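(* Assume $\mathcal{F}\subseteq{}^{\omega}\omega$ is a spread family. Let $\langle\mathbb{P}_\alpha,\dot{\mathbb{Q}}_\alpha:\alpha<\gamma\rangle$ be a finite support iteration of forcing notions, with limit $\mathbb{P}_\gamma$, such that for each $\alpha<\gamma$: (1) $\Vdash_{\mathbb{P}_\alpha}$ "$\mathcal{F}$ is spread", and (2) $\Vdash_{\mathbb{P}_\alpha}$ "$\dot{\mathbb{Q}}_\alpha$ is $\mathcal{F}$-sweet". Then $\mathbb{P}_\gamma$ is $\mathcal{F}$-sweet (and consequently, $\Vdash_{\mathbb{P}_\gamma}$ "$\mathcal{F}$ is a spread family").
   Context: Convention: in forcing notions a stronger condition is the larger one; $\Gamma_{\mathbb{P}}$ is the canonical $\mathbb{P}$-name for the generic filter. $\exists^\infty i$ means "for infinitely many $i$". ${}^{\omega}\omega$ is the set of functions from $\omega$ to $\omega$, and $[\omega_1]^{\aleph_1}$ is the set of subsets of $\omega_1$ of size $\aleph_1$. An uncountable family $\mathcal{F}\subseteq{}^{\omega}\omega$ is called spread if: for each $k^*,n^*<\omega$ and each sequence $\langle f_{\alpha,n}:\alpha<\omega_1,\ n<n^*\rangle$ of pairwise distinct elements of $\mathcal{F}$ there are an increasing sequence $\langle\alpha_i:i<\omega\rangle\subseteq\omega_1$ and an integer $k>k^*$ such that for all $i<\omega$ and all $n<n^*$, $f_{\alpha_i,n}(k)<f_{\alpha_{i+1},n}(k)$. Let $\mathcal{F}$ be a spread family. A forcing notion $\mathbb{P}$ is $\mathcal{F}$-sweet if for each sequence $\langle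 p_\alpha:\alpha<\omega_1\rangle\subseteq\mathbb{P}$ there are $A\in[\omega_1]^{\aleph_1}$, $k^*<\omega$, $n^*<\omega$ and a sequence $\langle f_{\alpha,n}:n<n^*,\ \alpha\in A\rangle\subseteq\mathcal{F}$ such that $(\alpha,n)\neq(\alpha',n')$ implies $f_{\alpha,n}\neq f_{\alpha',n'}$, and: if $\langle\alpha_i:i<\omega\rangle$ is an increasing sequence of elements of $A$ such that for some $k\in(k^*,\omega)$ we have $f_{\alpha_i,n}(k)<f_{\alpha_{i+1},n}(k)$ for all $i<\omega$ and $n<n^*$, then there is $p\in\mathbb{P}$ such that $p\Vdash(\exists^\infty i\in\omega)(p_{\alpha_i}\in\Gamma_{\mathbb{P}})$. *)

theory Defs
  imports "HOL-Library.Countable_Set"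
begin

unbundle cardinal_syntax

section \<open>Spread families and sweet forcing notions in the ground model\<close>

text \<open>A forcing notion is a relation \<open>R\<close> with underlying set \<open>Field R\<close>;
  \<open>(p, q) \<in> R\<close> means \<open>p \<le> q\<close>, that is, \<open>q\<close> is the stronger condition.\<close>

definition forcing_notion :: "'p rel \<Rightarrow> bool" where
  "forcing_notion R \<longleftrightarrow> Preorder R \<and> R \<noteq> {}"

text \<open>The cardinal successor of \<open>natLeq\<close> is a well-order of type \<open>\<omega>\<^sub>1\<close>; the elements of
  its field serve as the countable ordinals.\<close>

abbreviation omega1 :: "nat set rel" where
  "omega1 \<equiv> cardSuc natLeq"

definition increasing :: "(nat \<Rightarrow> nat set) \<Rightarrow> bool" where
  "increasing s \<longleftrightarrow> (\<forall>i. (s i, s (Suc i)) \<in> omega1 - Id)"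

definition grows :: "(nat \<Rightarrow> nat set) \<Rightarrow> (nat set \<Rightarrow> nat \<Rightarrow> nat \<Rightarrow> nat) \<Rightarrow> nat \<Rightarrow> nat \<Rightarrow> bool" where
  "grows s f k nstar \<longleftrightarrow> (\<forall>i. \<forall>n<nstar. f (s i) n k < f (s (Suc i)) n k)"

definition spread :: "(nat \<Rightarrow> nat) set \<Rightarrow> bool" where
  "spread F \<longleftrightarrow> uncountable F \<and>
    (\<forall>kstar nstar f.
      (\<forall>\<alpha>\<in>Field omega1. \<forall>n<nstar. f \<alpha> n \<in> F) \<longrightarrow>
      inj_on (\<lambda>(\<alpha>, n). f \<alpha> n) (Field omega1 \<times> {..<nstar}) \<longrightarrow>
      (\<exists>s k. increasing s \<and> k > kstar \<and> grows s f k nstar))"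

text \<open>The forcing relation for \<open>x \<in> \<Gamma>\<close> and for \<open>\<exists>\<^sup>\<infinity>i. x\<^sub>i \<in> \<Gamma>\<close>, where \<open>x\<close> and the sequence of
  the \<open>x\<^sub>i\<close> are in the ground model: since \<open>\<Gamma>\<close> is the name \<open>{(y, y) | y \<in> R}\<close> (with check
  names on the left), \<open>p\<close> forces \<open>x \<in> \<Gamma>\<close> iff the conditions above \<open>x\<close> are dense above \<open>p\<close>.\<close>

definition forces_gen :: "'p rel \<Rightarrow> 'p \<Rightarrow> 'p \<Rightarrow> bool" where
  "forces_gen R p x \<longleftrightarrow> (\<forall>q. (p, q) \<in> R \<longrightarrow> (\<exists>r. (q, r) \<in> R \<and> (x, r) \<in> R))"

definition forces_inf_gen :: "'p rel \<Rightarrow> 'p \<Rightarrow> (nat \<Rightarrow> 'p) \<Rightarrow> bool" where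
  "forces_inf_gen R p x \<longleftrightarrow>
    (\<forall>m q. (p, q) \<in> R \<longrightarrow> (\<exists>r i. (q, r) \<in> R \<and> m < i \<and> forces_gen R r (x i)))"

definition sweet :: "(nat \<Rightarrow> nat) set \<Rightarrow> 'p rel \<Rightarrow> bool" where
  "sweet F R \<longleftrightarrow> forcing_notion R \<and>
    (\<forall>p. (\<forall>\<alpha>\<in>Field omega1. p \<alpha> \<in> Field R) \<longrightarrow>
      (\<exists>A kstar nstar f.
        A \<subseteq> Field omega1 \<and> |A| =o omega1 \<and>
        (\<forall>\<alpha>\<in>A. \<forall>n<nstar. f \<alpha> n \<in> F) \<and>
        inj_on (\<lambda>(\<alpha>, n). f \<alpha> n) (A \<times> {..<nstar}) \<and>
        (\<forall>s. range s \<subseteq> A \<longrightarrow> increasing s \<longrightarrow> (\<exists>k>kstar. grows s f k nstar) \<longrightarrow>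
          (\<exists>r\<in>Field R. forces_inf_gen R r (\<lambda>i. p (s i))))))"


section \<open>Names\<close>

text \<open>
  A condition of an iteration indexed by \<open>'a\<close> is a partial function assigning names to finitely
  many indices, and a name is a set of pairs (name, condition).  Both are built simultaneously.
  Since a datatype cannot recurse through the full powerset, a name is given by an enumeration of
  its pairs along an index type \<open>'a + 'i + (nat \<Rightarrow> nat)\<close>; with \<open>\<kappa>\<close> the cardinality of that type,
  \<open>nm\<close> contains exactly the names of hereditary cardinality at most \<open>\<kappa>\<close>.  The type \<open>'i\<close> is
  arbitrary, so every given set of names fits into some instance.

  The forcing relation below lets quantifiers range over these names, so it describes
  \<open>H(\<kappa>\<^sup>+)\<close> of the generic extension.  This agrees with the extension itself for the
  statements considered.  The posets \<open>P \<alpha>\<close> of an iteration have at most \<open>\<kappa>\<close> conditions, so every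
  set of hereditary cardinality at most \<open>\<kappa>\<close> in the extension has a name here, and \<open>F\<close> is such a
  set because \<open>\<kappa>\<close> is at least the continuum.  In particular \<open>F\<close> is uncountable in \<open>H(\<kappa>\<^sup>+)\<close> iff it
  is so in the extension, and in that case the \<open>\<omega>\<^sub>1\<close> of the extension is at most \<open>\<kappa>\<close>, and all the
  sequences, sets and bijections quantified over have hereditary cardinality at most \<open>\<kappa>\<close>.
\<close>

datatype ('a, 'i) nm =
  Nm "('a + 'i + (nat \<Rightarrow> nat)) \<Rightarrow> (('a, 'i) nm \<times> ('a \<Rightarrow> ('a, 'i) nm option)) option"

type_synonym ('a, 'i) cond = "'a \<Rightarrow> ('a, 'i) nm option"

fun elts :: "('a, 'i) nm \<Rightarrow> (('a, 'i) nm \<times> ('a, 'i) cond) set" where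
  "elts (Nm f) = {z. Some z \<in> range f}"

text \<open>Used only for sets \<open>X\<close> not larger than the index type, see \<open>elts_nm_of\<close>.\<close>

definition nm_of :: "(('a, 'i) nm \<times> ('a, 'i) cond) set \<Rightarrow> ('a, 'i) nm" where
  "nm_of X = (SOME x. elts x = X)"

lemma elts_nm_of:
  fixes X :: "(('a, 'i) nm \<times> ('a, 'i) cond) set"
  assumes "|X| \<le>o |UNIV :: ('a + 'i + (nat \<Rightarrow> nat)) set|"
  shows "elts (nm_of X) = X"
proof -
  obtain g :: "_ \<Rightarrow> 'a + 'i + (nat \<Rightarrow> nat)" where g: "inj_on g X"
    using assms by (auto simp: card_of_ordLeq[symmetric])
  define f where "f = (\<lambda>i. if i \<in> g ` X then Some (inv_into X g i) else None)"
  have "elts (Nm f) = X"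
    using g by (auto simp: f_def image_iff inv_into_f_f split: if_splits intro: inv_into_into)
  then show ?thesis
    unfolding nm_of_def by (rule someI)
qed

inductive is_name :: "('a, 'i) cond rel \<Rightarrow> ('a, 'i) nm \<Rightarrow> bool" for R where
  "(\<And>y c. (y, c) \<in> elts x \<Longrightarrow> is_name R y \<and> c \<in> Field R) \<Longrightarrow> is_name R x"

text \<open>In the posets of an iteration the empty condition is the weakest one.\<close>

definition upair :: "('a, 'i) nm \<Rightarrow> ('a, 'i) nm \<Rightarrow> ('a, 'i) nm" where
  "upair x y = nm_of {(x, Map.empty), (y, Map.empty)}"

definition opair :: "('a, 'i) nm \<Rightarrow> ('a, 'i) nm \<Rightarrow> ('a, 'i) nm" where
  "opair x y = upair (upair x x) (upair x y)"

primrec check_nat :: "nat \<Rightarrow> ('a, 'i) nm" where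
  "check_nat 0 = nm_of {}"
| "check_nat (Suc n) = nm_of (insert (check_nat n, Map.empty) (elts (check_nat n)))"

definition check_omega :: "('a, 'i) nm" where
  "check_omega = nm_of (range (\<lambda>n. (check_nat n, Map.empty)))"

definition check_fun :: "(nat \<Rightarrow> nat) \<Rightarrow> ('a, 'i) nm" where
  "check_fun f = nm_of (range (\<lambda>n. (opair (check_nat n) (check_nat (f n)), Map.empty)))"

definition check_family :: "(nat \<Rightarrow> nat) set \<Rightarrow> ('a, 'i) nm" where
  "check_family F = nm_of ((\<lambda>f. (check_fun f, Map.empty)) ` F)"


section \<open>The forcing relation\<close>

text \<open>A formula of the forcing language (with names as parameters) is identified with the set of
  the conditions forcing it.  The primitives are equality, membership, conjunction, negation and
  the universal quantifier over names; everything else is a classical abbreviation.\<close>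

type_synonym ('a, 'i) fml = "('a, 'i) cond \<Rightarrow> bool"

definition f_and :: "('a, 'i) fml \<Rightarrow> ('a, 'i) fml \<Rightarrow> ('a, 'i) fml"  (infixr "\<^bold>\<and>" 35) where
  "(\<phi> \<^bold>\<and> \<psi>) p \<longleftrightarrow> \<phi> p \<and> \<psi> p"

context
  fixes R :: "('a, 'i) cond rel"
begin

text \<open>The usual recursion over names.  The recursive calls are positive and concern elements of
  the two names, so the inductive predicate is the unique solution of the recursion equation.\<close>

inductive f_eq :: "('a, 'i) nm \<Rightarrow> ('a, 'i) nm \<Rightarrow> ('a, 'i) fml"  (infix "\<^bold>=" 50) where
  "(\<And>u c q. (u, c) \<in> elts x \<Longrightarrow> (p, q) \<in> R \<Longrightarrow>
      \<exists>r. (q, r) \<in> R \<and> ((c, r) \<in> R \<longrightarrow> (\<exists>v d. (v, d) \<in> elts y \<and> (d, r) \<in> R \<and> (u \<^bold>= v) r))) \<Longrightarrow>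
   (\<And>v d q. (v, d) \<in> elts y \<Longrightarrow> (p, q) \<in> R \<Longrightarrow>
      \<exists>r. (q, r) \<in> R \<and> ((d, r) \<in> R \<longrightarrow> (\<exists>u c. (u, c) \<in> elts x \<and> (c, r) \<in> R \<and> (u \<^bold>= v) r))) \<Longrightarrow>
   (x \<^bold>= y) p"

definition f_mem :: "('a, 'i) nm \<Rightarrow> ('a, 'i) nm \<Rightarrow> ('a, 'i) fml"  (infix "\<^bold>\<in>" 50) where
  "(x \<^bold>\<in> y) p \<longleftrightarrow>
    (\<forall>q. (p, q) \<in> R \<longrightarrow>
      (\<exists>r. (q, r) \<in> R \<and> (\<exists>v d. (v, d) \<in> elts y \<and> (d, r) \<in> R \<and> (x \<^bold>= v) r)))"

definition f_not :: "('a, 'i) fml \<Rightarrow> ('a, 'i) fml"  ("\<^bold>\<not> _" [40] 40) where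
  "(\<^bold>\<not> \<phi>) p \<longleftrightarrow> (\<forall>q. (p, q) \<in> R \<longrightarrow> \<not> \<phi> q)"

definition f_all :: "(('a, 'i) nm \<Rightarrow> ('a, 'i) fml) \<Rightarrow> ('a, 'i) fml"  (binder "\<^bold>\<forall>" 10) where
  "(\<^bold>\<forall>x. \<phi> x) p \<longleftrightarrow> (\<forall>x. is_name R x \<longrightarrow> \<phi> x p)"

definition f_imp :: "('a, 'i) fml \<Rightarrow> ('a, 'i) fml \<Rightarrow> ('a, 'i) fml"  (infixr "\<^bold>\<longrightarrow>" 25) where
  "(\<phi> \<^bold>\<longrightarrow> \<psi>) = (\<^bold>\<not> (\<phi> \<^bold>\<and> \<^bold>\<not> \<psi>))"

definition f_or :: "('a, 'i) fml \<Rightarrow> ('a, 'i) fml \<Rightarrow> ('a, 'i) fml"  (infixr "\<^bold>\<or>" 30) where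
  "(\<phi> \<^bold>\<or> \<psi>) = (\<^bold>\<not> (\<^bold>\<not> \<phi> \<^bold>\<and> \<^bold>\<not> \<psi>))"

definition f_iff :: "('a, 'i) fml \<Rightarrow> ('a, 'i) fml \<Rightarrow> ('a, 'i) fml"  (infix "\<^bold>\<longleftrightarrow>" 25) where
  "(\<phi> \<^bold>\<longleftrightarrow> \<psi>) = ((\<phi> \<^bold>\<longrightarrow> \<psi>) \<^bold>\<and> (\<psi> \<^bold>\<longrightarrow> \<phi>))"

definition f_ex :: "(('a, 'i) nm \<Rightarrow> ('a, 'i) fml) \<Rightarrow> ('a, 'i) fml"  (binder "\<^bold>\<exists>" 10) where
  "(\<^bold>\<exists>x. \<phi> x) = (\<^bold>\<not> (\<^bold>\<forall>x. \<^bold>\<not> \<phi> x))"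

definition forced :: "('a, 'i) fml \<Rightarrow> bool" where
  "forced \<phi> \<longleftrightarrow> (\<forall>p\<in>Field R. \<phi> p)"


subsection \<open>Set-theoretic notions in the forcing language\<close>

text \<open>Natural numbers are von Neumann ordinals, so \<open><\<close> on \<open>\<omega>\<close> and on \<open>\<omega>\<^sub>1\<close> is membership.\<close>

definition f_subset :: "('a, 'i) nm \<Rightarrow> ('a, 'i) nm \<Rightarrow> ('a, 'i) fml" where
  "f_subset x y = (\<^bold>\<forall>z. z \<^bold>\<in> x \<^bold>\<longrightarrow> z \<^bold>\<in> y)"

definition f_suc :: "('a, 'i) nm \<Rightarrow> ('a, 'i) nm \<Rightarrow> ('a, 'i) fml" where
  "f_suc i j = (\<^bold>\<forall>z. z \<^bold>\<in> j \<^bold>\<longleftrightarrow> (z \<^bold>\<in> i \<^bold>\<or> z \<^bold>= i))"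

definition f_times :: "('a, 'i) nm \<Rightarrow> ('a, 'i) nm \<Rightarrow> ('a, 'i) nm \<Rightarrow> ('a, 'i) fml" where
  "f_times A B z = (\<^bold>\<exists>x y. x \<^bold>\<in> A \<^bold>\<and> y \<^bold>\<in> B \<^bold>\<and> z \<^bold>= opair x y)"

text \<open>\<open>f\<close> is a function from the class \<open>D\<close> to the set \<open>B\<close>.\<close>

definition f_fun ::
    "('a, 'i) nm \<Rightarrow> (('a, 'i) nm \<Rightarrow> ('a, 'i) fml) \<Rightarrow> ('a, 'i) nm \<Rightarrow> ('a, 'i) fml" where
  "f_fun f D B =
    ((\<^bold>\<forall>z. z \<^bold>\<in> f \<^bold>\<longrightarrow> (\<^bold>\<exists>x y. D x \<^bold>\<and> y \<^bold>\<in> B \<^bold>\<and> z \<^bold>= opair x y)) \<^bold>\<and>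
     (\<^bold>\<forall>x. D x \<^bold>\<longrightarrow> (\<^bold>\<exists>y. opair x y \<^bold>\<in> f)) \<^bold>\<and>
     (\<^bold>\<forall>x y y'. opair x y \<^bold>\<in> f \<^bold>\<longrightarrow> opair x y' \<^bold>\<in> f \<^bold>\<longrightarrow> y \<^bold>= y'))"

definition f_inj :: "('a, 'i) nm \<Rightarrow> ('a, 'i) fml" where
  "f_inj f = (\<^bold>\<forall>x x' y. opair x y \<^bold>\<in> f \<^bold>\<longrightarrow> opair x' y \<^bold>\<in> f \<^bold>\<longrightarrow> x \<^bold>= x')"

definition f_countable :: "('a, 'i) nm \<Rightarrow> ('a, 'i) fml" where
  "f_countable X = (\<^bold>\<exists>h. f_fun h (\<lambda>x. x \<^bold>\<in> X) check_omega \<^bold>\<and> f_inj h)"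

definition f_equipotent :: "('a, 'i) nm \<Rightarrow> ('a, 'i) nm \<Rightarrow> ('a, 'i) fml" where
  "f_equipotent X Y =
    (\<^bold>\<exists>h. f_fun h (\<lambda>x. x \<^bold>\<in> X) Y \<^bold>\<and> f_inj h \<^bold>\<and> (\<^bold>\<forall>y. y \<^bold>\<in> Y \<^bold>\<longrightarrow> (\<^bold>\<exists>x. opair x y \<^bold>\<in> h)))"

text \<open>\<open>W\<close> is the \<open>\<omega>\<^sub>1\<close> of the generic extension, i.e. the least uncountable ordinal there.\<close>

definition f_omega1 :: "('a, 'i) nm \<Rightarrow> ('a, 'i) fml" where
  "f_omega1 W =
    ((\<^bold>\<forall>x. x \<^bold>\<in> W \<^bold>\<longrightarrow> f_subset x W) \<^bold>\<and>
     (\<^bold>\<forall>x y. x \<^bold>\<in> W \<^bold>\<longrightarrow> y \<^bold>\<in> x \<^bold>\<longrightarrow> f_subset y x) \<^bold>\<and>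
     (\<^bold>\<not> f_countable W) \<^bold>\<and>
     (\<^bold>\<forall>x. x \<^bold>\<in> W \<^bold>\<longrightarrow> f_countable x))"

definition f_increasing :: "('a, 'i) nm \<Rightarrow> ('a, 'i) fml" where
  "f_increasing s =
    (\<^bold>\<forall>i j \<alpha> \<beta>. i \<^bold>\<in> check_omega \<^bold>\<longrightarrow> f_suc i j \<^bold>\<longrightarrow> opair i \<alpha> \<^bold>\<in> s \<^bold>\<longrightarrow> opair j \<beta> \<^bold>\<in> s \<^bold>\<longrightarrow> \<alpha> \<^bold>\<in> \<beta>)"

definition f_less_at :: "('a, 'i) nm \<Rightarrow> ('a, 'i) nm \<Rightarrow> ('a, 'i) nm \<Rightarrow> ('a, 'i) fml" where
  "f_less_at u v k = (\<^bold>\<exists>a b. opair k a \<^bold>\<in> u \<^bold>\<and> opair k b \<^bold>\<in> v \<^bold>\<and> a \<^bold>\<in> b)"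

definition f_grows ::
    "('a, 'i) nm \<Rightarrow> ('a, 'i) nm \<Rightarrow> ('a, 'i) nm \<Rightarrow> ('a, 'i) nm \<Rightarrow> ('a, 'i) fml" where
  "f_grows s f k nstar =
    (\<^bold>\<forall>i j n \<alpha> \<beta> u v. i \<^bold>\<in> check_omega \<^bold>\<longrightarrow> f_suc i j \<^bold>\<longrightarrow> n \<^bold>\<in> nstar \<^bold>\<longrightarrow>
       opair i \<alpha> \<^bold>\<in> s \<^bold>\<longrightarrow> opair j \<beta> \<^bold>\<in> s \<^bold>\<longrightarrow>
       opair (opair \<alpha> n) u \<^bold>\<in> f \<^bold>\<longrightarrow> opair (opair \<beta> n) v \<^bold>\<in> f \<^bold>\<longrightarrow> f_less_at u v k)"

definition f_spread :: "('a, 'i) nm \<Rightarrow> ('a, 'i) fml" where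
  "f_spread F =
    ((\<^bold>\<not> f_countable F) \<^bold>\<and>
     (\<^bold>\<forall>W kstar nstar f.
       f_omega1 W \<^bold>\<longrightarrow> kstar \<^bold>\<in> check_omega \<^bold>\<longrightarrow> nstar \<^bold>\<in> check_omega \<^bold>\<longrightarrow>
       f_fun f (f_times W nstar) F \<^bold>\<longrightarrow> f_inj f \<^bold>\<longrightarrow>
       (\<^bold>\<exists>s k. f_fun s (\<lambda>i. i \<^bold>\<in> check_omega) W \<^bold>\<and> f_increasing s \<^bold>\<and>
          k \<^bold>\<in> check_omega \<^bold>\<and> kstar \<^bold>\<in> k \<^bold>\<and> f_grows s f k nstar)))"


subsection \<open>Forcing notions in the generic extension\<close>

text \<open>A forcing notion of the extension is given by names \<open>Q\<close> for its underlying set and \<open>L\<close> for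
  its order; \<open>opair x y \<^bold>\<in> L\<close> says \<open>x \<le> y\<close>.\<close>

definition f_forcing_notion :: "('a, 'i) nm \<Rightarrow> ('a, 'i) nm \<Rightarrow> ('a, 'i) fml" where
  "f_forcing_notion Q L =
    ((\<^bold>\<exists>x. x \<^bold>\<in> Q) \<^bold>\<and>
     (\<^bold>\<forall>x. x \<^bold>\<in> Q \<^bold>\<longrightarrow> opair x x \<^bold>\<in> L) \<^bold>\<and>
     (\<^bold>\<forall>x y z. x \<^bold>\<in> Q \<^bold>\<longrightarrow> y \<^bold>\<in> Q \<^bold>\<longrightarrow> z \<^bold>\<in> Q \<^bold>\<longrightarrow>
        opair x y \<^bold>\<in> L \<^bold>\<longrightarrow> opair y z \<^bold>\<in> L \<^bold>\<longrightarrow> opair x z \<^bold>\<in> L))"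

text \<open>The next two formulas are the internal versions of \<^const>\<open>forces_gen\<close> and
  \<^const>\<open>forces_inf_gen\<close>; in the second one the sequence is \<open>p \<circ> s\<close>.\<close>

definition f_forces_gen ::
    "('a, 'i) nm \<Rightarrow> ('a, 'i) nm \<Rightarrow> ('a, 'i) nm \<Rightarrow> ('a, 'i) nm \<Rightarrow> ('a, 'i) fml" where
  "f_forces_gen Q L r x =
    (\<^bold>\<forall>u. u \<^bold>\<in> Q \<^bold>\<longrightarrow> opair r u \<^bold>\<in> L \<^bold>\<longrightarrow>
       (\<^bold>\<exists>v. v \<^bold>\<in> Q \<^bold>\<and> opair u v \<^bold>\<in> L \<^bold>\<and> opair x v \<^bold>\<in> L))"

definition f_forces_inf_gen ::
    "('a, 'i) nm \<Rightarrow> ('a, 'i) nm \<Rightarrow> ('a, 'i) nm \<Rightarrow> ('a, 'i) nm \<Rightarrow> ('a, 'i) nm \<Rightarrow> ('a, 'i) fml" where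
  "f_forces_inf_gen Q L r p s =
    (\<^bold>\<forall>m q. m \<^bold>\<in> check_omega \<^bold>\<longrightarrow> q \<^bold>\<in> Q \<^bold>\<longrightarrow> opair r q \<^bold>\<in> L \<^bold>\<longrightarrow>
       (\<^bold>\<exists>t i \<alpha> x. t \<^bold>\<in> Q \<^bold>\<and> opair q t \<^bold>\<in> L \<^bold>\<and> i \<^bold>\<in> check_omega \<^bold>\<and> m \<^bold>\<in> i \<^bold>\<and>
          opair i \<alpha> \<^bold>\<in> s \<^bold>\<and> opair \<alpha> x \<^bold>\<in> p \<^bold>\<and> f_forces_gen Q L t x))"

definition f_sweet :: "('a, 'i) nm \<Rightarrow> ('a, 'i) nm \<Rightarrow> ('a, 'i) nm \<Rightarrow> ('a, 'i) fml" where
  "f_sweet F Q L =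
    (f_forcing_notion Q L \<^bold>\<and>
     (\<^bold>\<forall>W p. f_omega1 W \<^bold>\<longrightarrow> f_fun p (\<lambda>\<alpha>. \<alpha> \<^bold>\<in> W) Q \<^bold>\<longrightarrow>
       (\<^bold>\<exists>A kstar nstar f.
         f_subset A W \<^bold>\<and> f_equipotent A W \<^bold>\<and>
         kstar \<^bold>\<in> check_omega \<^bold>\<and> nstar \<^bold>\<in> check_omega \<^bold>\<and>
         f_fun f (f_times A nstar) F \<^bold>\<and> f_inj f \<^bold>\<and>
         (\<^bold>\<forall>s. f_fun s (\<lambda>i. i \<^bold>\<in> check_omega) A \<^bold>\<longrightarrow> f_increasing s \<^bold>\<longrightarrow>
           (\<^bold>\<exists>k. k \<^bold>\<in> check_omega \<^bold>\<and> kstar \<^bold>\<in> k \<^bold>\<and> f_grows s f k nstar) \<^bold>\<longrightarrow>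
           (\<^bold>\<exists>r. r \<^bold>\<in> Q \<^bold>\<and> f_forces_inf_gen Q L r p s)))))"

end


section \<open>Finite support iterations\<close>

text \<open>
  \<open>P \<alpha>\<close> (for \<open>\<alpha> \<le> \<gamma>\<close>) consists of the finite partial functions \<open>p\<close> on the indices below \<open>\<alpha>\<close> such
  that, for each \<open>\<beta>\<close> in its domain, \<open>p \<beta>\<close> is a name from the domain of the name \<open>Q \<beta>\<close> and the
  restriction of \<open>p\<close> to \<open>\<beta>\<close> is a condition of \<open>P \<beta>\<close> which forces \<open>p \<beta> \<in> Q \<beta>\<close>; coordinates
  outside the domain carry no information, so the \<open>Q \<beta>\<close> need not have weakest elements.  The index order \<open>'a\<close> is an arbitrary well-order, so
  \<open>\<gamma>\<close> is an arbitrary ordinal.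
\<close>

definition iter_conds ::
    "('a::wellorder \<Rightarrow> ('a, 'i) cond rel) \<Rightarrow> ('a \<Rightarrow> ('a, 'i) nm) \<Rightarrow> 'a \<Rightarrow> ('a, 'i) cond set" where
  "iter_conds P Q \<alpha> =
    {p. finite (dom p) \<and> dom p \<subseteq> {..<\<alpha>} \<and>
        (\<forall>\<beta>\<in>dom p. p |` {..<\<beta>} \<in> Field (P \<beta>) \<and>
           the (p \<beta>) \<in> fst ` elts (Q \<beta>) \<and>
           f_mem (P \<beta>) (the (p \<beta>)) (Q \<beta>) (p |` {..<\<beta>}))}"

definition fs_iteration ::
    "'a::wellorder \<Rightarrow> ('a \<Rightarrow> ('a, 'i) cond rel) \<Rightarrow> ('a \<Rightarrow> ('a, 'i) nm) \<Rightarrow> ('a \<Rightarrow> ('a, 'i) nm) \<Rightarrow> bool"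
  where
  "fs_iteration \<gamma> P Q L \<longleftrightarrow>
    (\<forall>\<alpha>\<le>\<gamma>. P \<alpha> =
       {(p, q). p \<in> iter_conds P Q \<alpha> \<and> q \<in> iter_conds P Q \<alpha> \<and> dom p \<subseteq> dom q \<and>
          (\<forall>\<beta>\<in>dom p. f_mem (P \<beta>) (opair (the (p \<beta>)) (the (q \<beta>))) (L \<beta>) (q |` {..<\<beta>}))}) \<and>
    (\<forall>\<alpha><\<gamma>. is_name (P \<alpha>) (Q \<alpha>) \<and> is_name (P \<alpha>) (L \<alpha>) \<and>
       forced (P \<alpha>) (f_forcing_notion (P \<alpha>) (Q \<alpha>) (L \<alpha>)))"

end

theory Submission imports Defs "HOL-Library.Countable_Set_Type" begin

text \<open>
  Every \<open>P \<alpha>\<close> with \<open>\<alpha> \<le> \<gamma>\<close> is shown to be sweet, by strong induction on \<open>\<alpha>\<close> (\<open>sweet_iteration\<close>).  Two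
  consequences of sweetness over a spread family \<open>F\<close> are used on the way.

  First, a sweet forcing notion satisfies the countable chain condition (\<open>ccc_poset_if_sweet\<close>): among
  \<open>\<omega>\<^sub>1\<close> conditions there is a sequence infinitely many of whose members can be forced into the generic
  filter, and two of these are compatible.

  Second, \<open>F\<close> remains spread in the extension (\<open>forced_spread_if_sweet\<close>).  Given a name for \<open>\<omega>\<^sub>1\<close> many
  \<open>n\<close>-tuples from \<open>F\<close>, let \<open>r \<xi>\<close> decide the \<open>\<xi>\<close>-th tuple.  Compatible conditions decide different
  functions at different places, so by the chain condition the decided functions are pairwise distinct after
  thinning out, and together with the functions that witness sweetness for the sequence of the \<open>r \<xi>\<close> they form one
  injective family (\<open>thin_and_grow\<close>).  Spread in the ground model yields an increasing sequence of \<open>\<xi>\<close>'s along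
  which the whole family grows at some \<open>k\<close>.  Then a condition forces that infinitely many of the
  corresponding \<open>r \<xi>\<close> are generic; in the extension the \<open>\<xi>\<close>'s with \<open>r \<xi>\<close> generic form the required
  increasing sequence (\<open>generic_subsequence\<close>).

  For the induction step take \<open>\<omega>\<^sub>1\<close> conditions \<open>p x\<close> of \<open>P \<alpha>\<close> whose domains form a \<open>\<Delta>\<close>-system with root
  \<open>D\<close>.  Outside \<open>D\<close> a given condition meets the domains of only finitely many members of a sequence of
  \<open>p x\<close>'s, so if \<open>D\<close> is empty, the empty condition already forces infinitely many of them to be generic.
  Otherwise let \<open>\<beta>\<close> be the maximum of \<open>D\<close>.  For almost all members the part above \<open>\<beta>\<close> can be amalgamated with the given condition, so only the restrictions to \<open>\<beta>\<close>
  and the values at \<open>\<beta>\<close> matter, and successor and limit \<open>\<alpha>\<close> are treated alike.  This leaves the two-step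
  iteration of \<open>P \<beta>\<close> and \<open>Q \<beta>\<close> (\<open>two_step\<close>): sweetness of \<open>Q \<beta>\<close> in the extension is applied to the values at
  \<open>\<beta>\<close> of those \<open>p x\<close> whose restrictions are generic, and the uncountable set and the functions that it
  provides are decided by conditions of \<open>P \<beta>\<close>, to which the argument of the previous paragraph applies.

  Forcing is developed for names of bounded hereditary size.  The chain condition makes it possible to name the
  sets required: where a condition is to be attached to an element, countably many conditions suffice
  (\<open>comp_name\<close>).  It also ensures that the \<open>\<omega>\<^sub>1\<close> of the extension is that of the ground model
  (\<open>f_omega1_check_w1\<close>, \<open>f_omega1_unique\<close>), so that names for sequences of length \<open>\<omega>\<^sub>1\<close> can be read at ground model
  ordinals.
\<close>

section \<open>The countable ordinals as a type\<close>

lemma Card_order_omega1: "Card_order omega1"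
  by (simp add: cardSuc_Card_order natLeq_Card_order)

lemma Well_order_omega1: "Well_order omega1"
  using Card_order_omega1 by (auto simp: card_order_on_def)

lemma Field_omega1_ordIso: "|Field omega1| =o omega1"
  by (rule card_of_Field_ordIso[OF Card_order_omega1])

lemma uncountable_iff_ordIso_omega1:
  assumes "A \<subseteq> Field omega1"
  shows "|A| =o omega1 \<longleftrightarrow> uncountable A"
proof -
  have "uncountable A \<longleftrightarrow> natLeq <o |A|"
    using not_ordLeq_iff_ordLess[OF natLeq_Well_order card_of_Well_order, of A]
    by (simp add: countable_card_le_natLeq)
  also have "\<dots> \<longleftrightarrow> omega1 \<le>o |A|"
    by (rule cardSuc_ordLess_ordLeq[OF natLeq_Card_order card_of_Card_order])
  also have "\<dots> \<longleftrightarrow> |A| =o omega1"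
    using ordLeq_ordIso_trans[OF card_of_mono1[OF assms] Field_omega1_ordIso]
    by (auto simp: ordIso_iff_ordLeq)
  finally show ?thesis ..
qed

lemma uncountable_Field_omega1: "uncountable (Field omega1)"
  using uncountable_iff_ordIso_omega1[OF order_refl] Field_omega1_ordIso by simp

text \<open>As a type of class \<^class>\<open>wellorder\<close> the countable ordinals come with well-founded recursion and least
  elements, and sets of them need not be relativised to \<^term>\<open>Field omega1\<close>.\<close>

typedef w1 = "Field omega1"
  using uncountable_Field_omega1 by (cases "Field omega1 = {}") auto

instantiation w1 :: wellorder
begin

definition less_eq_w1 :: "w1 \<Rightarrow> w1 \<Rightarrow> bool" where
  "x \<le> y \<longleftrightarrow> (Rep_w1 x, Rep_w1 y) \<in> omega1"

definition less_w1 :: "w1 \<Rightarrow> w1 \<Rightarrow> bool" where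
  "x < y \<longleftrightarrow> (Rep_w1 x, Rep_w1 y) \<in> omega1 - Id"

instance
proof
  have wo: "refl_on (Field omega1) omega1" "trans omega1" "antisym omega1"
    "total_on (Field omega1) omega1" "wf (omega1 - Id)"
    using Well_order_omega1
    by (auto simp: well_order_on_def linear_order_on_def partial_order_on_def preorder_on_def)
  fix x y z :: w1
  show "x < y \<longleftrightarrow> x \<le> y \<and> \<not> y \<le> x"
    using wo(3) Rep_w1_inject[of x y] refl_onD[OF wo(1) Rep_w1[of x]]
    by (auto simp: less_eq_w1_def less_w1_def antisym_def)
  show "x \<le> x"
    using wo(1) by (auto simp: less_eq_w1_def refl_on_def intro: Rep_w1)
  show "x \<le> y \<Longrightarrow> y \<le> z \<Longrightarrow> x \<le> z"
    using wo(2) by (auto simp: less_eq_w1_def dest: transD)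
  show "x \<le> y \<Longrightarrow> y \<le> x \<Longrightarrow> x = y"
    using wo(3) by (auto simp: less_eq_w1_def Rep_w1_inject dest: antisymD)
  show "x \<le> y \<or> y \<le> x"
    using wo(1,4) Rep_w1[of x] Rep_w1[of y]
    by (cases "x = y") (auto simp: less_eq_w1_def Rep_w1_inject total_on_def dest: refl_onD)
next
  have "wf (omega1 - Id)"
    using Well_order_omega1 by (auto simp: well_order_on_def)
  then have wf: "wf {(x, y :: w1). x < y}"
    unfolding less_w1_def by (rule wf_subset[OF wf_inv_image[of _ Rep_w1]]) (auto simp: inv_image_def)
  fix Q :: "w1 \<Rightarrow> bool" and a :: w1
  assume "\<And>x. (\<And>y. y < x \<Longrightarrow> Q y) \<Longrightarrow> Q x"
  then show "Q a"
    using wf_induct_rule[OF wf, of Q a] by auto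
qed

end

lemma increasing_Rep_w1_iff: "increasing (\<lambda>i. Rep_w1 (s i)) \<longleftrightarrow> strict_mono s"
  by (auto simp: increasing_def strict_mono_Suc_iff less_w1_def)

lemma uncountable_UNIV_w1: "uncountable (UNIV :: w1 set)"
proof
  assume "countable (UNIV :: w1 set)"
  then have "countable (range Rep_w1)" by (rule countable_image)
  then show False
    using uncountable_Field_omega1 by (simp add: type_definition.Rep_range[OF type_definition_w1])
qed

lemma countable_lessThan_w1: "countable {..<x :: w1}"
proof -
  have "|underS omega1 (Rep_w1 x)| <o omega1"
    using card_of_underS[OF Card_order_omega1 Rep_w1] .
  then have "countable (underS omega1 (Rep_w1 x))"
    by (simp add: countable_card_le_natLeq cardSuc_ordLeq_ordLess card_of_Card_order natLeq_Card_order)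
  moreover have "Rep_w1 ` {..<x} \<subseteq> underS omega1 (Rep_w1 x)"
    by (auto simp: underS_def less_w1_def)
  ultimately have "countable (Rep_w1 ` {..<x})" by (rule countable_subset[rotated])
  then show ?thesis by (rule countable_image_inj_on) (simp add: inj_on_def Rep_w1_inject)
qed

lemma countable_atMost_w1: "countable {..x :: w1}"
proof -
  have "{..x} = insert x {..<x}" by auto
  then show ?thesis using countable_lessThan_w1[of x] by simp
qed

lemma uncountable_Int_greaterThan:
  assumes "uncountable (B :: w1 set)"
  shows "\<exists>b\<in>B. x < b"
proof (rule ccontr)
  assume "\<not> ?thesis"
  then have "B \<subseteq> {..x}" by (auto simp: not_less)
  then show False using assms countable_atMost_w1 countable_subset by blast
qed

lemma countable_bounded_w1:
  assumes "countable (C :: w1 set)"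
  shows "\<exists>x. \<forall>c\<in>C. c < x"
proof -
  have "countable (\<Union>c\<in>C. {..c})"
    using assms by (simp add: countable_atMost_w1)
  then obtain x where "x \<notin> (\<Union>c\<in>C. {..c})"
    using uncountable_UNIV_w1 by (metis UNIV_eq_I)
  then show ?thesis by (auto simp: not_le)
qed

text \<open>An uncountable set of countable ordinals contains a copy of all of them: at each stage only
  countably many values have been used, and they are bounded.\<close>

lemma strict_mono_into_uncountable:
  assumes "uncountable (B :: w1 set)"
  shows "\<exists>e :: w1 \<Rightarrow> w1. strict_mono e \<and> range e \<subseteq> B"
proof -
  have "\<exists>e :: w1 \<Rightarrow> w1. \<forall>x. e x \<in> B \<and> (\<forall>y<x. e y < e x)"
  proof (rule dependent_wellorder_choice)
    fix x :: w1 and f :: "w1 \<Rightarrow> w1"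
    obtain z where z: "\<forall>c\<in>f ` {..<x}. c < z"
      using countable_bounded_w1[OF countable_image[OF countable_lessThan_w1]] by blast
    then show "\<exists>r. r \<in> B \<and> (\<forall>y<x. f y < r)"
      using uncountable_Int_greaterThan[OF assms, of z] by (auto intro: less_trans)
  qed auto
  then show ?thesis by (auto simp: strict_mono_def)
qed

section \<open>Thinning out uncountable families\<close>

lemma uncountable_fiber:
  fixes f :: "'a \<Rightarrow> 'b::countable"
  assumes "uncountable A"
  shows "\<exists>y. uncountable {x\<in>A. f x = y}"
proof (rule ccontr)
  assume "\<not> ?thesis"
  then have "countable (\<Union>y. {x\<in>A. f x = y})" by (intro countable_UN) auto
  moreover have "(\<Union>y. {x\<in>A. f x = y}) = A" by auto
  ultimately show False using assms by simp
qed

text \<open>By Zorn's lemma.  With compatibility as the conflict relation this gives maximal antichains; other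
  relations serve to thin out uncountable families.\<close>

lemma maximal_conflict_free:
  "\<exists>M\<subseteq>B. (\<forall>x\<in>M. \<forall>y\<in>M. x \<noteq> y \<longrightarrow> \<not> C x y) \<and> (\<forall>b\<in>B - M. \<exists>x\<in>M. C x b \<or> C b x)"
proof -
  define free where "free X \<longleftrightarrow> X \<subseteq> B \<and> (\<forall>x\<in>X. \<forall>y\<in>X. x \<noteq> y \<longrightarrow> \<not> C x y)" for X
  have free_Union: "free (\<Union>\<C>)" if ch: "subset.chain {X. free X} \<C>" for \<C>
  proof -
    have sub: "free X" if "X \<in> \<C>" for X
      using ch that unfolding subset_chain_def by blast
    have "\<not> C x y" if "x \<in> X" "X \<in> \<C>" "y \<in> Y" "Y \<in> \<C>" "x \<noteq> y" for x y X Y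
    proof -
      have "X \<subseteq> Y \<or> Y \<subseteq> X" using ch that unfolding subset_chain_def by blast
      then show ?thesis using sub[of X] sub[of Y] that unfolding free_def by blast
    qed
    then show ?thesis using sub unfolding free_def by (meson UnionE Union_least)
  qed
  have "free {}" by (simp add: free_def)
  then have "\<exists>M\<in>{X. free X}. \<forall>X\<in>{X. free X}. M \<subseteq> X \<longrightarrow> X = M"
    using free_Union by (intro subset_Zorn_nonempty) auto
  then obtain M where M: "free M" and max: "\<And>X. free X \<Longrightarrow> M \<subseteq> X \<Longrightarrow> X = M"
    by (metis mem_Collect_eq)
  have "\<exists>x\<in>M. C x b \<or> C b x" if b: "b \<in> B - M" for b
  proof (rule ccontr)
    assume "\<not> ?thesis"
    then have "free (insert b M)" using M b by (simp add: free_def)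
    with max[OF this] b show False by auto
  qed
  with M show ?thesis unfolding free_def by blast
qed

text \<open>A maximal conflict-free set cannot be countable, since the elements in conflict with one of its
  members would then be countably many.\<close>

lemma uncountable_conflict_free:
  assumes "uncountable B"
    and cnt: "\<And>x. x \<in> B \<Longrightarrow> countable {y\<in>B. C x y}"
    and sym: "\<And>x y. C x y \<Longrightarrow> C y x"
  shows "\<exists>A\<subseteq>B. uncountable A \<and> (\<forall>x\<in>A. \<forall>y\<in>A. x \<noteq> y \<longrightarrow> \<not> C x y)"
proof -
  obtain M where M: "M \<subseteq> B" "\<forall>x\<in>M. \<forall>y\<in>M. x \<noteq> y \<longrightarrow> \<not> C x y"
    and max: "\<forall>b\<in>B - M. \<exists>x\<in>M. C x b \<or> C b x"
    using maximal_conflict_free[of B C] by (elim exE conjE) (rule that)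
  have "uncountable M"
  proof
    assume "countable M"
    then have "countable (M \<union> (\<Union>x\<in>M. {y\<in>B. C x y}))"
      using M(1) cnt by auto
    moreover have "B \<subseteq> M \<union> (\<Union>x\<in>M. {y\<in>B. C x y})" using max sym by blast
    ultimately show False using assms(1) countable_subset by blast
  qed
  with M show ?thesis by (intro exI[of _ M] conjI)
qed

text \<open>Either some point lies in uncountably many of the sets, and is moved into the root; or each set meets
  only countably many of the others, and uncountably many of them are pairwise disjoint.\<close>

lemma uncountable_Delta_system_card:
  fixes S :: "'a \<Rightarrow> 'b set"
  assumes "uncountable B" and "\<And>x. x \<in> B \<Longrightarrow> finite (S x) \<and> card (S x) = n"
  shows "\<exists>A\<subseteq>B. uncountable A \<and> (\<exists>D. \<forall>x\<in>A. \<forall>y\<in>A. x \<noteq> y \<longrightarrow> S x \<inter> S y = D)"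
  using assms
proof (induction n arbitrary: S B)
  case (0 S B)
  have "S x = {}" if "x \<in> B" for x
  proof -
    have "finite (S x) \<and> card (S x) = 0" using 0(2)[OF that] .
    then show "S x = {}" by (elim conjE) simp
  qed
  then have "\<forall>x\<in>B. \<forall>y\<in>B. x \<noteq> y \<longrightarrow> S x \<inter> S y = {}" by simp
  then show ?case using 0(1) by (intro exI[of _ B] conjI exI[of _ "{}"] order_refl)
next
  case (Suc n S B)
  show ?case
  proof (cases "\<exists>z. uncountable {x\<in>B. z \<in> S x}")
    case True
    then obtain z where z: "uncountable {x\<in>B. z \<in> S x}" by blast
    have minus: "finite (S x - {z}) \<and> card (S x - {z}) = n" if "x \<in> {x\<in>B. z \<in> S x}" for x
      using that Suc.prems(2)[of x] by simp
    have "\<exists>A\<subseteq>{x\<in>B. z \<in> S x}. uncountable A \<and>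
        (\<exists>D. \<forall>x\<in>A. \<forall>y\<in>A. x \<noteq> y \<longrightarrow> (S x - {z}) \<inter> (S y - {z}) = D)"
      using z minus by (rule Suc.IH)
    then obtain A D where A: "A \<subseteq> {x\<in>B. z \<in> S x}" "uncountable A"
      "\<forall>x\<in>A. \<forall>y\<in>A. x \<noteq> y \<longrightarrow> (S x - {z}) \<inter> (S y - {z}) = D"
      by (elim exE conjE) (rule that)
    then have "\<forall>x\<in>A. \<forall>y\<in>A. x \<noteq> y \<longrightarrow> S x \<inter> S y = insert z D" by blast
    moreover have "A \<subseteq> B" using A(1) by blast
    ultimately show ?thesis using A(2) by (intro exI[of _ A] conjI exI[of _ "insert z D"])
  next
    case False
    have "\<exists>A\<subseteq>B. uncountable A \<and> (\<forall>x\<in>A. \<forall>y\<in>A. x \<noteq> y \<longrightarrow> \<not> S x \<inter> S y \<noteq> {})"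
    proof (rule uncountable_conflict_free[OF Suc.prems(1)])
      fix x assume "x \<in> B"
      have "{y\<in>B. S x \<inter> S y \<noteq> {}} = (\<Union>z\<in>S x. {y\<in>B. z \<in> S y})" by auto
      moreover have "countable (S x)" using Suc.prems(2)[OF \<open>x \<in> B\<close>] by (simp add: countable_finite)
      ultimately show "countable {y\<in>B. S x \<inter> S y \<noteq> {}}" using False by simp
    qed blast
    then obtain A where "A \<subseteq> B" "uncountable A" "\<forall>x\<in>A. \<forall>y\<in>A. x \<noteq> y \<longrightarrow> \<not> S x \<inter> S y \<noteq> {}"
      by (elim exE conjE) (rule that)
    then show ?thesis unfolding not_not by (intro exI[of _ A] conjI exI[of _ "{}"])
  qed
qed

lemma uncountable_Delta_system:
  fixes S :: "'a \<Rightarrow> 'b set"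
  assumes "uncountable B" and "\<And>x. x \<in> B \<Longrightarrow> finite (S x)"
  shows "\<exists>A\<subseteq>B. uncountable A \<and> (\<exists>D. \<forall>x\<in>A. \<forall>y\<in>A. x \<noteq> y \<longrightarrow> S x \<inter> S y = D)"
proof -
  obtain n where n: "uncountable {x\<in>B. card (S x) = n}"
    using uncountable_fiber[OF assms(1), of "\<lambda>x. card (S x)"] by blast
  have "\<exists>A\<subseteq>{x\<in>B. card (S x) = n}. uncountable A \<and>
      (\<exists>D. \<forall>x\<in>A. \<forall>y\<in>A. x \<noteq> y \<longrightarrow> S x \<inter> S y = D)"
    using n by (rule uncountable_Delta_system_card) (simp add: assms(2))
  then show ?thesis by (elim exE conjE) (intro exI conjI, auto)
qed

text \<open>Two injective families may overlap.  After thinning out, overlaps occur only within one index and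
  always at the same positions, so listing the common values once yields an injective family.\<close>

lemma combine_families:
  fixes g h :: "'a \<Rightarrow> nat \<Rightarrow> 'b"
  assumes "uncountable A"
    and g: "inj_on (\<lambda>(x, n). g x n) (A \<times> {..<N})" "\<And>x n. x \<in> A \<Longrightarrow> n < N \<Longrightarrow> g x n \<in> F"
    and h: "inj_on (\<lambda>(x, n). h x n) (A \<times> {..<M})" "\<And>x n. x \<in> A \<Longrightarrow> n < M \<Longrightarrow> h x n \<in> F"
  shows "\<exists>A'\<subseteq>A. uncountable A' \<and> (\<exists>(J :: nat) l. (\<forall>x\<in>A'. \<forall>n<J. l x n \<in> F) \<and>
      inj_on (\<lambda>(x, n). l x n) (A' \<times> {..<J}) \<and>
      (\<forall>n<N. \<exists>j<J. \<forall>x\<in>A'. g x n = l x j) \<and> (\<forall>n<M. \<exists>j<J. \<forall>x\<in>A'. h x n = l x j))"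
proof -
  define L where "L x i = (if i < N then g x i else h x (i - N))" for x i
  define T where "T = N + M"
  define S where "S x = L x ` {..<T}" for x
  have LF: "L x i \<in> F" if "x \<in> A" "i < T" for x i
    using that g(2) h(2) by (auto simp: L_def T_def)
  have fin: "countable {y\<in>A. z \<in> S y}" for z
  proof -
    have "{y\<in>A. z \<in> S y} \<subseteq> (\<Union>i<T. {y\<in>A. L y i = z})" by (auto simp: S_def)
    moreover have "countable {y\<in>A. L y i = z}" if "i < T" for i
    proof -
      have "y = y'" if "y \<in> A" "L y i = z" "y' \<in> A" "L y' i = z" for y y'
      proof (cases "i < N")
        case True
        then show ?thesis
          using that inj_onD[OF g(1), of "(y, i)" "(y', i)"] by (simp add: L_def)
      next
        case False
        then have "i - N < M" using \<open>i < T\<close> by (simp add: T_def)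
        with False show ?thesis
          using that inj_onD[OF h(1), of "(y, i - N)" "(y', i - N)"] by (simp add: L_def)
      qed
      then have "\<exists>a. {y\<in>A. L y i = z} \<subseteq> {a}" by blast
      then obtain a where "{y\<in>A. L y i = z} \<subseteq> {a}" ..
      then show ?thesis by (rule countable_subset) simp
    qed
    ultimately have "countable (\<Union>i<T. {y\<in>A. L y i = z})" by (intro countable_UN) auto
    then show ?thesis using \<open>{y\<in>A. z \<in> S y} \<subseteq> _\<close> by (rule countable_subset[rotated])
  qed
  have "\<exists>A1\<subseteq>A. uncountable A1 \<and> (\<forall>x\<in>A1. \<forall>y\<in>A1. x \<noteq> y \<longrightarrow> \<not> S x \<inter> S y \<noteq> {})"
  proof (rule uncountable_conflict_free[OF assms(1)])
    fix x assume "x \<in> A"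
    have "{y\<in>A. S x \<inter> S y \<noteq> {}} = (\<Union>z\<in>S x. {y\<in>A. z \<in> S y})" by blast
    moreover have "countable (S x)" by (simp add: S_def)
    ultimately show "countable {y\<in>A. S x \<inter> S y \<noteq> {}}" using fin by simp
  qed blast
  then obtain A1 where A1: "A1 \<subseteq> A" "uncountable A1"
    and free: "\<forall>x\<in>A1. \<forall>y\<in>A1. x \<noteq> y \<longrightarrow> \<not> S x \<inter> S y \<noteq> {}"
    by (elim exE conjE) (rule that)
  have disj: "S x \<inter> S y = {}" if "x \<in> A1" "y \<in> A1" "x \<noteq> y" for x y
    using bspec[OF bspec[OF free that(1)] that(2)] that(3) by simp
  \<comment> \<open>The pattern of coincidences among the functions listed at one index: each position is sent to the first
    one that carries the same function.  Only finitely many patterns are possible.\<close>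
  define \<pi> where "\<pi> x i = (LEAST j. L x j = L x i)" for x i
  obtain ps where ps: "uncountable {x\<in>A1. map (\<pi> x) [0..<T] = ps}"
    using uncountable_fiber[OF A1(2), of "\<lambda>x. map (\<pi> x) [0..<T]"] by blast
  define A' where "A' = {x\<in>A1. map (\<pi> x) [0..<T] = ps}"
  have pi: "\<pi> x i = ps ! i" if "x \<in> A'" "i < T" for x i
    using that by (auto simp: A'_def)
  have Lpi: "L x (ps ! i) = L x i" "ps ! i \<le> i" if "x \<in> A'" "i < T" for x i
  proof -
    show "L x (ps ! i) = L x i"
      unfolding pi[OF that, symmetric] \<pi>_def by (rule LeastI[of _ i]) simp
    show "ps ! i \<le> i"
      unfolding pi[OF that, symmetric] \<pi>_def by (rule Least_le) simp
  qed
  have "A' \<noteq> {}" using ps unfolding A'_def by (metis countable_empty)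
  then obtain x0 where x0: "x0 \<in> A'" by blast
  \<comment> \<open>The first occurrences, which list each function once.\<close>
  define Js where "Js = {i. i < T \<and> ps ! i = i}"
  have "finite Js" by (simp add: Js_def)
  then obtain e where e: "bij_betw e {0..<card Js} Js" using ex_bij_betw_nat_finite by blast
  have psJ: "ps ! i \<in> Js" if "i < T" for i
  proof -
    have lt: "ps ! i < T" using Lpi(2)[OF x0 that] that by simp
    have "ps ! (ps ! i) = \<pi> x0 (ps ! i)" using pi[OF x0 lt] by simp
    also have "\<dots> = \<pi> x0 i" unfolding \<pi>_def Lpi(1)[OF x0 that] ..
    also have "\<dots> = ps ! i" using pi[OF x0 that] .
    finally show ?thesis using lt by (simp add: Js_def)
  qed
  define l where "l x j = L x (e j)" for x j
  have eJ: "e j < T" "ps ! e j = e j" if "j < card Js" for j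
    using bij_betwE[OF e] that by (auto simp: Js_def)
  have "inj_on (\<lambda>(x, n). l x n) (A' \<times> {..<card Js})"
  proof (rule inj_onI, clarsimp)
    fix x i y j assume *: "x \<in> A'" "y \<in> A'" "i < card Js" "j < card Js" "l x i = l y j"
    then have "S x \<inter> S y \<noteq> {}"
      using eJ(1) unfolding S_def l_def by blast
    then have xy: "x = y" using disj[of x y] *(1,2) unfolding A'_def by blast
    then have "\<pi> x (e i) = \<pi> x (e j)" using * by (simp add: \<pi>_def l_def)
    then have "e i = e j" using pi[OF *(1) eJ(1)] eJ(2) *(3,4) by simp
    then have "i = j" using inj_onD[OF bij_betw_imp_inj_on[OF e], of i j] *(3,4) by simp
    with xy show "x = y \<and> i = j" by simp
  qed
  moreover have rep: "\<exists>j<card Js. \<forall>x\<in>A'. L x i = l x j" if i: "i < T" for i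
  proof -
    obtain j where "j < card Js" "e j = ps ! i"
      using psJ[OF i] bij_betw_imp_surj_on[OF e] by (metis atLeast0LessThan imageE lessThan_iff)
    with Lpi(1)[OF _ i] show ?thesis by (intro exI[of _ j]) (simp add: l_def)
  qed
  have "\<forall>n<N. \<exists>j<card Js. \<forall>x\<in>A'. g x n = l x j"
  proof (intro allI impI)
    fix n assume "n < N"
    with rep[of n] show "\<exists>j<card Js. \<forall>x\<in>A'. g x n = l x j" by (simp add: L_def T_def)
  qed
  moreover have "\<forall>n<M. \<exists>j<card Js. \<forall>x\<in>A'. h x n = l x j"
  proof (intro allI impI)
    fix n assume "n < M"
    with rep[of "N + n"] show "\<exists>j<card Js. \<forall>x\<in>A'. h x n = l x j" by (simp add: L_def T_def)
  qed
  moreover have "\<forall>x\<in>A'. \<forall>n<card Js. l x n \<in> F"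
    using LF eJ(1) A1(1) by (auto simp: l_def A'_def)
  moreover have "A' \<subseteq> A" "uncountable A'" using A1(1) ps by (auto simp: A'_def)
  ultimately show ?thesis
    by (intro exI[of _ A'] conjI exI[of _ "card Js"] exI[of _ l])
qed

section \<open>Spread and sweet in terms of uncountable index sets\<close>

text \<open>Spread and sweetness are restated for arbitrary uncountable sets of countable ordinals.  The following
  shape is common to sweetness and to what is derived from it later: finitely many functions are attached
  to each index such that their growth along a sequence guarantees a property of that sequence.\<close>

abbreviation grows_at :: "('x \<Rightarrow> nat \<Rightarrow> nat \<Rightarrow> nat) \<Rightarrow> nat \<Rightarrow> (nat \<Rightarrow> 'x) \<Rightarrow> nat \<Rightarrow> bool" where
  "grows_at f N s k \<equiv> \<forall>i. \<forall>n<N. f (s i) n k < f (s (Suc i)) n k"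

abbreviation growth_ensures ::
    "(w1 \<Rightarrow> nat \<Rightarrow> nat \<Rightarrow> nat) \<Rightarrow> nat \<Rightarrow> nat \<Rightarrow> w1 set \<Rightarrow> ((nat \<Rightarrow> w1) \<Rightarrow> nat \<Rightarrow> bool) \<Rightarrow> bool" where
  "growth_ensures f N K A \<Phi> \<equiv>
    \<forall>s k. strict_mono s \<longrightarrow> range s \<subseteq> A \<longrightarrow> K < k \<longrightarrow> grows_at f N s k \<longrightarrow> \<Phi> s k"

abbreviation ensured_by_growth ::
    "(nat \<Rightarrow> nat) set \<Rightarrow> w1 set \<Rightarrow> ((nat \<Rightarrow> w1) \<Rightarrow> nat \<Rightarrow> bool) \<Rightarrow> bool" where
  "ensured_by_growth F A \<Phi> \<equiv> \<exists>K N f. (\<forall>x\<in>A. \<forall>n<N. f x n \<in> F) \<and>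
    inj_on (\<lambda>(x, n). f x n) (A \<times> {..<N}) \<and> growth_ensures f N K A \<Phi>"

text \<open>The set \<open>B\<close> is indexed by all countable ordinals in increasing order, under which increasing
  sequences of indices correspond to increasing sequences in \<open>B\<close>.\<close>

lemma spread_on_uncountable:
  fixes B :: "w1 set" and f :: "w1 \<Rightarrow> nat \<Rightarrow> nat \<Rightarrow> nat"
  assumes "spread F" and B: "uncountable B"
    and f: "\<And>x n. x \<in> B \<Longrightarrow> n < N \<Longrightarrow> f x n \<in> F" "inj_on (\<lambda>(x, n). f x n) (B \<times> {..<N})"
  shows "\<exists>s k. strict_mono s \<and> range s \<subseteq> B \<and> K < k \<and> grows_at f N s k"
proof -
  obtain e :: "w1 \<Rightarrow> w1" where e: "strict_mono e" "range e \<subseteq> B"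
    using strict_mono_into_uncountable[OF B] by blast
  define f' where "f' a = f (e (Abs_w1 a))" for a
  have f'F: "\<forall>\<alpha>\<in>Field omega1. \<forall>n<N. f' \<alpha> n \<in> F"
    using e(2) f(1) by (auto simp: f'_def)
  have f'inj: "inj_on (\<lambda>(\<alpha>, n). f' \<alpha> n) (Field omega1 \<times> {..<N})"
  proof (rule inj_onI, clarsimp)
    fix a n b m
    assume *: "a \<in> Field omega1" "b \<in> Field omega1" "n < N" "m < N" "f' a n = f' b m"
    have "e (Abs_w1 a) \<in> B" "e (Abs_w1 b) \<in> B" using e(2) by auto
    then have "e (Abs_w1 a) = e (Abs_w1 b) \<and> n = m"
      using inj_onD[OF f(2), of "(e (Abs_w1 a), n)" "(e (Abs_w1 b), m)"] * by (simp add: f'_def)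
    then show "a = b \<and> n = m"
      using *(1,2) by (simp add: Abs_w1_inject strict_mono_eq[OF e(1)])
  qed
  obtain s k where s: "increasing s" "k > K" "grows s f' k N"
    using assms(1)[unfolded spread_def, THEN conjunct2, THEN spec, of K, THEN spec, of N, THEN spec,
        of f', THEN mp, OF f'F, THEN mp, OF f'inj] by (elim exE conjE) (rule that)
  have sF: "s i \<in> Field omega1" for i
    using s(1) by (auto simp: increasing_def Field_def)
  have "increasing (\<lambda>i. Rep_w1 (Abs_w1 (s i)))"
    using s(1) sF by (simp add: Abs_w1_inverse)
  then have "strict_mono (\<lambda>i. Abs_w1 (s i))" by (simp only: increasing_Rep_w1_iff)
  then have "strict_mono (\<lambda>i. e (Abs_w1 (s i)))"
    by (intro strict_monoI strict_monoD[OF e(1)]) (rule strict_monoD)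
  moreover have "range (\<lambda>i. e (Abs_w1 (s i))) \<subseteq> B" using e(2) by auto
  moreover have "\<forall>i. \<forall>n<N. f (e (Abs_w1 (s i))) n k < f (e (Abs_w1 (s (Suc i)))) n k"
    using s(3) by (simp add: grows_def f'_def)
  ultimately show ?thesis using s(2)
    by (intro exI[of _ "\<lambda>i. e (Abs_w1 (s i))"] exI[of _ k] conjI)
qed

lemma sweet_on_uncountable:
  fixes B :: "w1 set"
  assumes "sweet F R" and B: "uncountable B" and p: "\<forall>x\<in>B. p x \<in> Field R"
  shows "\<exists>A\<subseteq>B. uncountable A \<and> ensured_by_growth F A (\<lambda>s k. \<exists>r\<in>Field R. forces_inf_gen R r (\<lambda>i. p (s i)))"
proof -
  obtain e :: "w1 \<Rightarrow> w1" where e: "strict_mono e" "range e \<subseteq> B"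
    using strict_mono_into_uncountable[OF B] by blast
  have pe: "\<forall>\<alpha>\<in>Field omega1. p (e (Abs_w1 \<alpha>)) \<in> Field R"
    using e(2) p by blast
  obtain A K N and f :: "nat set \<Rightarrow> nat \<Rightarrow> nat \<Rightarrow> nat" where A: "A \<subseteq> Field omega1" "|A| =o omega1"
    and f: "\<forall>\<alpha>\<in>A. \<forall>n<N. f \<alpha> n \<in> F" "inj_on (\<lambda>(\<alpha>, n). f \<alpha> n) (A \<times> {..<N})"
    and gen: "\<forall>s. range s \<subseteq> A \<longrightarrow> increasing s \<longrightarrow> (\<exists>k>K. grows s f k N) \<longrightarrow>
      (\<exists>r\<in>Field R. forces_inf_gen R r (\<lambda>i. p (e (Abs_w1 (s i)))))"
    using assms(1)[unfolded sweet_def, THEN conjunct2, THEN spec, of "\<lambda>\<alpha>. p (e (Abs_w1 \<alpha>))",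
        THEN mp, OF pe] by (elim exE conjE) (rule that)
  define A' where "A' = e ` Abs_w1 ` A"
  define d where "d x = Rep_w1 (inv e x)" for x
  have de: "d (e (Abs_w1 a)) = a" if "a \<in> A" for a
    using subsetD[OF A(1) that] by (simp add: d_def inv_f_f[OF strict_mono_imp_inj_on[OF e(1)]] Abs_w1_inverse)
  have ed: "e (Abs_w1 (d x)) = x" "d x \<in> A" if "x \<in> A'" for x
    using that de by (auto simp: A'_def)
  have "uncountable A'"
  proof
    assume "countable A'"
    then have "countable (d ` A')" by simp
    moreover have "d ` A' = A" by (auto simp: A'_def image_image de)
    ultimately show False using A(2) uncountable_iff_ordIso_omega1[OF A(1)] by simp
  qed
  moreover have "A' \<subseteq> B" using e(2) by (auto simp: A'_def)
  moreover have "\<forall>x\<in>A'. \<forall>n<N. f (d x) n \<in> F" using ed f(1) by blast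
  moreover have "inj_on (\<lambda>(x, n). f (d x) n) (A' \<times> {..<N})"
  proof (rule inj_onI, clarsimp)
    fix x n y m assume *: "x \<in> A'" "y \<in> A'" "n < N" "m < N" "f (d x) n = f (d y) m"
    then have "d x = d y \<and> n = m"
      using inj_onD[OF f(2), of "(d x, n)" "(d y, m)"] ed(2) by simp
    then show "x = y \<and> n = m"
      using ed(1)[OF *(1)] ed(1)[OF *(2)] by metis
  qed
  moreover have "\<exists>r\<in>Field R. forces_inf_gen R r (\<lambda>i. p (s i))"
    if s: "strict_mono s" "range s \<subseteq> A'" "K < k" "\<forall>i. \<forall>n<N. f (d (s i)) n k < f (d (s (Suc i))) n k" for s k
  proof -
    have sA: "s i \<in> A'" for i using s(2) by auto
    have "strict_mono (\<lambda>i. inv e (s i))"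
    proof (rule strict_monoI)
      fix i j :: nat assume "i < j"
      have "e (inv e (s i)) = s i" for i using sA[of i] by (auto simp: A'_def intro: f_inv_into_f)
      then have "e (inv e (s i)) < e (inv e (s j))" using strict_monoD[OF s(1) \<open>i < j\<close>] by simp
      then show "inv e (s i) < inv e (s j)" by (simp add: strict_mono_less[OF e(1)])
    qed
    then have "increasing (\<lambda>i. d (s i))" by (simp add: d_def increasing_Rep_w1_iff)
    moreover have "range (\<lambda>i. d (s i)) \<subseteq> A" using ed(2) sA by blast
    moreover have "grows (\<lambda>i. d (s i)) f k N" using s(4) by (simp add: grows_def)
    then have "\<exists>k>K. grows (\<lambda>i. d (s i)) f k N" using s(3) by blast
    ultimately show ?thesis using gen[THEN spec, of "\<lambda>i. d (s i)"] by (simp add: ed(1)[OF sA])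
  qed
  ultimately show ?thesis
    by (intro exI[of _ A'] conjI exI[of _ K] exI[of _ N] exI[of _ "\<lambda>x. f (d x)"] allI impI)
qed

lemma sweetI:
  assumes "forcing_notion R"
    and "\<And>p :: w1 \<Rightarrow> 'p. (\<And>x. p x \<in> Field R) \<Longrightarrow>
      \<exists>A. uncountable A \<and> ensured_by_growth F A (\<lambda>s k. \<exists>r\<in>Field R. forces_inf_gen R r (\<lambda>i. p (s i)))"
  shows "sweet F R"
  unfolding sweet_def
proof (intro conjI assms(1) allI impI)
  fix p :: "nat set \<Rightarrow> 'p" assume "\<forall>\<alpha>\<in>Field omega1. p \<alpha> \<in> Field R"
  then have "p (Rep_w1 x) \<in> Field R" for x using Rep_w1 by blast
  from assms(2)[of "\<lambda>x. p (Rep_w1 x)", OF this] obtain A K N and f :: "w1 \<Rightarrow> nat \<Rightarrow> nat \<Rightarrow> nat" where A: "uncountable A"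
    and f: "\<forall>x\<in>A. \<forall>n<N. f x n \<in> F" "inj_on (\<lambda>(x, n). f x n) (A \<times> {..<N})"
    and gen: "growth_ensures f N K A (\<lambda>s k. \<exists>r\<in>Field R. forces_inf_gen R r (\<lambda>i. p (Rep_w1 (s i))))"
    apply (elim exE conjE)
    subgoal for A K N f by (rule that[of A N f K])
    done
  have "inj_on Rep_w1 A" by (simp add: inj_on_def Rep_w1_inject)
  then have "uncountable (Rep_w1 ` A)"
    using A countable_image_inj_on by blast
  then have "|Rep_w1 ` A| =o omega1"
    using uncountable_iff_ordIso_omega1[of "Rep_w1 ` A"] Rep_w1 by (simp add: image_subset_iff)
  moreover have "\<exists>r\<in>Field R. forces_inf_gen R r (\<lambda>i. p (s i))"
    if s: "range s \<subseteq> Rep_w1 ` A" "increasing s" "\<exists>k>K. grows s (\<lambda>a. f (Abs_w1 a)) k N" for s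
  proof -
    have sA: "s i \<in> Rep_w1 ` A" for i using s(1) by auto
    have RA: "Rep_w1 (Abs_w1 (s i)) = s i" for i
    proof -
      obtain a where "s i = Rep_w1 a" using sA[of i] by blast
      then show ?thesis by (simp add: Rep_w1_inverse)
    qed
    obtain k where k: "K < k" "grows s (\<lambda>a. f (Abs_w1 a)) k N" using s(3) by blast
    have "strict_mono (\<lambda>i. Abs_w1 (s i))"
      using s(2) unfolding increasing_Rep_w1_iff[symmetric] RA .
    moreover have "range (\<lambda>i. Abs_w1 (s i)) \<subseteq> A"
    proof (rule image_subsetI)
      fix i
      obtain a where "a \<in> A" "s i = Rep_w1 a" using sA by blast
      then show "Abs_w1 (s i) \<in> A" by (simp add: Rep_w1_inverse)
    qed
    ultimately show ?thesis
      using gen[THEN spec, of "\<lambda>i. Abs_w1 (s i)", THEN spec, of k] k by (simp add: grows_def RA)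
  qed
  moreover have "inj_on (\<lambda>(\<alpha>, n). f (Abs_w1 \<alpha>) n) (Rep_w1 ` A \<times> {..<N})"
  proof (rule inj_onI, clarsimp simp: Rep_w1_inverse)
    fix x n y m assume "x \<in> A" "n < N" "y \<in> A" "m < N" "f x n = f y m"
    then show "Rep_w1 x = Rep_w1 y \<and> n = m"
      using inj_onD[OF f(2), of "(x, n)" "(y, m)"] by simp
  qed
  moreover have "Rep_w1 ` A \<subseteq> Field omega1" using Rep_w1 by blast
  moreover have "\<forall>\<alpha>\<in>Rep_w1 ` A. \<forall>n<N. f (Abs_w1 \<alpha>) n \<in> F" using f(1) by (simp add: Rep_w1_inverse)
  ultimately show "\<exists>A kstar nstar f. A \<subseteq> Field omega1 \<and> |A| =o omega1 \<and>
      (\<forall>\<alpha>\<in>A. \<forall>n<nstar. f \<alpha> n \<in> F) \<and> inj_on (\<lambda>(\<alpha>, n). f \<alpha> n) (A \<times> {..<nstar}) \<and>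
      (\<forall>s. range s \<subseteq> A \<longrightarrow> increasing s \<longrightarrow> (\<exists>k>kstar. grows s f k nstar) \<longrightarrow>
        (\<exists>r\<in>Field R. forces_inf_gen R r (\<lambda>i. p (s i))))"
    by (intro exI[of _ "Rep_w1 ` A"] exI[of _ K] exI[of _ N] exI[of _ "\<lambda>\<alpha>. f (Abs_w1 \<alpha>)"] conjI allI impI)
qed

section \<open>Equality and membership of names\<close>

lemma nm_induct:
  assumes "\<And>x :: ('a, 'i) nm. (\<And>u c. (u, c) \<in> elts x \<Longrightarrow> P u) \<Longrightarrow> P x"
  shows "P x"
proof (induction x rule: nm.induct)
  case (Nm f)
  show ?case
  proof (rule assms)
    fix u c assume "(u, c) \<in> elts (Nm f)"
    then have "Some (u, c) \<in> range f" by simp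
    then show "P u" by (rule Nm(1)[of _ "(u, c)"]) (auto simp: fsts.simps)
  qed
qed

type_synonym ('a, 'i) index = "'a + 'i + (nat \<Rightarrow> nat)"

text \<open>The posets of an iteration have the empty condition as weakest element, and only then do pairs
  \<open>(y, Map.empty)\<close> describe elements that are present in every extension.\<close>

locale forcing_poset =
  fixes R :: "('a, 'i) cond rel"
  assumes R_refl: "p \<in> Field R \<Longrightarrow> (p, p) \<in> R"
    and R_trans: "(p, q) \<in> R \<Longrightarrow> (q, r) \<in> R \<Longrightarrow> (p, r) \<in> R"
    and empty_in_Field: "Map.empty \<in> Field R"
    and empty_weakest: "p \<in> Field R \<Longrightarrow> (Map.empty, p) \<in> R"
begin

abbreviation le :: "('a, 'i) cond \<Rightarrow> ('a, 'i) cond \<Rightarrow> bool" (infix "\<preceq>" 50) where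
  "p \<preceq> q \<equiv> (p, q) \<in> R"

abbreviation eq (infix "\<^bold>=" 50) where "x \<^bold>= y \<equiv> f_eq R x y"
abbreviation mem (infix "\<^bold>\<in>" 50) where "x \<^bold>\<in> y \<equiv> f_mem R x y"

lemma le_Field: "p \<preceq> q \<Longrightarrow> p \<in> Field R" "p \<preceq> q \<Longrightarrow> q \<in> Field R"
  by (auto simp: Field_def)

lemma f_imp_iff: "f_imp R \<phi> \<psi> p \<longleftrightarrow> (\<forall>q. p \<preceq> q \<longrightarrow> \<phi> q \<longrightarrow> (\<exists>r. q \<preceq> r \<and> \<psi> r))"
  by (auto simp: f_imp_def f_not_def f_and_def)

lemma f_or_iff: "f_or R \<phi> \<psi> p \<longleftrightarrow> (\<forall>q. p \<preceq> q \<longrightarrow> (\<exists>r. q \<preceq> r \<and> (\<phi> r \<or> \<psi> r)))"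
  by (auto simp: f_or_def f_not_def f_and_def)

lemma f_ex_iff:
  "f_ex R \<phi> p \<longleftrightarrow> (\<forall>q. p \<preceq> q \<longrightarrow> (\<exists>r x. q \<preceq> r \<and> is_name R x \<and> \<phi> x r))"
  unfolding f_ex_def f_not_def f_all_def by blast

lemma f_and_iff: "f_and \<phi> \<psi> p \<longleftrightarrow> \<phi> p \<and> \<psi> p"
  by (simp add: f_and_def)

lemma f_not_iff: "f_not R \<phi> p \<longleftrightarrow> (\<forall>q. p \<preceq> q \<longrightarrow> \<not> \<phi> q)"
  by (simp add: f_not_def)

lemma f_all_iff: "f_all R \<phi> p \<longleftrightarrow> (\<forall>x. is_name R x \<longrightarrow> \<phi> x p)"
  by (simp add: f_all_def)

text \<open>Forcing an atomic formula gives a set of conditions that is closed under strengthening and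
  contains every condition above which it is dense.\<close>

definition regular :: "('a, 'i) fml \<Rightarrow> bool" where
  "regular \<phi> \<longleftrightarrow> (\<forall>p q. p \<preceq> q \<longrightarrow> \<phi> p \<longrightarrow> \<phi> q) \<and>
    (\<forall>p\<in>Field R. (\<forall>q. p \<preceq> q \<longrightarrow> (\<exists>r. q \<preceq> r \<and> \<phi> r)) \<longrightarrow> \<phi> p)"

lemma regular_mono: "regular \<phi> \<Longrightarrow> \<phi> p \<Longrightarrow> p \<preceq> q \<Longrightarrow> \<phi> q"
  unfolding regular_def by blast

lemma regular_dense: "regular \<phi> \<Longrightarrow> p \<in> Field R \<Longrightarrow> (\<And>q. p \<preceq> q \<Longrightarrow> \<exists>r. q \<preceq> r \<and> \<phi> r) \<Longrightarrow> \<phi> p"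
  unfolding regular_def by blast

lemma f_eq_iff:
  "(x \<^bold>= y) p \<longleftrightarrow>
    (\<forall>u c q. (u, c) \<in> elts x \<longrightarrow> p \<preceq> q \<longrightarrow>
      (\<exists>r. q \<preceq> r \<and> (c \<preceq> r \<longrightarrow> (\<exists>v d. (v, d) \<in> elts y \<and> d \<preceq> r \<and> (u \<^bold>= v) r)))) \<and>
    (\<forall>v d q. (v, d) \<in> elts y \<longrightarrow> p \<preceq> q \<longrightarrow>
      (\<exists>r. q \<preceq> r \<and> (d \<preceq> r \<longrightarrow> (\<exists>u c. (u, c) \<in> elts x \<and> c \<preceq> r \<and> (u \<^bold>= v) r))))"
  by (subst f_eq.simps) simp

lemma regular_eq: "regular (x \<^bold>= y)"
  unfolding regular_def
proof (intro conjI allI impI ballI)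
  fix p q assume "p \<preceq> q" "(x \<^bold>= y) p"
  then show "(x \<^bold>= y) q"
    unfolding f_eq_iff[of x y] using R_trans by meson
next
  fix p assume *: "p \<in> Field R" "\<forall>q. p \<preceq> q \<longrightarrow> (\<exists>r. q \<preceq> r \<and> (x \<^bold>= y) r)"
  show "(x \<^bold>= y) p"
    unfolding f_eq_iff[of x y p]
  proof (intro conjI allI impI)
    fix u c q assume a: "(u, c) \<in> elts x" "p \<preceq> q"
    obtain r where r: "q \<preceq> r" "(x \<^bold>= y) r" using * a by blast
    have "\<exists>s. r \<preceq> s \<and> (c \<preceq> s \<longrightarrow> (\<exists>v d. (v, d) \<in> elts y \<and> d \<preceq> s \<and> (u \<^bold>= v) s))"
      using r(2) R_refl[OF le_Field(2)[OF r(1)]] a(1) unfolding f_eq_iff[of x y r] by blast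
    then show "\<exists>r. q \<preceq> r \<and> (c \<preceq> r \<longrightarrow> (\<exists>v d. (v, d) \<in> elts y \<and> d \<preceq> r \<and> (u \<^bold>= v) r))"
      using R_trans[OF r(1)] by blast
  next
    fix v d q assume a: "(v, d) \<in> elts y" "p \<preceq> q"
    obtain r where r: "q \<preceq> r" "(x \<^bold>= y) r" using * a by blast
    have "\<exists>s. r \<preceq> s \<and> (d \<preceq> s \<longrightarrow> (\<exists>u c. (u, c) \<in> elts x \<and> c \<preceq> s \<and> (u \<^bold>= v) s))"
      using r(2) R_refl[OF le_Field(2)[OF r(1)]] a(1) unfolding f_eq_iff[of x y r] by blast
    then show "\<exists>r. q \<preceq> r \<and> (d \<preceq> r \<longrightarrow> (\<exists>u c. (u, c) \<in> elts x \<and> c \<preceq> r \<and> (u \<^bold>= v) r))"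
      using R_trans[OF r(1)] by blast
  qed
qed

lemma eq_mono: "(x \<^bold>= y) p \<Longrightarrow> p \<preceq> q \<Longrightarrow> (x \<^bold>= y) q"
  using regular_mono[OF regular_eq] .

lemma regular_mem: "regular (x \<^bold>\<in> y)"
  unfolding regular_def f_mem_def
proof (intro conjI allI impI ballI)
  fix p q s
  assume "p \<preceq> q" "\<forall>q. p \<preceq> q \<longrightarrow> (\<exists>r. q \<preceq> r \<and> (\<exists>v d. (v, d) \<in> elts y \<and> d \<preceq> r \<and> (x \<^bold>= v) r))" "q \<preceq> s"
  then show "\<exists>r. s \<preceq> r \<and> (\<exists>v d. (v, d) \<in> elts y \<and> d \<preceq> r \<and> (x \<^bold>= v) r)"
    using R_trans by blast
next
  fix p s
  assume *: "\<forall>q. p \<preceq> q \<longrightarrow> (\<exists>r. q \<preceq> r \<and>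
    (\<forall>q. r \<preceq> q \<longrightarrow> (\<exists>r. q \<preceq> r \<and> (\<exists>v d. (v, d) \<in> elts y \<and> d \<preceq> r \<and> (x \<^bold>= v) r))))"
    and s: "p \<preceq> s"
  obtain r where r: "s \<preceq> r"
    "\<forall>q. r \<preceq> q \<longrightarrow> (\<exists>r. q \<preceq> r \<and> (\<exists>v d. (v, d) \<in> elts y \<and> d \<preceq> r \<and> (x \<^bold>= v) r))"
    using * s by blast
  then obtain t where "r \<preceq> t" "\<exists>v d. (v, d) \<in> elts y \<and> d \<preceq> t \<and> (x \<^bold>= v) t"
    using R_refl[OF le_Field(2)[OF r(1)]] by blast
  then show "\<exists>r. s \<preceq> r \<and> (\<exists>v d. (v, d) \<in> elts y \<and> d \<preceq> r \<and> (x \<^bold>= v) r)"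
    using R_trans[OF r(1)] by blast
qed

lemma mem_mono: "(x \<^bold>\<in> y) p \<Longrightarrow> p \<preceq> q \<Longrightarrow> (x \<^bold>\<in> y) q"
  using regular_mono[OF regular_mem] .

lemma mem_dense: "p \<in> Field R \<Longrightarrow> (\<And>q. p \<preceq> q \<Longrightarrow> \<exists>r. q \<preceq> r \<and> (x \<^bold>\<in> y) r) \<Longrightarrow> (x \<^bold>\<in> y) p"
  using regular_dense[OF regular_mem] .

lemma eq_dense: "p \<in> Field R \<Longrightarrow> (\<And>q. p \<preceq> q \<Longrightarrow> \<exists>r. q \<preceq> r \<and> (x \<^bold>= y) r) \<Longrightarrow> (x \<^bold>= y) p"
  using regular_dense[OF regular_eq] .

lemma eq_refl: "(x \<^bold>= x) p"
proof (induction x arbitrary: p rule: nm_induct)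
  case (1 x)
  show ?case
    unfolding f_eq_iff[of x x p] using 1 R_refl le_Field(2) by meson
qed

lemma eq_sym: "(x \<^bold>= y) p \<Longrightarrow> (y \<^bold>= x) p"
proof (induction rule: f_eq.induct)
  case (1 x p y)
  show ?case
    unfolding f_eq_iff[of y x p] using 1 by meson
qed

lemma mem_obtain:
  assumes "(x \<^bold>\<in> y) p" "p \<in> Field R"
  obtains r v d where "p \<preceq> r" "(v, d) \<in> elts y" "d \<preceq> r" "(x \<^bold>= v) r"
  using assms R_refl[OF assms(2)] unfolding f_mem_def by blast

lemma eq_trans: "(x \<^bold>= y) p \<Longrightarrow> (y \<^bold>= z) p \<Longrightarrow> (x \<^bold>= z) p"
proof (induction x arbitrary: y z p rule: nm_induct)
  case (1 x)
  show ?case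
    unfolding f_eq_iff[of x z p]
  proof (intro conjI allI impI)
    fix u c q assume a: "(u, c) \<in> elts x" "p \<preceq> q"
    obtain r where r: "q \<preceq> r" "c \<preceq> r \<longrightarrow> (\<exists>v d. (v, d) \<in> elts y \<and> d \<preceq> r \<and> (u \<^bold>= v) r)"
      using 1(2) a unfolding f_eq_iff[of x y p] by blast
    show "\<exists>r. q \<preceq> r \<and> (c \<preceq> r \<longrightarrow> (\<exists>v d. (v, d) \<in> elts z \<and> d \<preceq> r \<and> (u \<^bold>= v) r))"
    proof (cases "c \<preceq> r")
      case True
      then obtain v d where v: "(v, d) \<in> elts y" "d \<preceq> r" "(u \<^bold>= v) r" using r by blast
      have "p \<preceq> r" using a(2) r(1) R_trans by blast
      then obtain s where s: "r \<preceq> s" "d \<preceq> s \<longrightarrow> (\<exists>w e. (w, e) \<in> elts z \<and> e \<preceq> s \<and> (v \<^bold>= w) s)"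
        using 1(3) v(1) unfolding f_eq_iff[of y z p] by blast
      then obtain w e where w: "(w, e) \<in> elts z" "e \<preceq> s" "(v \<^bold>= w) s"
        using R_trans[OF v(2) s(1)] by blast
      have "(u \<^bold>= w) s" using 1(1)[OF a(1) eq_mono[OF v(3) s(1)] w(3)] .
      then show ?thesis using w R_trans[OF r(1) s(1)] by blast
    qed (use r in blast)
  next
    fix w e q assume a: "(w, e) \<in> elts z" "p \<preceq> q"
    obtain r where r: "q \<preceq> r" "e \<preceq> r \<longrightarrow> (\<exists>v d. (v, d) \<in> elts y \<and> d \<preceq> r \<and> (v \<^bold>= w) r)"
      using 1(3) a unfolding f_eq_iff[of y z p] by blast
    show "\<exists>r. q \<preceq> r \<and> (e \<preceq> r \<longrightarrow> (\<exists>u c. (u, c) \<in> elts x \<and> c \<preceq> r \<and> (u \<^bold>= w) r))"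
    proof (cases "e \<preceq> r")
      case True
      then obtain v d where v: "(v, d) \<in> elts y" "d \<preceq> r" "(v \<^bold>= w) r" using r by blast
      have "p \<preceq> r" using a(2) r(1) R_trans by blast
      then obtain s where s: "r \<preceq> s" "d \<preceq> s \<longrightarrow> (\<exists>u c. (u, c) \<in> elts x \<and> c \<preceq> s \<and> (u \<^bold>= v) s)"
        using 1(2) v(1) unfolding f_eq_iff[of x y p] by blast
      then obtain u c where u: "(u, c) \<in> elts x" "c \<preceq> s" "(u \<^bold>= v) s"
        using R_trans[OF v(2) s(1)] by blast
      have "(u \<^bold>= w) s" using 1(1)[OF u(1) u(3) eq_mono[OF v(3) s(1)]] .
      then show ?thesis using u R_trans[OF r(1) s(1)] by blast
    qed (use r in blast)
  qed
qed

lemma mem_cong_left: "(x \<^bold>= y) p \<Longrightarrow> (y \<^bold>\<in> z) p \<Longrightarrow> (x \<^bold>\<in> z) p"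
  unfolding f_mem_def using eq_trans eq_mono R_trans by meson

lemma mem_eltsI: "(y, c) \<in> elts x \<Longrightarrow> c \<preceq> p \<Longrightarrow> (y \<^bold>\<in> x) p"
  unfolding f_mem_def using eq_refl R_trans R_refl le_Field(2) by meson

lemma mem_cong_right:
  assumes "(x \<^bold>\<in> y) p" "(y \<^bold>= z) p"
  shows "(x \<^bold>\<in> z) p"
  unfolding f_mem_def
proof (intro allI impI)
  fix q assume q: "p \<preceq> q"
  obtain r v d where r: "q \<preceq> r" "(v, d) \<in> elts y" "d \<preceq> r" "(x \<^bold>= v) r"
    using mem_obtain[OF mem_mono[OF assms(1) q] le_Field(2)[OF q]] .
  obtain s where s: "r \<preceq> s" "d \<preceq> s \<longrightarrow> (\<exists>w e. (w, e) \<in> elts z \<and> e \<preceq> s \<and> (v \<^bold>= w) s)"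
    using assms(2) r(2) R_trans[OF q r(1)] unfolding f_eq_iff[of y z p] by blast
  then obtain w e where w: "(w, e) \<in> elts z" "e \<preceq> s" "(v \<^bold>= w) s"
    using R_trans[OF r(3) s(1)] by blast
  have "(x \<^bold>= w) s" using eq_trans[OF eq_mono[OF r(4) s(1)] w(3)] .
  then show "\<exists>r. q \<preceq> r \<and> (\<exists>v d. (v, d) \<in> elts z \<and> d \<preceq> r \<and> (x \<^bold>= v) r)"
    using w R_trans[OF r(1) s(1)] by blast
qed

text \<open>Extensionality.  An element whose condition is incompatible with the current one is not in the set, whence
  the case distinctions.\<close>

lemma eqI:
  assumes "\<And>u c q. (u, c) \<in> elts x \<Longrightarrow> p \<preceq> q \<Longrightarrow> c \<preceq> q \<Longrightarrow> (u \<^bold>\<in> y) q"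
    and "\<And>v d q. (v, d) \<in> elts y \<Longrightarrow> p \<preceq> q \<Longrightarrow> d \<preceq> q \<Longrightarrow> (v \<^bold>\<in> x) q"
  shows "(x \<^bold>= y) p"
  unfolding f_eq_iff[of x y p]
proof (intro conjI allI impI)
  fix u c q assume a: "(u, c) \<in> elts x" "p \<preceq> q"
  show "\<exists>r. q \<preceq> r \<and> (c \<preceq> r \<longrightarrow> (\<exists>v d. (v, d) \<in> elts y \<and> d \<preceq> r \<and> (u \<^bold>= v) r))"
  proof (cases "\<exists>r. q \<preceq> r \<and> c \<preceq> r")
    case True
    then obtain r where r: "q \<preceq> r" "c \<preceq> r" by blast
    obtain s v d where "r \<preceq> s" "(v, d) \<in> elts y" "d \<preceq> s" "(u \<^bold>= v) s"
      using mem_obtain[OF assms(1)[OF a(1) R_trans[OF a(2) r(1)] r(2)] le_Field(2)[OF r(1)]] .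
    then show ?thesis using R_trans[OF r(1)] by blast
  qed (use a R_refl le_Field(2) in blast)
next
  fix v d q assume a: "(v, d) \<in> elts y" "p \<preceq> q"
  show "\<exists>r. q \<preceq> r \<and> (d \<preceq> r \<longrightarrow> (\<exists>u c. (u, c) \<in> elts x \<and> c \<preceq> r \<and> (u \<^bold>= v) r))"
  proof (cases "\<exists>r. q \<preceq> r \<and> d \<preceq> r")
    case True
    then obtain r where r: "q \<preceq> r" "d \<preceq> r" by blast
    obtain s u c where "r \<preceq> s" "(u, c) \<in> elts x" "c \<preceq> s" "(v \<^bold>= u) s"
      using mem_obtain[OF assms(2)[OF a(1) R_trans[OF a(2) r(1)] r(2)] le_Field(2)[OF r(1)]] .
    then show ?thesis using R_trans[OF r(1)] eq_sym by blast
  qed (use a R_refl le_Field(2) in blast)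
qed

lemma f_andI: "\<phi> p \<Longrightarrow> \<psi> p \<Longrightarrow> f_and \<phi> \<psi> p"
  by (simp add: f_and_def)

lemma f_allI: "(\<And>x. is_name R x \<Longrightarrow> \<phi> x p) \<Longrightarrow> f_all R \<phi> p"
  by (simp add: f_all_def)

subsection \<open>Formulas stable under strengthening\<close>

text \<open>One half of regularity.  It is passed on by all connectives and suffices for the formulas that define comprehension names.\<close>

definition stable :: "('a, 'i) fml \<Rightarrow> bool" where
  "stable \<phi> \<longleftrightarrow> (\<forall>p q. \<phi> p \<longrightarrow> p \<preceq> q \<longrightarrow> \<phi> q)"

lemma stableD: "stable \<phi> \<Longrightarrow> \<phi> p \<Longrightarrow> p \<preceq> q \<Longrightarrow> \<phi> q"
  unfolding stable_def by blast

lemma stable_regular: "regular \<phi> \<Longrightarrow> stable \<phi>"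
  unfolding regular_def stable_def by blast

lemma stable_and: "stable \<phi> \<Longrightarrow> stable \<psi> \<Longrightarrow> stable (f_and \<phi> \<psi>)"
  unfolding stable_def f_and_def by blast

lemma stable_not: "stable (f_not R \<phi>)"
  unfolding stable_def f_not_def using R_trans by blast

lemma stable_imp: "stable (f_imp R \<phi> \<psi>)"
  unfolding f_imp_def by (rule stable_not)

lemma stable_or: "stable (f_or R \<phi> \<psi>)"
  unfolding f_or_def by (rule stable_not)

lemma stable_ex: "stable (f_ex R \<phi>)"
  unfolding f_ex_def by (rule stable_not)

lemma stable_all: "(\<And>x. stable (\<phi> x)) \<Longrightarrow> stable (f_all R \<phi>)"
  unfolding stable_def f_all_def by blast

lemmas stable_intros = stable_regular[OF regular_eq] stable_regular[OF regular_mem] stable_and stable_not stable_imp stable_or stable_ex stable_all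

lemma impD: "f_imp R \<phi> \<psi> p \<Longrightarrow> p \<preceq> q \<Longrightarrow> \<phi> q \<Longrightarrow> \<exists>r. q \<preceq> r \<and> \<psi> r"
  by (simp add: f_imp_iff)

text \<open>Forcing an implication yields the conclusion only for a dense set of stronger conditions, which is no loss
  when the conclusion is regular.\<close>

lemma imp_regularD:
  assumes "f_imp R \<phi> \<psi> p" "stable \<phi>" "regular \<psi>" "\<phi> p" "p \<in> Field R"
  shows "\<psi> p"
  using assms(3,5)
proof (rule regular_dense)
  fix q assume "p \<preceq> q"
  then show "\<exists>r. q \<preceq> r \<and> \<psi> r" using impD[OF assms(1)] stableD[OF assms(2,4)] by blast
qed

subsection \<open>Pairs\<close>

lemma infinite_index: "infinite (UNIV :: ('a, 'i) index set)"
proof -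
  have "infinite (UNIV :: (nat \<Rightarrow> nat) set)"
    by (metis finite_fun_UNIVD2 infinite_UNIV_nat zero_neq_one)
  then show ?thesis by (simp flip: UNIV_Plus_UNIV)
qed

lemma countable_ordLeq_index:
  assumes "countable X"
  shows "|X| \<le>o |UNIV :: ('a, 'i) index set|"
  using assms[unfolded countable_card_le_natLeq]
proof (rule ordLeq_transitive)
  show "natLeq \<le>o |UNIV :: ('a, 'i) index set|"
    using infinite_index infinite_iff_natLeq_ordLeq by metis
qed

lemma elts_nm_of_countable: "countable X \<Longrightarrow> elts (nm_of X :: ('a, 'i) nm) = X"
  by (rule elts_nm_of[OF countable_ordLeq_index])

lemma elts_upair: "elts (upair x y :: ('a, 'i) nm) = {(x, Map.empty), (y, Map.empty)}"
  unfolding upair_def by (rule elts_nm_of_countable) simp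

lemma mem_obtain_ground:
  assumes "elts x = (\<lambda>y. (y, Map.empty)) ` Y" "(z \<^bold>\<in> x) p" "p \<in> Field R"
  obtains r y where "p \<preceq> r" "y \<in> Y" "(z \<^bold>= y) r"
proof -
  obtain r v d where "p \<preceq> r" "(v, d) \<in> elts x" "(z \<^bold>= v) r"
    using mem_obtain[OF assms(2,3)] .
  then show thesis using that unfolding assms(1) by auto
qed

lemma mem_groundI:
  assumes "elts x = (\<lambda>y. (y, Map.empty)) ` Y" "y \<in> Y" "p \<in> Field R"
  shows "(y \<^bold>\<in> x) p"
  using mem_eltsI[of y Map.empty x p] assms empty_weakest by auto

lemma elts_upair_image: "elts (upair x y :: ('a, 'i) nm) = (\<lambda>y. (y, Map.empty)) ` {x, y}"
  by (simp add: elts_upair)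

lemma mem_upair_obtain:
  assumes "(z \<^bold>\<in> upair x y) p" "p \<in> Field R"
  obtains r where "p \<preceq> r" "(z \<^bold>= x) r \<or> (z \<^bold>= y) r"
  using mem_obtain_ground[OF elts_upair_image assms] by blast

lemma mem_upairI: "p \<in> Field R \<Longrightarrow> (x \<^bold>\<in> upair x y) p" "p \<in> Field R \<Longrightarrow> (y \<^bold>\<in> upair x y) p"
  using mem_groundI[OF elts_upair_image] by auto

lemma upair_cong:
  assumes "(x \<^bold>= x') p" "(y \<^bold>= y') p"
  shows "(upair x y \<^bold>= upair x' y') p"
proof (rule eqI)
  fix u c q assume "(u, c) \<in> elts (upair x y)" "p \<preceq> q"
  then show "(u \<^bold>\<in> upair x' y') q"
    using mem_cong_left[OF eq_mono[OF assms(1)] mem_upairI(1)]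
      mem_cong_left[OF eq_mono[OF assms(2)] mem_upairI(2)] le_Field
    by (auto simp: elts_upair)
next
  fix u c q assume "(u, c) \<in> elts (upair x' y')" "p \<preceq> q"
  then show "(u \<^bold>\<in> upair x y) q"
    using mem_cong_left[OF eq_sym[OF eq_mono[OF assms(1)]] mem_upairI(1)]
      mem_cong_left[OF eq_sym[OF eq_mono[OF assms(2)]] mem_upairI(2)] le_Field
    by (auto simp: elts_upair)
qed

lemma opair_cong: "(x \<^bold>= x') p \<Longrightarrow> (y \<^bold>= y') p \<Longrightarrow> (opair x y \<^bold>= opair x' y') p"
  unfolding opair_def by (intro upair_cong)

lemma upair_eqD:
  assumes "(upair a b \<^bold>= upair c d) p" "p \<in> Field R"
  obtains r where "p \<preceq> r" "(a \<^bold>= c) r \<and> (b \<^bold>= d) r \<or> (a \<^bold>= d) r \<and> (b \<^bold>= c) r"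
proof -
  note F = le_Field(2)
  obtain r1 where r1: "p \<preceq> r1" "(a \<^bold>= c) r1 \<or> (a \<^bold>= d) r1"
    using mem_upair_obtain[OF mem_cong_right[OF mem_upairI(1)[OF assms(2)] assms(1)] assms(2)] .
  note e1 = eq_mono[OF assms(1) r1(1)]
  obtain r2 where r2: "r1 \<preceq> r2" "(b \<^bold>= c) r2 \<or> (b \<^bold>= d) r2"
    using mem_upair_obtain[OF mem_cong_right[OF mem_upairI(2)[OF F[OF r1(1)]] e1] F[OF r1(1)]] .
  note e2 = eq_sym[OF eq_mono[OF e1 r2(1)]]
  obtain r3 where r3: "r2 \<preceq> r3" "(c \<^bold>= a) r3 \<or> (c \<^bold>= b) r3"
    using mem_upair_obtain[OF mem_cong_right[OF mem_upairI(1)[OF F[OF r2(1)]] e2] F[OF r2(1)]] .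
  note e3 = eq_mono[OF e2 r3(1)]
  obtain r4 where r4: "r3 \<preceq> r4" "(d \<^bold>= a) r4 \<or> (d \<^bold>= b) r4"
    using mem_upair_obtain[OF mem_cong_right[OF mem_upairI(2)[OF F[OF r3(1)]] e3] F[OF r3(1)]] .
  have le: "p \<preceq> r4" "r1 \<preceq> r4" "r2 \<preceq> r4"
    using R_trans r1(1) r2(1) r3(1) r4(1) by blast+
  have "(a \<^bold>= c) r4 \<or> (a \<^bold>= d) r4" "(b \<^bold>= c) r4 \<or> (b \<^bold>= d) r4" "(c \<^bold>= a) r4 \<or> (c \<^bold>= b) r4"
    using r1(2) r2(2) r3(2) eq_mono le r4(1) by blast+
  with r4(2) have "(a \<^bold>= c) r4 \<and> (b \<^bold>= d) r4 \<or> (a \<^bold>= d) r4 \<and> (b \<^bold>= c) r4"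
    using eq_sym eq_trans by blast
  then show thesis using that le(1) by blast
qed

text \<open>The pairs are those of Kuratowski, so the components are equal on a dense set of conditions.\<close>

lemma opair_eqD:
  assumes "(opair x y \<^bold>= opair x' y') p" "p \<in> Field R"
  shows "(x \<^bold>= x') p" "(y \<^bold>= y') p"
proof -
  have *: "\<exists>r. q \<preceq> r \<and> (x \<^bold>= x') r \<and> (y \<^bold>= y') r" if q: "p \<preceq> q" for q
  proof -
    note F = le_Field(2)
    have "(upair (upair x x) (upair x y) \<^bold>= upair (upair x' x') (upair x' y')) q"
      using eq_mono[OF assms(1) q] by (simp add: opair_def)
    from upair_eqD[OF this F[OF q]] obtain r where r: "q \<preceq> r" and
      "(upair x x \<^bold>= upair x' x') r \<and> (upair x y \<^bold>= upair x' y') r \<or>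
       (upair x x \<^bold>= upair x' y') r \<and> (upair x y \<^bold>= upair x' x') r" .
    then show ?thesis
    proof (elim disjE conjE)
      assume a: "(upair x x \<^bold>= upair x' x') r" "(upair x y \<^bold>= upair x' y') r"
      obtain s where s: "r \<preceq> s" "(x \<^bold>= x') s" using upair_eqD[OF a(1) F[OF r]] by blast
      obtain t where t: "s \<preceq> t" "(x \<^bold>= x') t \<and> (y \<^bold>= y') t \<or> (x \<^bold>= y') t \<and> (y \<^bold>= x') t"
        using upair_eqD[OF eq_mono[OF a(2) s(1)] F[OF s(1)]] .
      have x: "(x \<^bold>= x') t" using eq_mono[OF s(2) t(1)] .
      have "(y \<^bold>= y') t" using t(2) eq_trans[OF _ eq_trans[OF eq_sym[OF x]], of y y'] by blast
      then show ?thesis using x R_trans[OF R_trans[OF r s(1)] t(1)] by blast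
    next
      assume a: "(upair x x \<^bold>= upair x' y') r" "(upair x y \<^bold>= upair x' x') r"
      obtain s where s: "r \<preceq> s" "(x \<^bold>= x') s" "(x \<^bold>= y') s" using upair_eqD[OF a(1) F[OF r]] by blast
      obtain t where t: "s \<preceq> t" "(y \<^bold>= x') t"
        using upair_eqD[OF eq_mono[OF a(2) s(1)] F[OF s(1)]] by blast
      have x: "(x \<^bold>= x') t" "(x \<^bold>= y') t" using eq_mono[OF s(2) t(1)] eq_mono[OF s(3) t(1)] .
      have "(y \<^bold>= y') t" using eq_trans[OF t(2) eq_trans[OF eq_sym[OF x(1)] x(2)]] .
      then show ?thesis using x(1) R_trans[OF R_trans[OF r s(1)] t(1)] by blast
    qed
  qed
  show "(x \<^bold>= x') p" using * by (intro eq_dense[OF assms(2)]) blast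
  show "(y \<^bold>= y') p" using * by (intro eq_dense[OF assms(2)]) blast
qed

lemma is_name_eltsD:
  assumes "is_name R x" "(y, c) \<in> elts x"
  shows "is_name R y \<and> c \<in> Field R"
  using assms(1) by cases (use assms(2) in blast)

lemma is_name_ground:
  assumes "elts x = (\<lambda>y. (y, Map.empty)) ` Y" "\<And>y. y \<in> Y \<Longrightarrow> is_name R y"
  shows "is_name R x"
proof (rule is_name.intros)
  fix y c assume "(y, c) \<in> elts x"
  then have "y \<in> Y" "c = Map.empty" unfolding assms(1) by auto
  then show "is_name R y \<and> c \<in> Field R" using assms(2) empty_in_Field by simp
qed

lemma is_name_upair: "is_name R x \<Longrightarrow> is_name R y \<Longrightarrow> is_name R (upair x y)"
  by (rule is_name_ground[OF elts_upair_image]) (elim insertE emptyE, simp_all)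

lemma is_name_opair: "is_name R x \<Longrightarrow> is_name R y \<Longrightarrow> is_name R (opair x y)"
  unfolding opair_def by (intro is_name_upair)

end

section \<open>Names for objects of the ground model\<close>

function check_ord :: "w1 \<Rightarrow> ('a, 'i) nm" where
  "check_ord x = nm_of ((\<lambda>y. (check_ord y, Map.empty)) ` {..<x})"
  by auto
termination
  by (relation "{(x, y). x < y}") (auto simp: wellorder_class.wf)

declare check_ord.simps [simp del]

definition check_w1 :: "('a, 'i) nm" where
  "check_w1 = nm_of (range (\<lambda>x. (check_ord x, Map.empty)))"

context forcing_poset
begin

abbreviation has_value :: "('a, 'i) nm \<Rightarrow> w1 \<Rightarrow> nat \<Rightarrow> (nat \<Rightarrow> nat) \<Rightarrow> ('a, 'i) fml" where
  "has_value f x n g \<equiv> f_mem R (opair (opair (check_ord x) (check_nat n)) (check_fun g)) f"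

lemma ordLeq_index_funI:
  fixes f :: "'c \<Rightarrow> nat \<Rightarrow> nat"
  assumes "inj_on f X"
  shows "|X| \<le>o |UNIV :: ('a, 'i) index set|"
proof -
  have "inj_on (\<lambda>x. Inr (Inr (f x)) :: ('a, 'i) index) X"
    using assms by (simp add: inj_on_def)
  then show ?thesis unfolding card_of_ordLeq[symmetric] by blast
qed

text \<open>Countable ordinals are represented by sets of natural numbers, which are coded by their characteristic
  functions.\<close>

lemma w1_ordLeq_index: "|X :: w1 set| \<le>o |UNIV :: ('a, 'i) index set|"
proof (rule ordLeq_index_funI)
  show "inj_on (\<lambda>x n. if n \<in> Rep_w1 x then 1 else (0 :: nat)) X"
  proof (rule inj_onI)
    fix x y assume "(\<lambda>n. if n \<in> Rep_w1 x then 1 else 0) = (\<lambda>n. if n \<in> Rep_w1 y then 1 else (0 :: nat))"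
    then have "n \<in> Rep_w1 x \<longleftrightarrow> n \<in> Rep_w1 y" for n by (metis zero_neq_one)
    then have "Rep_w1 x = Rep_w1 y" by blast
    then show "x = y" by (simp only: Rep_w1_inject)
  qed
qed

lemma elts_nm_of_image:
  assumes "|X| \<le>o |UNIV :: ('a, 'i) index set|"
  shows "elts (nm_of (h ` X) :: ('a, 'i) nm) = h ` X"
  by (rule elts_nm_of[OF ordLeq_transitive[OF card_of_image assms]])

lemma elts_check_ord: "elts (check_ord x :: ('a, 'i) nm) = (\<lambda>y. (y, Map.empty)) ` (check_ord ` {..<x})"
  by (subst check_ord.simps) (simp add: elts_nm_of_image[OF w1_ordLeq_index] image_image)

lemma elts_check_w1: "elts (check_w1 :: ('a, 'i) nm) = (\<lambda>y. (y, Map.empty)) ` range check_ord"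
  unfolding check_w1_def by (simp add: elts_nm_of_image[OF w1_ordLeq_index] image_image)

lemma elts_check_nat: "elts (check_nat n :: ('a, 'i) nm) = (\<lambda>y. (y, Map.empty)) ` (check_nat ` {..<n})"
proof (induction n)
  case 0
  show ?case by (simp add: elts_nm_of_countable)
next
  case (Suc n)
  have "countable (elts (check_nat n :: ('a, 'i) nm))" unfolding Suc by simp
  then have "countable (insert (check_nat n, Map.empty) (elts (check_nat n :: ('a, 'i) nm)))" by simp
  from elts_nm_of_countable[OF this] show ?case
    by (simp only: check_nat.simps Suc lessThan_Suc image_insert)
qed

lemma elts_check_omega: "elts (check_omega :: ('a, 'i) nm) = (\<lambda>y. (y, Map.empty)) ` range check_nat"
  unfolding check_omega_def by (simp add: elts_nm_of_countable image_image)

lemma elts_check_fun: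
  "elts (check_fun f :: ('a, 'i) nm) =
    (\<lambda>y. (y, Map.empty)) ` range (\<lambda>n. opair (check_nat n) (check_nat (f n)))"
  unfolding check_fun_def by (simp add: elts_nm_of_countable image_image)

lemma elts_check_family: "elts (check_family F :: ('a, 'i) nm) = (\<lambda>y. (y, Map.empty)) ` (check_fun ` F)"
  unfolding check_family_def
  by (simp add: elts_nm_of_image[OF ordLeq_index_funI[of id]] image_image)

lemma is_name_check_nat: "is_name R (check_nat n)"
proof (induction n rule: less_induct)
  case (less n)
  show ?case by (rule is_name_ground[OF elts_check_nat]) (use less in blast)
qed

lemma is_name_check_ord: "is_name R (check_ord x)"
proof (induction x rule: less_induct)
  case (less x)
  show ?case by (rule is_name_ground[OF elts_check_ord]) (use less in blast)
qed

lemma is_name_check_w1: "is_name R check_w1"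
  by (rule is_name_ground[OF elts_check_w1]) (use is_name_check_ord in blast)

lemma is_name_check_fun: "is_name R (check_fun f)"
  by (rule is_name_ground[OF elts_check_fun]) (use is_name_check_nat is_name_opair in blast)

text \<open>A uniform treatment of the von Neumann ordinals given by \<^const>\<open>check_nat\<close> and
  \<^const>\<open>check_ord\<close>.\<close>

definition ordinal_names :: "('b::wellorder \<Rightarrow> ('a, 'i) nm) \<Rightarrow> bool" where
  "ordinal_names c \<longleftrightarrow> (\<forall>x. elts (c x) = (\<lambda>y. (y, Map.empty)) ` (c ` {..<x}))"

lemma ordinal_names_check_nat: "ordinal_names check_nat"
  unfolding ordinal_names_def using elts_check_nat by blast

lemma ordinal_names_check_ord: "ordinal_names check_ord"
  unfolding ordinal_names_def using elts_check_ord by blast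

lemma mem_ordinal_obtain:
  assumes "ordinal_names c" "(z \<^bold>\<in> c x) p" "p \<in> Field R"
  obtains r y where "p \<preceq> r" "y < x" "(z \<^bold>= c y) r"
proof -
  have "elts (c x) = (\<lambda>y. (y, Map.empty)) ` (c ` {..<x})"
    using assms(1) unfolding ordinal_names_def by blast
  from mem_obtain_ground[OF this assms(2,3)] that show thesis by blast
qed

lemma mem_ordinalI:
  assumes "ordinal_names c" "y < x" "p \<in> Field R"
  shows "(c y \<^bold>\<in> c x) p"
proof (rule mem_groundI)
  show "elts (c x) = (\<lambda>y. (y, Map.empty)) ` (c ` {..<x})"
    using assms(1) unfolding ordinal_names_def by blast
qed (use assms in auto)

lemma ordinal_names_less_neq:
  assumes "ordinal_names c" "x < y" "p \<in> Field R"
  shows "\<not> (c x \<^bold>= c y) p"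
  using assms(2,3)
proof (induction x arbitrary: y p rule: less_induct)
  case (less x)
  show ?case
  proof
    assume eq: "(c x \<^bold>= c y) p"
    have "(c x \<^bold>\<in> c x) p"
      using mem_cong_right[OF mem_ordinalI[OF assms(1) less.prems] eq_sym[OF eq]] .
    then obtain r z where r: "p \<preceq> r" "z < x" "(c x \<^bold>= c z) r"
      using mem_ordinal_obtain[OF assms(1) _ less.prems(2)] by blast
    show False using less.IH[OF r(2) r(2) le_Field(2)[OF r(1)]] eq_sym[OF r(3)] by blast
  qed
qed

lemma ordinal_eqD:
  assumes "ordinal_names c" "(c x \<^bold>= c y) p" "p \<in> Field R"
  shows "x = y"
  using ordinal_names_less_neq[OF assms(1) _ assms(3)] assms(2) eq_sym by (metis neqE)

lemma ordinal_memD: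
  assumes "ordinal_names c" "(c x \<^bold>\<in> c y) p" "p \<in> Field R"
  shows "x < y"
proof -
  obtain r z where r: "p \<preceq> r" "z < y" "(c x \<^bold>= c z) r"
    using mem_ordinal_obtain[OF assms] .
  then show ?thesis using ordinal_eqD[OF assms(1) r(3) le_Field(2)[OF r(1)]] by simp
qed

lemmas check_nat_eqD = ordinal_eqD[OF ordinal_names_check_nat]
lemmas check_nat_memD = ordinal_memD[OF ordinal_names_check_nat]
lemmas check_nat_memI = mem_ordinalI[OF ordinal_names_check_nat]
lemmas check_ord_eqD = ordinal_eqD[OF ordinal_names_check_ord]
lemmas check_ord_memI = mem_ordinalI[OF ordinal_names_check_ord]

lemma mem_omega_obtain:
  assumes "(z \<^bold>\<in> check_omega) p" "p \<in> Field R"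
  obtains r n where "p \<preceq> r" "(z \<^bold>= check_nat n) r"
  using mem_obtain_ground[OF elts_check_omega assms] by blast

lemma mem_omegaI: "p \<in> Field R \<Longrightarrow> (check_nat n \<^bold>\<in> check_omega) p"
  by (rule mem_groundI[OF elts_check_omega]) auto

lemma mem_w1_obtain:
  assumes "(z \<^bold>\<in> check_w1) p" "p \<in> Field R"
  obtains r x where "p \<preceq> r" "(z \<^bold>= check_ord x) r"
  using mem_obtain_ground[OF elts_check_w1 assms] by blast

lemma mem_w1I: "p \<in> Field R \<Longrightarrow> (check_ord x \<^bold>\<in> check_w1) p"
  by (rule mem_groundI[OF elts_check_w1]) auto

lemma mem_family_obtain:
  assumes "(z \<^bold>\<in> check_family F) p" "p \<in> Field R"
  obtains r f where "p \<preceq> r" "f \<in> F" "(z \<^bold>= check_fun f) r"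
  using mem_obtain_ground[OF elts_check_family assms] by blast

lemma mem_familyI: "p \<in> Field R \<Longrightarrow> f \<in> F \<Longrightarrow> (check_fun f \<^bold>\<in> check_family F) p"
  by (rule mem_groundI[OF elts_check_family]) auto

lemma check_fun_memI: "p \<in> Field R \<Longrightarrow> (opair (check_nat k) (check_nat (f k)) \<^bold>\<in> check_fun f) p"
  by (rule mem_groundI[OF elts_check_fun]) auto

lemma check_fun_memD:
  assumes "(opair (check_nat k) a \<^bold>\<in> check_fun f) p" "p \<in> Field R"
  shows "(a \<^bold>= check_nat (f k)) p"
proof (rule eq_dense[OF assms(2)])
  fix q assume q: "p \<preceq> q"
  obtain r y where r: "q \<preceq> r" "y \<in> range (\<lambda>n. opair (check_nat n) (check_nat (f n)))"
      "(opair (check_nat k) a \<^bold>= y) r"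
    using mem_obtain_ground[OF elts_check_fun mem_mono[OF assms(1) q] le_Field(2)[OF q]] .
  then obtain n where n: "(opair (check_nat k) a \<^bold>= opair (check_nat n) (check_nat (f n))) r" by blast
  note D = opair_eqD[OF n le_Field(2)[OF r(1)]]
  have "k = n" using check_nat_eqD[OF D(1) le_Field(2)[OF r(1)]] .
  with D(2) r(1) show "\<exists>r. q \<preceq> r \<and> (a \<^bold>= check_nat (f k)) r" by blast
qed

lemma check_fun_eqD:
  assumes "(check_fun f \<^bold>= check_fun g) p" "p \<in> Field R"
  shows "f = g"
proof
  fix k
  have "(opair (check_nat k) (check_nat (f k)) \<^bold>\<in> check_fun g) p"
    using mem_cong_right[OF check_fun_memI[OF assms(2)] assms(1)] .
  from check_nat_eqD[OF check_fun_memD[OF this assms(2)] assms(2)] show "f k = g k" .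
qed

lemma f_suc_checkD:
  assumes "f_suc R (i :: ('a, 'i) nm) j p" "p \<in> Field R" "(i \<^bold>= check_nat m) p" "(j \<^bold>= check_nat n) p"
  shows "n = Suc m"
proof -
  have suc: "f_imp R (z \<^bold>\<in> j) (f_or R (z \<^bold>\<in> i) (z \<^bold>= i)) p" "f_imp R (f_or R (z \<^bold>\<in> i) (z \<^bold>= i)) (z \<^bold>\<in> j) p"
    if "is_name R z" for z
    using assms(1) that unfolding f_suc_def f_all_iff f_iff_def f_and_def by blast+
  have "f_or R (check_nat m \<^bold>\<in> i) (check_nat m \<^bold>= i) p"
    unfolding f_or_iff using eq_sym[OF assms(3)] eq_mono R_refl[OF le_Field(2)] by blast
  from impD[OF suc(2)[OF is_name_check_nat] R_refl[OF assms(2)] this]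
  obtain r where r: "p \<preceq> r" "(check_nat m \<^bold>\<in> j) r" by blast
  have "m < n"
    using check_nat_memD[OF mem_cong_right[OF r(2) eq_mono[OF assms(4) r(1)]] le_Field(2)[OF r(1)]] .
  moreover have "\<not> Suc m < n"
  proof
    assume "Suc m < n"
    then have "(check_nat (Suc m) \<^bold>\<in> j) p"
      using mem_cong_right[OF check_nat_memI[OF _ assms(2)] eq_sym[OF assms(4)]] by blast
    from impD[OF suc(1)[OF is_name_check_nat] R_refl[OF assms(2)] this]
    obtain s where s: "p \<preceq> s" "f_or R (check_nat (Suc m) \<^bold>\<in> i) (check_nat (Suc m) \<^bold>= i) s" by blast
    then obtain t where t: "s \<preceq> t" "(check_nat (Suc m) \<^bold>\<in> i) t \<or> (check_nat (Suc m) \<^bold>= i) t"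
      unfolding f_or_iff using R_refl[OF le_Field(2)[OF s(1)]] by blast
    have i: "(i \<^bold>= check_nat m) t" using eq_mono[OF assms(3) R_trans[OF s(1) t(1)]] .
    note Ft = le_Field(2)[OF t(1)]
    from t(2) show False
    proof
      assume "(check_nat (Suc m) \<^bold>\<in> i) t"
      from check_nat_memD[OF mem_cong_right[OF this i] Ft] show False by simp
    next
      assume "(check_nat (Suc m) \<^bold>= i) t"
      from check_nat_eqD[OF eq_trans[OF this i] Ft] show False by simp
    qed
  qed
  ultimately show ?thesis by simp
qed

end

section \<open>Comprehension names under the countable chain condition\<close>

locale ccc_poset = forcing_poset +
  assumes ccc: "A \<subseteq> Field R \<Longrightarrow> (\<And>p q. p \<in> A \<Longrightarrow> q \<in> A \<Longrightarrow> p \<noteq> q \<Longrightarrow> \<not> (\<exists>r. (p, r) \<in> R \<and> (q, r) \<in> R)) \<Longrightarrow>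
    countable A"
begin

text \<open>The indexed form of the chain condition does not distinguish repeated conditions.\<close>

lemma ccc_indexed:
  assumes "uncountable J" "\<And>x. x \<in> J \<Longrightarrow> r x \<in> Field R"
  obtains x y s where "x \<in> J" "y \<in> J" "x \<noteq> y" "r x \<preceq> s" "r y \<preceq> s"
proof (cases "inj_on r J")
  case True
  then have "uncountable (r ` J)" using assms(1) countable_image_inj_on by blast
  moreover have "r ` J \<subseteq> Field R" using assms(2) by blast
  ultimately have "\<not> (\<forall>p\<in>r ` J. \<forall>q\<in>r ` J. p \<noteq> q \<longrightarrow> \<not> (\<exists>s. p \<preceq> s \<and> q \<preceq> s))"
    using ccc[of "r ` J"] by meson
  then obtain x y s where "x \<in> J" "y \<in> J" "r x \<noteq> r y" "r x \<preceq> s" "r y \<preceq> s" by blast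
  then show thesis using that[of x y s] by blast
next
  case False
  then obtain x y where "x \<in> J" "y \<in> J" "x \<noteq> y" "r x = r y" unfolding inj_on_def by blast
  then show thesis using that[of x y "r x"] R_refl[OF assms(2)[of x]] by simp
qed

text \<open>Countably many conditions that represent all those satisfying \<open>\<phi>\<close>; a maximal antichain among
  the latter is of this kind.\<close>

definition countable_predense_set :: "('a, 'b) fml \<Rightarrow> ('a, 'b) cond set" where
  "countable_predense_set \<phi> = (SOME A. A \<subseteq> {r\<in>Field R. \<phi> r} \<and> countable A \<and>
    (\<forall>p\<in>Field R. \<phi> p \<longrightarrow> (\<exists>a\<in>A. \<exists>r. a \<preceq> r \<and> p \<preceq> r)))"

lemma countable_predense:
  "countable_predense_set \<phi> \<subseteq> {r\<in>Field R. \<phi> r} \<and> countable (countable_predense_set \<phi>) \<and>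
    (\<forall>p\<in>Field R. \<phi> p \<longrightarrow> (\<exists>a\<in>countable_predense_set \<phi>. \<exists>r. a \<preceq> r \<and> p \<preceq> r))"
  unfolding countable_predense_set_def
proof (rule someI_ex)
  obtain M where M: "M \<subseteq> {r\<in>Field R. \<phi> r}" "\<forall>x\<in>M. \<forall>y\<in>M. x \<noteq> y \<longrightarrow> \<not> (\<exists>r. x \<preceq> r \<and> y \<preceq> r)"
    and max: "\<forall>b\<in>{r\<in>Field R. \<phi> r} - M. \<exists>x\<in>M. (\<exists>r. x \<preceq> r \<and> b \<preceq> r) \<or> (\<exists>r. b \<preceq> r \<and> x \<preceq> r)"
    using maximal_conflict_free[of "{r\<in>Field R. \<phi> r}" "\<lambda>x y. \<exists>r. x \<preceq> r \<and> y \<preceq> r"]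
    by (elim exE conjE) (rule that)
  have "countable M" using ccc[of M] M by blast
  moreover have "\<exists>a\<in>M. \<exists>r. a \<preceq> r \<and> p \<preceq> r" if "p \<in> Field R" "\<phi> p" for p
  proof (cases "p \<in> M")
    case True
    then show ?thesis using R_refl[OF that(1)] by blast
  next
    case False
    then show ?thesis using max that by blast
  qed
  ultimately show "\<exists>A. A \<subseteq> {r\<in>Field R. \<phi> r} \<and> countable A \<and>
    (\<forall>p\<in>Field R. \<phi> p \<longrightarrow> (\<exists>a\<in>A. \<exists>r. a \<preceq> r \<and> p \<preceq> r))"
    using M(1) by (intro exI[of _ M] conjI ballI impI)
qed

text \<open>A name for \<open>{t x | x \<in> I, \<phi> x}\<close>.  Pairing \<open>t x\<close> with all conditions that satisfy \<open>\<phi> x\<close> might produce more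
  pairs than a name can have; countably many per element give the same set.\<close>

definition comp_name :: "'x set \<Rightarrow> ('x \<Rightarrow> ('a, 'b) nm) \<Rightarrow> ('x \<Rightarrow> ('a, 'b) fml) \<Rightarrow> ('a, 'b) nm" where
  "comp_name I t \<phi> = nm_of (\<Union>x\<in>I. {t x} \<times> countable_predense_set (\<phi> x))"

lemma elts_comp_name:
  assumes "|I| \<le>o |UNIV :: ('a, 'b) index set|"
  shows "elts (comp_name I t \<phi>) = (\<Union>x\<in>I. {t x} \<times> countable_predense_set (\<phi> x))"
  unfolding comp_name_def
proof (rule elts_nm_of, rule card_of_UNION_ordLeq_infinite[OF infinite_index assms], rule ballI)
  fix x
  have "countable ({t x} \<times> countable_predense_set (\<phi> x))" using countable_predense[of "\<phi> x"] by simp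
  then show "|{t x} \<times> countable_predense_set (\<phi> x)| \<le>o |UNIV :: ('a, 'b) index set|"
    by (rule countable_ordLeq_index)
qed

lemma mem_comp_obtain:
  assumes "|I| \<le>o |UNIV :: ('a, 'b) index set|" "\<And>x. stable (\<phi> x)"
    and "(z \<^bold>\<in> comp_name I t \<phi>) p" "p \<in> Field R"
  obtains r x where "p \<preceq> r" "x \<in> I" "(z \<^bold>= t x) r" "\<phi> x r"
proof -
  obtain r v d where r: "p \<preceq> r" "(v, d) \<in> elts (comp_name I t \<phi>)" "d \<preceq> r" "(z \<^bold>= v) r"
    using mem_obtain[OF assms(3,4)] .
  then obtain x where x: "x \<in> I" "v = t x" "d \<in> countable_predense_set (\<phi> x)"
    unfolding elts_comp_name[OF assms(1)] by blast
  then have "\<phi> x d" using countable_predense[of "\<phi> x"] by blast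
  then show thesis using that[OF r(1) x(1)] r(4) x(2) stableD[OF assms(2) _ r(3)] by blast
qed

lemma mem_compI:
  assumes "|I| \<le>o |UNIV :: ('a, 'b) index set|" "\<And>x. stable (\<phi> x)"
    and "x \<in> I" "\<phi> x p" "p \<in> Field R"
  shows "(t x \<^bold>\<in> comp_name I t \<phi>) p"
proof (rule mem_dense[OF assms(5)])
  fix q assume q: "p \<preceq> q"
  obtain a r where a: "a \<in> countable_predense_set (\<phi> x)" "a \<preceq> r" "q \<preceq> r"
    using countable_predense[of "\<phi> x"] stableD[OF assms(2,4) q] le_Field(2)[OF q] by blast
  have "(t x, a) \<in> elts (comp_name I t \<phi>)"
    unfolding elts_comp_name[OF assms(1)] using a(1) assms(3) by blast
  from mem_eltsI[OF this a(2)] a(3) show "\<exists>r. q \<preceq> r \<and> (t x \<^bold>\<in> comp_name I t \<phi>) r" by blast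
qed

lemma is_name_comp:
  assumes "|I| \<le>o |UNIV :: ('a, 'b) index set|" "\<And>x. x \<in> I \<Longrightarrow> is_name R (t x)"
  shows "is_name R (comp_name I t \<phi>)"
proof (rule is_name.intros)
  fix y c assume "(y, c) \<in> elts (comp_name I t \<phi>)"
  then obtain x where x: "x \<in> I" "y = t x" "c \<in> countable_predense_set (\<phi> x)"
    unfolding elts_comp_name[OF assms(1)] by blast
  then have "c \<in> Field R" using countable_predense[of "\<phi> x"] by blast
  with x assms(2) show "is_name R y \<and> c \<in> Field R" by blast
qed

end

section \<open>Functions in the generic extension\<close>

context forcing_poset
begin

lemma imp2_regularD:
  assumes "f_imp R \<phi> (f_imp R \<psi> \<chi>) p" "stable \<phi>" "stable \<psi>" "regular \<chi>" "\<phi> p" "\<psi> p" "p \<in> Field R"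
  shows "\<chi> p"
  using assms(4,7)
proof (rule regular_dense)
  fix q assume q: "p \<preceq> q"
  obtain r where r: "q \<preceq> r" "f_imp R \<psi> \<chi> r"
    using impD[OF assms(1) q stableD[OF assms(2,5) q]] by blast
  obtain s where s: "r \<preceq> s" "\<chi> s"
    using impD[OF r(2) R_refl[OF le_Field(2)[OF r(1)]] stableD[OF assms(3,6) R_trans[OF q r(1)]]] by blast
  show "\<exists>r. q \<preceq> r \<and> \<chi> r" using R_trans[OF r(1) s(1)] s(2) by blast
qed

lemma ex_obtain:
  assumes "f_ex R \<phi> p" "p \<in> Field R"
  obtains r x where "p \<preceq> r" "is_name R x" "\<phi> x r"
  using assms R_refl unfolding f_ex_iff by blast

lemma allD: "f_all R \<phi> p \<Longrightarrow> is_name R x \<Longrightarrow> \<phi> x p"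
  unfolding f_all_iff by blast

lemma stable_f_fun: "stable (f_fun R f D B)"
  unfolding f_fun_def by (intro stable_intros)

lemma stable_f_inj: "stable (f_inj R f)"
  unfolding f_inj_def by (intro stable_intros)

lemma fun_total:
  assumes "f_fun R f D B p" "p \<in> Field R" "is_name R x" "D x p"
  obtains r y where "p \<preceq> r" "is_name R y" "(opair x y \<^bold>\<in> f) r"
proof -
  have "f_imp R (D x) (f_ex R (\<lambda>y. opair x y \<^bold>\<in> f)) p"
    using assms(1) allD[OF _ assms(3)] unfolding f_fun_def f_and_iff by blast
  from impD[OF this R_refl[OF assms(2)] assms(4)] obtain r where
    r: "p \<preceq> r" "f_ex R (\<lambda>y. opair x y \<^bold>\<in> f) r" by blast
  obtain s y where "r \<preceq> s" "is_name R y" "(opair x y \<^bold>\<in> f) s"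
    using ex_obtain[OF r(2) le_Field(2)[OF r(1)]] .
  then show thesis using that R_trans[OF r(1)] by blast
qed

lemma fun_unique:
  assumes "f_fun R f D B p" "p \<in> Field R" "is_name R x" "is_name R y" "is_name R y'"
    and "(opair x y \<^bold>\<in> f) p" "(opair x y' \<^bold>\<in> f) p"
  shows "(y \<^bold>= y') p"
proof -
  have "f_imp R (opair x y \<^bold>\<in> f) (f_imp R (opair x y' \<^bold>\<in> f) (y \<^bold>= y')) p"
    using assms(1,3-5) unfolding f_fun_def f_and_iff f_all_iff by blast
  from imp2_regularD[OF this stable_regular[OF regular_mem] stable_regular[OF regular_mem] regular_eq assms(6,7,2)] show ?thesis .
qed

lemma inj_unique:
  assumes "f_inj R f p" "p \<in> Field R" "is_name R x" "is_name R x'" "is_name R y"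
    and "(opair x y \<^bold>\<in> f) p" "(opair x' y \<^bold>\<in> f) p"
  shows "(x \<^bold>= x') p"
proof -
  have "f_imp R (opair x y \<^bold>\<in> f) (f_imp R (opair x' y \<^bold>\<in> f) (x \<^bold>= x')) p"
    using assms(1,3-5) unfolding f_inj_def f_all_iff by blast
  from imp2_regularD[OF this stable_regular[OF regular_mem] stable_regular[OF regular_mem] regular_eq assms(6,7,2)] show ?thesis .
qed

lemma fun_pair_obtain:
  assumes "f_fun R f D B p" "p \<in> Field R" "is_name R x" "is_name R y" "(opair x y \<^bold>\<in> f) p"
  obtains r x' where "p \<preceq> r" "is_name R x'" "D x' r" "(x \<^bold>= x') r" "(y \<^bold>\<in> B) r"
proof -
  have "f_imp R (opair x y \<^bold>\<in> f) (f_ex R (\<lambda>x'. f_ex R (\<lambda>y'.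
      D x' \<^bold>\<and> (y' \<^bold>\<in> B) \<^bold>\<and> (opair x y \<^bold>= opair x' y')))) p"
    using assms(1) allD[OF _ is_name_opair[OF assms(3,4)]] unfolding f_fun_def f_and_iff by blast
  from impD[OF this R_refl[OF assms(2)] assms(5)] obtain r where r: "p \<preceq> r"
    "f_ex R (\<lambda>x'. f_ex R (\<lambda>y'. D x' \<^bold>\<and> (y' \<^bold>\<in> B) \<^bold>\<and> (opair x y \<^bold>= opair x' y'))) r" by blast
  obtain s x' where s: "r \<preceq> s" "is_name R x'"
    "f_ex R (\<lambda>y'. D x' \<^bold>\<and> (y' \<^bold>\<in> B) \<^bold>\<and> (opair x y \<^bold>= opair x' y')) s"
    using ex_obtain[OF r(2) le_Field(2)[OF r(1)]] .
  obtain t y' where t: "s \<preceq> t" "is_name R y'"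
    "(D x' \<^bold>\<and> (y' \<^bold>\<in> B) \<^bold>\<and> (opair x y \<^bold>= opair x' y')) t"
    using ex_obtain[OF s(3) le_Field(2)[OF s(1)]] .
  then have t': "D x' t" "(y' \<^bold>\<in> B) t" "(opair x y \<^bold>= opair x' y') t" unfolding f_and_iff by blast+
  note D = opair_eqD[OF t'(3) le_Field(2)[OF t(1)]]
  show thesis
    using that[OF R_trans[OF R_trans[OF r(1) s(1)] t(1)] s(2) t'(1) D(1) mem_cong_left[OF D(2) t'(2)]] .
qed

lemma fun_range:
  assumes "f_fun R f D B p" "p \<in> Field R" "is_name R x" "is_name R y" "(opair x y \<^bold>\<in> f) p"
  shows "(y \<^bold>\<in> B) p"
proof (rule mem_dense[OF assms(2)])
  fix q assume q: "p \<preceq> q"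
  show "\<exists>r. q \<preceq> r \<and> (y \<^bold>\<in> B) r"
    using fun_pair_obtain[OF stableD[OF stable_f_fun assms(1) q] le_Field(2)[OF q] assms(3,4)
        mem_mono[OF assms(5) q]] by blast
qed

lemma fun_dom:
  assumes "f_fun R f (\<lambda>x. x \<^bold>\<in> A) B p" "p \<in> Field R" "is_name R x" "is_name R y" "(opair x y \<^bold>\<in> f) p"
  shows "(x \<^bold>\<in> A) p"
proof (rule mem_dense[OF assms(2)])
  fix q assume q: "p \<preceq> q"
  obtain r x' where "q \<preceq> r" "(x' \<^bold>\<in> A) r" "(x \<^bold>= x') r"
    using fun_pair_obtain[OF stableD[OF stable_f_fun assms(1) q] le_Field(2)[OF q] assms(3,4)
        mem_mono[OF assms(5) q]] .
  then show "\<exists>r. q \<preceq> r \<and> (x \<^bold>\<in> A) r" using mem_cong_left by blast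
qed

lemma pair_mem_cong:
  "(opair x y \<^bold>\<in> f) p \<Longrightarrow> (x \<^bold>= x') p \<Longrightarrow> (y \<^bold>= y') p \<Longrightarrow> (opair x' y' \<^bold>\<in> f) p"
  using mem_cong_left[OF opair_cong[OF eq_sym eq_sym]] .

lemma fun_omega_value:
  assumes "f_fun R f D check_omega p" "p \<in> Field R" "is_name R x" "D x p"
  obtains r n where "p \<preceq> r" "(opair x (check_nat n) \<^bold>\<in> f) r"
proof -
  obtain r y where r: "p \<preceq> r" "is_name R y" "(opair x y \<^bold>\<in> f) r"
    using fun_total[OF assms] .
  note Fr = le_Field(2)[OF r(1)]
  have "(y \<^bold>\<in> check_omega) r"
    using fun_range[OF stableD[OF stable_f_fun assms(1) r(1)] Fr assms(3) r(2,3)] .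
  then obtain s n where s: "r \<preceq> s" "(y \<^bold>= check_nat n) s" using mem_omega_obtain[OF _ Fr] by blast
  show thesis
    using that[OF R_trans[OF r(1) s(1)] pair_mem_cong[OF mem_mono[OF r(3) s(1)] eq_refl s(2)]] .
qed

lemma elts_ordLeq_index: "|elts (x :: ('a, 'i) nm)| \<le>o |UNIV :: ('a, 'i) index set|"
proof (cases x)
  case (Nm f)
  have "elts x \<subseteq> (\<lambda>i. the (f i)) ` UNIV"
  proof
    fix z assume "z \<in> elts x"
    then obtain i where "f i = Some z" using Nm by auto
    then show "z \<in> (\<lambda>i. the (f i)) ` UNIV" by (intro image_eqI[of _ _ i]) simp_all
  qed
  then show ?thesis using ordLeq_transitive[OF card_of_mono1 card_of_image] by blast
qed

lemma image_elts_ordLeq_index: "|h ` elts (x :: ('a, 'i) nm)| \<le>o |UNIV :: ('a, 'i) index set|"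
  using ordLeq_transitive[OF card_of_image elts_ordLeq_index] .

lemma Times_ordLeq_index:
  assumes "|A| \<le>o |UNIV :: ('a, 'i) index set|" "|B| \<le>o |UNIV :: ('a, 'i) index set|"
  shows "|A \<times> B| \<le>o |UNIV :: ('a, 'i) index set|"
  using card_of_Times_ordLeq_infinite_Field[OF _ assms card_of_Card_order] infinite_index
  by (simp only: Field_card_of) blast

end

context ccc_poset
begin

text \<open>For a comprehension name consisting of pairs, functionality has to be checked only where the
  formulas \<open>\<phi> x\<close> hold.\<close>

lemma f_fun_comp:
  assumes I: "|I| \<le>o |UNIV :: ('a, 'b) index set|" and stable: "\<And>x. stable (\<phi> x)"
    and names: "\<And>x. x \<in> I \<Longrightarrow> is_name R (a x)" "\<And>x. x \<in> I \<Longrightarrow> is_name R (b x)"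
    and graph: "\<And>x q. x \<in> I \<Longrightarrow> p \<preceq> q \<Longrightarrow> \<phi> x q \<Longrightarrow> D (a x) q \<and> (b x \<^bold>\<in> B) q"
    and total: "\<And>z q. is_name R z \<Longrightarrow> p \<preceq> q \<Longrightarrow> D z q \<Longrightarrow> \<exists>r x. q \<preceq> r \<and> x \<in> I \<and> \<phi> x r \<and> (z \<^bold>= a x) r"
    and uniq: "\<And>x y q. x \<in> I \<Longrightarrow> y \<in> I \<Longrightarrow> p \<preceq> q \<Longrightarrow> \<phi> x q \<Longrightarrow> \<phi> y q \<Longrightarrow> (a x \<^bold>= a y) q \<Longrightarrow> (b x \<^bold>= b y) q"
  shows "f_fun R (comp_name I (\<lambda>x. opair (a x) (b x)) \<phi>) D B p"
proof -
  let ?f = "comp_name I (\<lambda>x. opair (a x) (b x)) \<phi>"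
  note obt = mem_comp_obtain[OF I stable]
  note F = le_Field(2)
  have 1: "f_imp R (z \<^bold>\<in> ?f) (f_ex R (\<lambda>x. f_ex R (\<lambda>y. D x \<^bold>\<and> (y \<^bold>\<in> B) \<^bold>\<and> (z \<^bold>= opair x y)))) p" for z
    unfolding f_imp_iff
  proof (intro allI impI)
    fix q assume q: "p \<preceq> q" "(z \<^bold>\<in> ?f) q"
    obtain r x where r: "q \<preceq> r" "x \<in> I" "(z \<^bold>= opair (a x) (b x)) r" "\<phi> x r"
      using obt[OF q(2) F[OF q(1)]] .
    have *: "(D (a x) \<^bold>\<and> (b x \<^bold>\<in> B) \<^bold>\<and> (z \<^bold>= opair (a x) (b x))) s" if "r \<preceq> s" for s
      using graph[OF r(2) R_trans[OF R_trans[OF q(1) r(1)] that] stableD[OF stable r(4) that]]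
        eq_mono[OF r(3) that] unfolding f_and_iff by blast
    have "f_ex R (\<lambda>x. f_ex R (\<lambda>y. D x \<^bold>\<and> (y \<^bold>\<in> B) \<^bold>\<and> (z \<^bold>= opair x y))) r"
      unfolding f_ex_iff
    proof (intro allI impI)
      fix s assume s: "r \<preceq> s"
      have "\<forall>q. s \<preceq> q \<longrightarrow> (\<exists>r y. q \<preceq> r \<and> is_name R y \<and> (D (a x) \<^bold>\<and> (y \<^bold>\<in> B) \<^bold>\<and> (z \<^bold>= opair (a x) y)) r)"
        using *[OF R_trans[OF s]] names(2)[OF r(2)] R_refl[OF F] by blast
      then show "\<exists>t x. s \<preceq> t \<and> is_name R x \<and>
          (\<forall>q. t \<preceq> q \<longrightarrow> (\<exists>r y. q \<preceq> r \<and> is_name R y \<and> (D x \<^bold>\<and> (y \<^bold>\<in> B) \<^bold>\<and> (z \<^bold>= opair x y)) r))"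
        using names(1)[OF r(2)] R_refl[OF F[OF s]] by blast
    qed
    with r(1) show "\<exists>r. q \<preceq> r \<and> f_ex R (\<lambda>x. f_ex R (\<lambda>y. D x \<^bold>\<and> (y \<^bold>\<in> B) \<^bold>\<and> (z \<^bold>= opair x y))) r"
      by blast
  qed
  have 2: "f_imp R (D z) (f_ex R (\<lambda>y. opair z y \<^bold>\<in> ?f)) p" if z: "is_name R z" for z
    unfolding f_imp_iff
  proof (intro allI impI)
    fix q assume q: "p \<preceq> q" "D z q"
    obtain r x where r: "q \<preceq> r" "x \<in> I" "\<phi> x r" "(z \<^bold>= a x) r" using total[OF z q] by blast
    have "(opair (a x) (b x) \<^bold>\<in> ?f) r" by (rule mem_compI[where \<phi> = \<phi> and x = x, OF I stable r(2,3) F[OF r(1)]])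
    then have *: "(opair z (b x) \<^bold>\<in> ?f) r" using pair_mem_cong[OF _ eq_sym[OF r(4)] eq_refl] by blast
    have "f_ex R (\<lambda>y. opair z y \<^bold>\<in> ?f) r"
      unfolding f_ex_iff using mem_mono[OF *] R_refl[OF F] names(2)[OF r(2)] by blast
    with r(1) show "\<exists>r. q \<preceq> r \<and> f_ex R (\<lambda>y. opair z y \<^bold>\<in> ?f) r" by blast
  qed
  have 3: "f_imp R (opair z y \<^bold>\<in> ?f) (f_imp R (opair z y' \<^bold>\<in> ?f) (y \<^bold>= y')) p" for z y y'
    unfolding f_imp_iff
  proof (intro allI impI)
    fix q assume q: "p \<preceq> q" "(opair z y \<^bold>\<in> ?f) q"
    have "\<exists>s. r \<preceq> s \<and> (y \<^bold>= y') s" if r: "q \<preceq> r" "(opair z y' \<^bold>\<in> ?f) r" for r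
    proof -
      obtain s x where s: "r \<preceq> s" "x \<in> I" "(opair z y' \<^bold>= opair (a x) (b x)) s" "\<phi> x s"
        using obt[OF r(2) F[OF r(1)]] .
      obtain t x' where t: "s \<preceq> t" "x' \<in> I" "(opair z y \<^bold>= opair (a x') (b x')) t" "\<phi> x' t"
        using obt[OF mem_mono[OF q(2) R_trans[OF r(1) s(1)]] F[OF s(1)]] .
      note Ft = F[OF t(1)]
      note D1 = opair_eqD[OF eq_mono[OF s(3) t(1)] Ft] and D2 = opair_eqD[OF t(3) Ft]
      have pt: "p \<preceq> t" using R_trans[OF R_trans[OF R_trans[OF q(1) r(1)] s(1)] t(1)] .
      have "(b x' \<^bold>= b x) t"
        using uniq[OF t(2) s(2) pt t(4) stableD[OF stable s(4) t(1)] eq_trans[OF eq_sym[OF D2(1)] D1(1)]] .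
      then have "(y \<^bold>= y') t" using eq_trans[OF D2(2) eq_trans[OF _ eq_sym[OF D1(2)]]] by blast
      then show ?thesis using R_trans[OF s(1) t(1)] by blast
    qed
    then show "\<exists>r. q \<preceq> r \<and> (\<forall>s. r \<preceq> s \<longrightarrow> (opair z y' \<^bold>\<in> ?f) s \<longrightarrow> (\<exists>t. s \<preceq> t \<and> (y \<^bold>= y') t))"
      using R_refl[OF F[OF q(1)]] by blast
  qed
  show ?thesis unfolding f_fun_def by (intro f_andI f_allI 1 2 3)
qed

lemma f_inj_comp:
  assumes I: "|I| \<le>o |UNIV :: ('a, 'b) index set|" and stable: "\<And>x. stable (\<phi> x)"
    and inj: "\<And>x y q. x \<in> I \<Longrightarrow> y \<in> I \<Longrightarrow> p \<preceq> q \<Longrightarrow> \<phi> x q \<Longrightarrow> \<phi> y q \<Longrightarrow> (b x \<^bold>= b y) q \<Longrightarrow> (a x \<^bold>= a y) q"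
  shows "f_inj R (comp_name I (\<lambda>x. opair (a x) (b x)) \<phi>) p"
proof -
  let ?f = "comp_name I (\<lambda>x. opair (a x) (b x)) \<phi>"
  note obt = mem_comp_obtain[OF I stable]
  note F = le_Field(2)
  have 3: "f_imp R (opair z y \<^bold>\<in> ?f) (f_imp R (opair z' y \<^bold>\<in> ?f) (z \<^bold>= z')) p" for z z' y
    unfolding f_imp_iff
  proof (intro allI impI)
    fix q assume q: "p \<preceq> q" "(opair z y \<^bold>\<in> ?f) q"
    have "\<exists>s. r \<preceq> s \<and> (z \<^bold>= z') s" if r: "q \<preceq> r" "(opair z' y \<^bold>\<in> ?f) r" for r
    proof -
      obtain s x where s: "r \<preceq> s" "x \<in> I" "(opair z' y \<^bold>= opair (a x) (b x)) s" "\<phi> x s"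
        using obt[OF r(2) F[OF r(1)]] .
      obtain t x' where t: "s \<preceq> t" "x' \<in> I" "(opair z y \<^bold>= opair (a x') (b x')) t" "\<phi> x' t"
        using obt[OF mem_mono[OF q(2) R_trans[OF r(1) s(1)]] F[OF s(1)]] .
      note Ft = F[OF t(1)]
      note D1 = opair_eqD[OF eq_mono[OF s(3) t(1)] Ft] and D2 = opair_eqD[OF t(3) Ft]
      have pt: "p \<preceq> t" using R_trans[OF R_trans[OF R_trans[OF q(1) r(1)] s(1)] t(1)] .
      have "(a x' \<^bold>= a x) t"
        using inj[OF t(2) s(2) pt t(4) stableD[OF stable s(4) t(1)] eq_trans[OF eq_sym[OF D2(2)] D1(2)]] .
      then have "(z \<^bold>= z') t" using eq_trans[OF D2(1) eq_trans[OF _ eq_sym[OF D1(1)]]] by blast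
      then show ?thesis using R_trans[OF s(1) t(1)] by blast
    qed
    then show "\<exists>r. q \<preceq> r \<and> (\<forall>s. r \<preceq> s \<longrightarrow> (opair z' y \<^bold>\<in> ?f) s \<longrightarrow> (\<exists>t. s \<preceq> t \<and> (z \<^bold>= z') t))"
      using R_refl[OF F[OF q(1)]] by blast
  qed
  show ?thesis unfolding f_inj_def f_all_iff using 3 by blast
qed

section \<open>Uncountability in the generic extension\<close>

text \<open>Uncountably many distinct objects would be mapped to the same number by conditions two of which are
  compatible, against injectivity.\<close>

lemma no_injection:
  assumes J: "uncountable J" and names: "\<And>x. x \<in> J \<Longrightarrow> is_name R (c x)"
    and dist: "\<And>x y q. x \<in> J \<Longrightarrow> y \<in> J \<Longrightarrow> q \<in> Field R \<Longrightarrow> (c x \<^bold>= c y) q \<Longrightarrow> x = y"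
    and mem: "\<And>x. x \<in> J \<Longrightarrow> (c x \<^bold>\<in> X) p" and p: "p \<in> Field R"
    and h: "f_fun R h (\<lambda>x. x \<^bold>\<in> X) check_omega p" "f_inj R h p"
  shows False
proof -
  have "\<exists>r n. p \<preceq> r \<and> (opair (c x) (check_nat n) \<^bold>\<in> h) r" if "x \<in> J" for x
    using fun_omega_value[OF h(1) p names[OF that]] mem[OF that] by blast
  then obtain r n where r: "\<And>x. x \<in> J \<Longrightarrow> p \<preceq> r x"
    "\<And>x. x \<in> J \<Longrightarrow> (opair (c x) (check_nat (n x :: nat)) \<^bold>\<in> h) (r x)" by metis
  obtain m where m: "uncountable {x\<in>J. n x = m}" using uncountable_fiber[OF J, of n] by blast
  obtain x y s where xy: "x \<in> {x\<in>J. n x = m}" "y \<in> {x\<in>J. n x = m}" "x \<noteq> y" "r x \<preceq> s" "r y \<preceq> s"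
    using ccc_indexed[OF m, of r] r(1) le_Field(2) by blast
  then have xJ: "x \<in> J" "y \<in> J" "n x = m" "n y = m" by blast+
  have hx: "(opair (c x) (check_nat m) \<^bold>\<in> h) s" "(opair (c y) (check_nat m) \<^bold>\<in> h) s"
    using mem_mono[OF r(2)[OF xJ(1)] xy(4)] mem_mono[OF r(2)[OF xJ(2)] xy(5)] xJ(3,4) by simp_all
  have "p \<preceq> s" using R_trans[OF r(1)[OF xJ(1)] xy(4)] .
  then have "(c x \<^bold>= c y) s"
    using inj_unique[OF stableD[OF stable_f_inj h(2)] le_Field(2) names[OF xJ(1)] names[OF xJ(2)] is_name_check_nat hx]
    by blast
  then show False using dist[OF xJ(1,2) le_Field(2)[OF xy(4)]] xy(3) by blast
qed

lemma not_countableI: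
  assumes J: "uncountable J" and names: "\<And>x. x \<in> J \<Longrightarrow> is_name R (c x)"
    and dist: "\<And>x y q. x \<in> J \<Longrightarrow> y \<in> J \<Longrightarrow> q \<in> Field R \<Longrightarrow> (c x \<^bold>= c y) q \<Longrightarrow> x = y"
    and mem: "\<And>x. x \<in> J \<Longrightarrow> (c x \<^bold>\<in> X) p"
  shows "f_not R (f_countable R X) p"
  unfolding f_not_iff
proof (intro allI impI notI)
  fix q assume q: "p \<preceq> q" "f_countable R X q"
  obtain r h where r: "q \<preceq> r" "f_fun R h (\<lambda>x. x \<^bold>\<in> X) check_omega r" "f_inj R h r"
    using ex_obtain[OF q(2)[unfolded f_countable_def] le_Field(2)[OF q(1)]] unfolding f_and_iff by blast
  show False
    using no_injection[OF J names dist mem_mono[OF mem R_trans[OF q(1) r(1)]] le_Field(2)[OF r(1)] r(2,3)] .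
qed

text \<open>The injection uses an enumeration of \<open>\<xi>\<close> from the ground model: an element of \<open>X\<close> is mapped to the
  number of the ordinal that it is decided to be.\<close>

lemma f_countable_below:
  assumes X: "is_name R X" and p: "p \<in> Field R"
    and sub: "\<And>z q. is_name R z \<Longrightarrow> p \<preceq> q \<Longrightarrow> (z \<^bold>\<in> X) q \<Longrightarrow> (z \<^bold>\<in> check_ord \<xi>) q"
  shows "f_countable R X p"
proof -
  define code where "code = to_nat_on {..<\<xi>}"
  have code: "\<eta> = \<zeta>" if "\<eta> < \<xi>" "\<zeta> < \<xi>" "code \<eta> = code \<zeta>" for \<eta> \<zeta>
    using inj_onD[OF inj_on_to_nat_on[OF countable_lessThan_w1[of \<xi>]], of \<eta> \<zeta>] that
    unfolding code_def by blast
  define I where "I = fst ` elts X \<times> {..<\<xi>}"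
  define \<phi> where "\<phi> x r \<longleftrightarrow> (fst x \<^bold>\<in> X) r \<and> (fst x \<^bold>= check_ord (snd x)) r"
    for x :: "('a, 'b) nm \<times> w1" and r
  define b :: "('a, 'b) nm \<times> w1 \<Rightarrow> ('a, 'b) nm" where "b x = check_nat (code (snd x))" for x
  have I: "|I| \<le>o |UNIV :: ('a, 'b) index set|"
    unfolding I_def by (rule Times_ordLeq_index[OF image_elts_ordLeq_index w1_ordLeq_index])
  have stable: "stable (\<phi> x)" for x
    unfolding \<phi>_def stable_def using mem_mono eq_mono by blast
  have a: "is_name R (fst x)" if x: "x \<in> I" for x
  proof -
    obtain c where "(fst x, c) \<in> elts X" using x unfolding I_def by fastforce
    then show ?thesis using is_name_eltsD[OF X] by blast
  qed
  have b: "is_name R (b x)" for x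
    unfolding b_def by (rule is_name_check_nat)
  let ?h = "comp_name I (\<lambda>x. opair (fst x) (b x)) \<phi>"
  have h: "f_fun R ?h (\<lambda>x. x \<^bold>\<in> X) check_omega q" if q: "p \<preceq> q" for q
  proof (rule f_fun_comp[OF I stable a b])
    fix x r assume "x \<in> I" "q \<preceq> r" "\<phi> x r"
    then show "(fst x \<^bold>\<in> X) r \<and> (b x \<^bold>\<in> check_omega) r"
      using mem_omegaI[OF le_Field(2)] unfolding \<phi>_def b_def by blast
  next
    fix z r assume z: "is_name R z" "q \<preceq> r" "(z \<^bold>\<in> X) r"
    obtain s \<eta> where s: "r \<preceq> s" "\<eta> < \<xi>" "(z \<^bold>= check_ord \<eta>) s"
      using mem_ordinal_obtain[OF ordinal_names_check_ord sub[OF z(1) R_trans[OF q z(2)] z(3)] le_Field(2)[OF z(2)]] .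
    obtain t v d where t: "s \<preceq> t" "(v, d) \<in> elts X" "d \<preceq> t" "(z \<^bold>= v) t"
      using mem_obtain[OF mem_mono[OF z(3) s(1)] le_Field(2)[OF s(1)]] .
    have "v \<in> fst ` elts X" using t(2) by (rule image_eqI[rotated]) simp
    then have "(v, \<eta>) \<in> I" using s(2) by (simp add: I_def)
    moreover have "\<phi> (v, \<eta>) t"
      using mem_eltsI[OF t(2,3)] eq_trans[OF eq_sym[OF t(4)] eq_mono[OF s(3) t(1)]]
      unfolding \<phi>_def by simp
    moreover have "(z \<^bold>= fst (v, \<eta>)) t" using t(4) by simp
    ultimately show "\<exists>s x. r \<preceq> s \<and> x \<in> I \<and> \<phi> x s \<and> (z \<^bold>= fst x) s"
      using R_trans[OF s(1) t(1)] by blast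
  next
    fix x y r assume "x \<in> I" "y \<in> I" and r: "q \<preceq> r" and *: "\<phi> x r" "\<phi> y r" "(fst x \<^bold>= fst y) r"
    have "(check_ord (snd x) \<^bold>= check_ord (snd y)) r"
      using * eq_trans[OF eq_sym eq_trans] unfolding \<phi>_def by blast
    from check_ord_eqD[OF this le_Field(2)[OF r]] show "(b x \<^bold>= b y) r"
      unfolding b_def by (simp add: eq_refl)
  qed
  have inj: "f_inj R ?h q" if q: "p \<preceq> q" for q
  proof (rule f_inj_comp[OF I stable])
    fix x y r assume xy: "x \<in> I" "y \<in> I" and r: "q \<preceq> r" and *: "\<phi> x r" "\<phi> y r" "(b x \<^bold>= b y) r"
    have "code (snd x) = code (snd y)"
      using check_nat_eqD[OF _ le_Field(2)[OF r]] *(3) unfolding b_def by blast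
    then have "snd x = snd y" using code[of "snd x" "snd y"] xy by (simp add: I_def mem_Times_iff)
    then have "(check_ord (snd x) \<^bold>= fst y) r" using *(2) eq_sym unfolding \<phi>_def by simp
    then show "(fst x \<^bold>= fst y) r" using *(1) eq_trans unfolding \<phi>_def by blast
  qed
  have nh: "is_name R ?h" by (rule is_name_comp[OF I]) (use a b is_name_opair in blast)
  show ?thesis
    unfolding f_countable_def f_ex_iff f_and_iff
  proof (intro allI impI)
    fix q assume q: "p \<preceq> q"
    show "\<exists>r h. q \<preceq> r \<and> is_name R h \<and> f_fun R h (\<lambda>x. x \<^bold>\<in> X) check_omega r \<and> f_inj R h r"
      using R_refl[OF le_Field(2)[OF q]] nh h[OF q] inj[OF q] by (intro exI[of _ q] exI[of _ ?h] conjI)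
  qed
qed

end

section \<open>The first uncountable ordinal of the generic extension\<close>

context forcing_poset
begin

lemma f_subsetI:
  assumes "\<And>z q. is_name R z \<Longrightarrow> p \<preceq> q \<Longrightarrow> (z \<^bold>\<in> x) q \<Longrightarrow> (z \<^bold>\<in> y) q"
  shows "f_subset R x y p"
  unfolding f_subset_def f_all_iff f_imp_iff using assms R_refl le_Field(2) by blast

lemma f_subsetD:
  assumes "f_subset R x y p" "p \<in> Field R" "is_name R z" "(z \<^bold>\<in> x) p"
  shows "(z \<^bold>\<in> y) p"
  using imp_regularD[OF allD[OF assms(1)[unfolded f_subset_def] assms(3)] stable_regular[OF regular_mem] regular_mem assms(4,2)] .

lemma imp_subsetD:
  assumes "f_imp R \<phi> (f_subset R x y) p" "stable \<phi>" "\<phi> p" "p \<in> Field R" "is_name R z" "(z \<^bold>\<in> x) p"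
  shows "(z \<^bold>\<in> y) p"
proof (rule mem_dense[OF assms(4)])
  fix q assume q: "p \<preceq> q"
  obtain r where r: "q \<preceq> r" "f_subset R x y r" using impD[OF assms(1) q stableD[OF assms(2,3) q]] by blast
  show "\<exists>r. q \<preceq> r \<and> (z \<^bold>\<in> y) r"
    using f_subsetD[OF r(2) le_Field(2)[OF r(1)] assms(5) mem_mono[OF assms(6) R_trans[OF q r(1)]]] r(1)
    by blast
qed

lemma stable_f_omega1: "stable (f_omega1 R W)"
  unfolding f_omega1_def by (intro stable_intros)

lemma omega1_transitive:
  assumes "f_omega1 R W p" "p \<in> Field R" "is_name R x" "is_name R z" "(x \<^bold>\<in> W) p" "(z \<^bold>\<in> x) p"
  shows "(z \<^bold>\<in> W) p"
proof -
  have "f_imp R (x \<^bold>\<in> W) (f_subset R x W) p"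
    using assms(1,3) unfolding f_omega1_def f_and_iff f_all_iff by blast
  from imp_subsetD[OF this stable_regular[OF regular_mem] assms(5,2,4,6)] show ?thesis .
qed

lemma omega1_elem_transitive:
  assumes "f_omega1 R W p" "p \<in> Field R" "is_name R x" "is_name R y" "is_name R z"
    and "(x \<^bold>\<in> W) p" "(y \<^bold>\<in> x) p" "(z \<^bold>\<in> y) p"
  shows "(z \<^bold>\<in> x) p"
proof (rule mem_dense[OF assms(2)])
  fix q assume q: "p \<preceq> q"
  have "f_imp R (x \<^bold>\<in> W) (f_imp R (y \<^bold>\<in> x) (f_subset R y x)) p"
    using assms(1,3,4) unfolding f_omega1_def f_and_iff f_all_iff by blast
  from impD[OF this q mem_mono[OF assms(6) q]]
  obtain r where r: "q \<preceq> r" "f_imp R (y \<^bold>\<in> x) (f_subset R y x) r" by blast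
  have pr: "p \<preceq> r" using R_trans[OF q r(1)] .
  have "(z \<^bold>\<in> x) r"
    using imp_subsetD[OF r(2) stable_regular[OF regular_mem] mem_mono[OF assms(7) pr] le_Field(2)[OF pr] assms(5)
        mem_mono[OF assms(8) pr]] .
  with r(1) show "\<exists>r. q \<preceq> r \<and> (z \<^bold>\<in> x) r" by blast
qed

lemma omega1_elem_countable:
  assumes "f_omega1 R W p" "p \<in> Field R" "is_name R x" "(x \<^bold>\<in> W) p"
  obtains r where "p \<preceq> r" "f_countable R x r"
proof -
  have "f_imp R (x \<^bold>\<in> W) (f_countable R x) p"
    using assms(1,3) unfolding f_omega1_def f_and_iff f_all_iff by blast
  from impD[OF this R_refl[OF assms(2)] assms(4)] that show thesis by blast
qed

lemma omega1_not_countable: "f_omega1 R W p \<Longrightarrow> f_not R (f_countable R W) p"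
  unfolding f_omega1_def f_and_iff by blast

text \<open>The axiom of foundation holds in the extension since names are well-founded.\<close>

lemma minimal_name:
  assumes "\<psi> x q" "is_name R x" "q \<in> Field R"
    and mono: "\<And>y r s. \<psi> y r \<Longrightarrow> r \<preceq> s \<Longrightarrow> \<psi> y s"
    and cong: "\<And>y z r. \<psi> y r \<Longrightarrow> (y \<^bold>= z) r \<Longrightarrow> \<psi> z r"
  shows "\<exists>y r. q \<preceq> r \<and> is_name R y \<and> \<psi> y r \<and> (\<forall>z s. r \<preceq> s \<longrightarrow> (z \<^bold>\<in> y) s \<longrightarrow> \<not> \<psi> z s)"
  using assms(1-3)
proof (induction x arbitrary: q rule: nm_induct)
  case (1 x)
  show ?case
  proof (cases "\<exists>z s. q \<preceq> s \<and> (z \<^bold>\<in> x) s \<and> \<psi> z s")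
    case True
    then obtain z s where s: "q \<preceq> s" "(z \<^bold>\<in> x) s" "\<psi> z s" by blast
    obtain t v d where t: "s \<preceq> t" "(v, d) \<in> elts x" "d \<preceq> t" "(z \<^bold>= v) t"
      using mem_obtain[OF s(2) le_Field(2)[OF s(1)]] .
    have "\<psi> v t" using cong[OF mono[OF s(3) t(1)] t(4)] .
    then have "\<exists>y r. t \<preceq> r \<and> is_name R y \<and> \<psi> y r \<and> (\<forall>z s. r \<preceq> s \<longrightarrow> (z \<^bold>\<in> y) s \<longrightarrow> \<not> \<psi> z s)"
      using 1(1)[OF t(2), of t] is_name_eltsD[OF 1(3) t(2)] le_Field(2)[OF t(1)] by blast
    then show ?thesis using R_trans[OF R_trans[OF s(1) t(1)]] by blast
  next
    case False
    then show ?thesis using 1(2-4) R_refl by blast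
  qed
qed

lemma eq_by_subset:
  assumes X: "is_name R X" and Y: "is_name R Y"
    and 1: "\<And>z q. is_name R z \<Longrightarrow> p \<preceq> q \<Longrightarrow> (z \<^bold>\<in> X) q \<Longrightarrow> (z \<^bold>\<in> Y) q"
    and 2: "\<And>z q. is_name R z \<Longrightarrow> p \<preceq> q \<Longrightarrow> (z \<^bold>\<in> Y) q \<Longrightarrow> (z \<^bold>\<in> X) q"
  shows "(X \<^bold>= Y) p"
proof (rule eqI)
  fix u c q assume "(u, c) \<in> elts X" "p \<preceq> q" "c \<preceq> q"
  then show "(u \<^bold>\<in> Y) q" using 1 is_name_eltsD[OF X] mem_eltsI by blast
next
  fix u c q assume "(u, c) \<in> elts Y" "p \<preceq> q" "c \<preceq> q"
  then show "(u \<^bold>\<in> X) q" using 2 is_name_eltsD[OF Y] mem_eltsI by blast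
qed

lemma check_ord_subsetI:
  assumes "\<And>\<eta>. \<eta> < \<xi> \<Longrightarrow> (check_ord \<eta> \<^bold>\<in> x) p" "p \<preceq> q" "(z \<^bold>\<in> check_ord \<xi>) q"
  shows "(z \<^bold>\<in> x) q"
proof (rule mem_dense[OF le_Field(2)[OF assms(2)]])
  fix r assume r: "q \<preceq> r"
  obtain s \<eta> where s: "r \<preceq> s" "\<eta> < \<xi>" "(z \<^bold>= check_ord \<eta>) s"
    using mem_ordinal_obtain[OF ordinal_names_check_ord mem_mono[OF assms(3) r] le_Field(2)[OF r]] .
  have "(check_ord \<eta> \<^bold>\<in> x) s"
    using mem_mono[OF assms(1)[OF s(2)] R_trans[OF R_trans[OF assms(2) r] s(1)]] .
  then show "\<exists>s. r \<preceq> s \<and> (z \<^bold>\<in> x) s" using s(1) mem_cong_left[OF s(3)] by blast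
qed

text \<open>Comparability with the ground model ordinal \<open>\<xi>\<close>.  If \<open>x\<close> is not below \<open>\<xi>\<close>, then \<open>\<xi> \<subseteq> x\<close> by
  induction; and if they are not equal, a minimal element of \<open>x - \<xi>\<close> is \<open>\<xi>\<close> itself.\<close>

lemma omega1_trichotomy:
  assumes "f_omega1 R W p" "p \<in> Field R" "is_name R x" "(x \<^bold>\<in> W) p"
  shows "\<exists>r. p \<preceq> r \<and> ((x \<^bold>= check_ord \<xi>) r \<or> (check_ord \<xi> \<^bold>\<in> x) r \<or> (x \<^bold>\<in> check_ord \<xi>) r)"
  using assms
proof (induction \<xi> arbitrary: x p rule: less_induct)
  case (less \<xi>)
  note W = less.prems(1) and p = less.prems(2) and x = less.prems(3) and xW = less.prems(4)
  have below: "(y \<^bold>\<in> check_ord \<xi>) q"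
    if "\<eta> < \<xi>" "(y \<^bold>= check_ord \<eta>) q \<or> (y \<^bold>\<in> check_ord \<eta>) q" "q \<in> Field R" for y \<eta> q
    using that(2)
  proof
    assume "(y \<^bold>= check_ord \<eta>) q"
    from mem_cong_left[OF this check_ord_memI[OF that(1,3)]] show ?thesis .
  next
    assume y: "(y \<^bold>\<in> check_ord \<eta>) q"
    show ?thesis
      by (rule check_ord_subsetI[OF _ R_refl[OF that(3)] y]) (use that(1,3) check_ord_memI in force)
  qed
  show ?case
  proof (cases "\<exists>q \<eta>. p \<preceq> q \<and> \<eta> < \<xi> \<and> ((x \<^bold>= check_ord \<eta>) q \<or> (x \<^bold>\<in> check_ord \<eta>) q)")
    case True
    then show ?thesis using below le_Field(2) by blast
  next
    case False
    have sub: "(check_ord \<eta> \<^bold>\<in> x) p" if \<eta>: "\<eta> < \<xi>" for \<eta>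
    proof (rule mem_dense[OF p])
      fix q assume q: "p \<preceq> q"
      show "\<exists>r. q \<preceq> r \<and> (check_ord \<eta> \<^bold>\<in> x) r"
        using less.IH[OF \<eta> stableD[OF stable_f_omega1 W q] le_Field(2)[OF q] x mem_mono[OF xW q]]
          False R_trans[OF q] \<eta> by blast
    qed
    define \<psi> where "\<psi> y q \<longleftrightarrow> (y \<^bold>\<in> x) q \<and> (\<forall>r. q \<preceq> r \<longrightarrow> \<not> (y \<^bold>\<in> check_ord \<xi>) r)" for y q
    have notpsi: "(z \<^bold>\<in> check_ord \<xi>) q" if zx: "(z \<^bold>\<in> x) q" and q: "q \<in> Field R"
      and no: "\<And>r. q \<preceq> r \<Longrightarrow> \<not> \<psi> z r" for z q
    proof (rule mem_dense[OF q])
      fix r assume r: "q \<preceq> r"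
      show "\<exists>s. r \<preceq> s \<and> (z \<^bold>\<in> check_ord \<xi>) s"
        using no[OF r] mem_mono[OF zx r] unfolding \<psi>_def by blast
    qed
    show ?thesis
    proof (cases "\<exists>y q. is_name R y \<and> p \<preceq> q \<and> \<psi> y q")
      case no: False
      have "(x \<^bold>= check_ord \<xi>) p"
      proof (rule eq_by_subset[OF x is_name_check_ord])
        fix z q assume z: "is_name R z" "p \<preceq> q" "(z \<^bold>\<in> x) q"
        show "(z \<^bold>\<in> check_ord \<xi>) q"
          by (rule notpsi[OF z(3) le_Field(2)[OF z(2)]]) (use no z(1) R_trans[OF z(2)] in blast)
      next
        fix z q assume "p \<preceq> q" "(z \<^bold>\<in> check_ord \<xi>) q"
        then show "(z \<^bold>\<in> x) q" using check_ord_subsetI[OF sub] by blast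
      qed
      then show ?thesis using R_refl[OF p] by blast
    next
      case True
      then obtain y0 q0 where y0: "is_name R y0" "p \<preceq> q0" "\<psi> y0 q0" by blast
      have "\<exists>y r. q0 \<preceq> r \<and> is_name R y \<and> \<psi> y r \<and> (\<forall>z s. r \<preceq> s \<longrightarrow> (z \<^bold>\<in> y) s \<longrightarrow> \<not> \<psi> z s)"
      proof (rule minimal_name[of \<psi>, OF y0(3,1) le_Field(2)[OF y0(2)]])
        fix y r s assume "\<psi> y r" "r \<preceq> s"
        then show "\<psi> y s" unfolding \<psi>_def using mem_mono R_trans by blast
      next
        fix y z r assume "\<psi> y r" "(y \<^bold>= z) r"
        then show "\<psi> z r" unfolding \<psi>_def using mem_cong_left eq_sym eq_mono by blast
      qed
      then obtain y r where r: "q0 \<preceq> r" "is_name R y" "\<psi> y r"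
        and min: "\<And>z s. r \<preceq> s \<Longrightarrow> (z \<^bold>\<in> y) s \<Longrightarrow> \<not> \<psi> z s" by blast
      have pr: "p \<preceq> r" using R_trans[OF y0(2) r(1)] .
      note Fr = le_Field(2)[OF pr]
      have yx: "(y \<^bold>\<in> x) r" and y_not: "\<And>s. r \<preceq> s \<Longrightarrow> \<not> (y \<^bold>\<in> check_ord \<xi>) s"
        using r(3) unfolding \<psi>_def by blast+
      note Wr = stableD[OF stable_f_omega1 W pr]
      have yW: "(y \<^bold>\<in> W) r" using omega1_transitive[OF Wr Fr x r(2) mem_mono[OF xW pr] yx] .
      have \<xi>y: "(check_ord \<eta> \<^bold>\<in> y) r" if \<eta>: "\<eta> < \<xi>" for \<eta>
      proof (rule mem_dense[OF Fr])
        fix q assume q: "r \<preceq> q"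
        obtain s where s: "q \<preceq> s" "(y \<^bold>= check_ord \<eta>) s \<or> (check_ord \<eta> \<^bold>\<in> y) s \<or> (y \<^bold>\<in> check_ord \<eta>) s"
          using less.IH[OF \<eta> stableD[OF stable_f_omega1 Wr q] le_Field(2)[OF q] r(2) mem_mono[OF yW q]] by blast
        then show "\<exists>s. q \<preceq> s \<and> (check_ord \<eta> \<^bold>\<in> y) s"
          using below[OF \<eta> _ le_Field(2)[OF s(1)]] y_not[OF R_trans[OF q s(1)]] by blast
      qed
      have "(y \<^bold>= check_ord \<xi>) r"
      proof (rule eq_by_subset[OF r(2) is_name_check_ord])
        fix z q assume z: "is_name R z" "r \<preceq> q" "(z \<^bold>\<in> y) q"
        note Fq = le_Field(2)[OF z(2)]
        have "(z \<^bold>\<in> x) q"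
          using omega1_elem_transitive[OF stableD[OF stable_f_omega1 Wr z(2)] Fq x r(2) z(1)
              mem_mono[OF xW R_trans[OF pr z(2)]] mem_mono[OF yx z(2)] z(3)] .
        then show "(z \<^bold>\<in> check_ord \<xi>) q"
          by (rule notpsi[OF _ Fq]) (use min R_trans[OF z(2)] mem_mono[OF z(3)] in blast)
      next
        fix z q assume "r \<preceq> q" "(z \<^bold>\<in> check_ord \<xi>) q"
        then show "(z \<^bold>\<in> y) q" using check_ord_subsetI[OF \<xi>y] by blast
      qed
      then have "(check_ord \<xi> \<^bold>\<in> x) r" using mem_cong_left[OF eq_sym yx] by blast
      then show ?thesis using pr by blast
    qed
  qed
qed

end

context ccc_poset
begin

lemma not_countable_if_check_ords:
  assumes "\<And>\<xi>. (check_ord \<xi> \<^bold>\<in> X) p"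
  shows "f_not R (f_countable R X) p"
proof (rule not_countableI[where J = "UNIV :: w1 set" and c = check_ord])
  show "uncountable (UNIV :: w1 set)" by (rule uncountable_UNIV_w1)
  fix x y q assume "q \<in> Field R" "(check_ord x \<^bold>= check_ord y) q"
  then show "x = y" using check_ord_eqD by blast
qed (use assms is_name_check_ord in blast)+

lemma check_ord_mem_mono:
  assumes "(z \<^bold>\<in> check_ord \<eta>) q" "\<eta> \<le> \<xi>" "q \<in> Field R"
  shows "(z \<^bold>\<in> check_ord \<xi>) q"
  by (rule check_ord_subsetI[OF _ R_refl[OF assms(3)] assms(1)])
    (use assms(2,3) check_ord_memI less_le_trans in blast)

lemma check_ord_mem_w1:
  assumes "(z \<^bold>\<in> check_ord \<eta>) q" "q \<in> Field R"
  shows "(z \<^bold>\<in> check_w1) q"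
  by (rule check_ord_subsetI[OF mem_w1I[OF assms(2)] R_refl[OF assms(2)] assms(1)])

text \<open>The elements are countable already in the ground model, and the chain condition keeps the whole set
  uncountable.\<close>

lemma f_omega1_check_w1:
  assumes p: "p \<in> Field R"
  shows "f_omega1 R check_w1 p"
proof -
  have 1: "(z \<^bold>\<in> check_w1) q" if h: "(x \<^bold>\<in> check_w1) q" "(z \<^bold>\<in> x) q" "q \<in> Field R" for x z q
  proof (rule mem_dense[OF h(3)])
    fix r assume r: "q \<preceq> r"
    obtain s \<xi> where s: "r \<preceq> s" "(x \<^bold>= check_ord \<xi>) s"
      using mem_w1_obtain[OF mem_mono[OF h(1) r] le_Field(2)[OF r]] .
    have "(z \<^bold>\<in> check_ord \<xi>) s"
      using mem_cong_right[OF mem_mono[OF h(2) R_trans[OF r s(1)]] s(2)] .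
    then show "\<exists>s. r \<preceq> s \<and> (z \<^bold>\<in> check_w1) s" using check_ord_mem_w1 le_Field(2) s(1) by blast
  qed
  have 2: "(z \<^bold>\<in> x) q" if h: "(x \<^bold>\<in> check_w1) q" "(y \<^bold>\<in> x) q" "(z \<^bold>\<in> y) q" "q \<in> Field R" for x y z q
  proof (rule mem_dense[OF h(4)])
    fix r assume r: "q \<preceq> r"
    obtain s \<xi> where s: "r \<preceq> s" "(x \<^bold>= check_ord \<xi>) s"
      using mem_w1_obtain[OF mem_mono[OF h(1) r] le_Field(2)[OF r]] .
    have qs: "q \<preceq> s" using R_trans[OF r s(1)] .
    obtain t \<eta> where t: "s \<preceq> t" "\<eta> < \<xi>" "(y \<^bold>= check_ord \<eta>) t"
      using mem_ordinal_obtain[OF ordinal_names_check_ord mem_cong_right[OF mem_mono[OF h(2) qs] s(2)]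
          le_Field(2)[OF s(1)]] .
    have qt: "q \<preceq> t" using R_trans[OF qs t(1)] .
    have "(z \<^bold>\<in> check_ord \<xi>) t"
      using check_ord_mem_mono[OF mem_cong_right[OF mem_mono[OF h(3) qt] t(3)] less_imp_le[OF t(2)] le_Field(2)[OF qt]] .
    then have "(z \<^bold>\<in> x) t" using mem_cong_right[OF _ eq_sym[OF eq_mono[OF s(2) t(1)]]] by blast
    then show "\<exists>s. r \<preceq> s \<and> (z \<^bold>\<in> x) s" using R_trans[OF s(1) t(1)] by blast
  qed
  have 3: "\<exists>r. q \<preceq> r \<and> f_countable R x r" if x: "is_name R x" "(x \<^bold>\<in> check_w1) q" "q \<in> Field R" for x q
  proof -
    obtain r \<xi> where r: "q \<preceq> r" "(x \<^bold>= check_ord \<xi>) r"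
      using mem_w1_obtain[OF x(2,3)] .
    have "f_countable R x r"
      by (rule f_countable_below[OF x(1) le_Field(2)[OF r(1)]])
        (use mem_cong_right eq_mono[OF r(2)] in blast)
    with r(1) show ?thesis by blast
  qed
  show ?thesis
    unfolding f_omega1_def
  proof (intro f_andI f_allI)
    fix x
    show "f_imp R (x \<^bold>\<in> check_w1) (f_subset R x check_w1) p"
      unfolding f_imp_iff
      using 1 mem_mono R_refl le_Field(2) by (blast intro: f_subsetI)
    fix y
    show "f_imp R (x \<^bold>\<in> check_w1) (f_imp R (y \<^bold>\<in> x) (f_subset R y x)) p"
      unfolding f_imp_iff
    proof (intro allI impI)
      fix q assume q: "p \<preceq> q" "(x \<^bold>\<in> check_w1) q"
      have "f_subset R y x r" if "q \<preceq> r" "(y \<^bold>\<in> x) r" for r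
        by (rule f_subsetI) (use 2 mem_mono[OF q(2)] mem_mono[OF that(2)] R_trans[OF that(1)] le_Field(2) in blast)
      then show "\<exists>r. q \<preceq> r \<and> (\<forall>s. r \<preceq> s \<longrightarrow> (y \<^bold>\<in> x) s \<longrightarrow> (\<exists>t. s \<preceq> t \<and> f_subset R y x t))"
        using R_refl le_Field(2) q(1) by blast
    qed
  next
    show "f_not R (f_countable R check_w1) p" using not_countable_if_check_ords mem_w1I[OF p] by blast
  next
    fix x assume "is_name R x"
    then show "f_imp R (x \<^bold>\<in> check_w1) (f_countable R x) p"
      unfolding f_imp_iff using 3 le_Field(2) by blast
  qed
qed

text \<open>By trichotomy, a ground model ordinal that could be missing from \<open>W\<close> would be a bound for \<open>W\<close>, which would
  then be countable; and an element of \<open>W\<close> different from all countable ordinals of the ground model would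
  contain all of them and be uncountable.\<close>

lemma f_omega1_unique:
  assumes W: "f_omega1 R W p" and p: "p \<in> Field R" and nW: "is_name R W"
  shows "(W \<^bold>= check_w1) p"
proof -
  have tri: "\<exists>r. q \<preceq> r \<and> ((x \<^bold>= check_ord \<xi>) r \<or> (check_ord \<xi> \<^bold>\<in> x) r \<or> (x \<^bold>\<in> check_ord \<xi>) r)"
    if "is_name R x" "p \<preceq> q" "(x \<^bold>\<in> W) q" for x q \<xi>
    using omega1_trichotomy[OF stableD[OF stable_f_omega1 W that(2)] le_Field(2)[OF that(2)] that(1,3)] .
  have sub: "(check_ord \<xi> \<^bold>\<in> W) p" for \<xi>
  proof (rule mem_dense[OF p])
    fix q assume q: "p \<preceq> q"
    show "\<exists>r. q \<preceq> r \<and> (check_ord \<xi> \<^bold>\<in> W) r"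
    proof (rule ccontr)
      assume no: "\<not> ?thesis"
      have "f_countable R W q"
      proof (rule f_countable_below[OF nW le_Field(2)[OF q]])
        fix z r assume z: "is_name R z" "q \<preceq> r" "(z \<^bold>\<in> W) r"
        show "(z \<^bold>\<in> check_ord \<xi>) r"
        proof (rule mem_dense[OF le_Field(2)[OF z(2)]])
          fix s assume s: "r \<preceq> s"
          have qs: "q \<preceq> s" using R_trans[OF z(2) s] .
          obtain t where t: "s \<preceq> t" "(z \<^bold>= check_ord \<xi>) t \<or> (check_ord \<xi> \<^bold>\<in> z) t \<or> (z \<^bold>\<in> check_ord \<xi>) t"
            using tri[OF z(1) R_trans[OF q qs] mem_mono[OF z(3) s]] by blast
          have qt: "q \<preceq> t" and zt: "(z \<^bold>\<in> W) t"
            using R_trans[OF qs t(1)] mem_mono[OF z(3) R_trans[OF s t(1)]] by blast+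
          have "\<not> (z \<^bold>= check_ord \<xi>) t"
            using mem_cong_left[OF eq_sym zt] no qt by blast
          moreover have "\<not> (check_ord \<xi> \<^bold>\<in> z) t"
            using omega1_transitive[OF stableD[OF stable_f_omega1 W R_trans[OF q qt]] le_Field(2)[OF qt] z(1)
                is_name_check_ord zt] no qt by blast
          ultimately show "\<exists>t. s \<preceq> t \<and> (z \<^bold>\<in> check_ord \<xi>) t" using t by blast
        qed
      qed
      then show False using omega1_not_countable[OF W] q unfolding f_not_iff by blast
    qed
  qed
  show ?thesis
  proof (rule eq_by_subset[OF nW is_name_check_w1])
    fix z q assume z: "is_name R z" "p \<preceq> q" "(z \<^bold>\<in> W) q"
    show "(z \<^bold>\<in> check_w1) q"
    proof (rule mem_dense[OF le_Field(2)[OF z(2)]], rule ccontr)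
      fix r assume r: "q \<preceq> r" and no: "\<not> (\<exists>s. r \<preceq> s \<and> (z \<^bold>\<in> check_w1) s)"
      have pr: "p \<preceq> r" using R_trans[OF z(2) r] .
      have "(check_ord \<xi> \<^bold>\<in> z) r" for \<xi>
      proof (rule mem_dense[OF le_Field(2)[OF r]])
        fix s assume s: "r \<preceq> s"
        obtain t where t: "s \<preceq> t" "(z \<^bold>= check_ord \<xi>) t \<or> (check_ord \<xi> \<^bold>\<in> z) t \<or> (z \<^bold>\<in> check_ord \<xi>) t"
          using tri[OF z(1) R_trans[OF pr s] mem_mono[OF z(3) R_trans[OF r s]]] by blast
        have "\<not> (z \<^bold>\<in> check_w1) t" using no R_trans[OF s t(1)] by blast
        then have "\<not> (z \<^bold>= check_ord \<xi>) t" "\<not> (z \<^bold>\<in> check_ord \<xi>) t"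
          using mem_cong_left[OF _ mem_w1I] check_ord_mem_w1 le_Field(2)[OF t(1)] by blast+
        then show "\<exists>t. s \<preceq> t \<and> (check_ord \<xi> \<^bold>\<in> z) t" using t by blast
      qed
      then have "f_not R (f_countable R z) r" by (rule not_countable_if_check_ords)
      moreover obtain s where "r \<preceq> s" "f_countable R z s"
        using omega1_elem_countable[OF stableD[OF stable_f_omega1 W pr] le_Field(2)[OF pr] z(1) mem_mono[OF z(3) r]] .
      ultimately show False unfolding f_not_iff by blast
    qed
  next
    fix z q assume z: "p \<preceq> q" "(z \<^bold>\<in> check_w1) q"
    show "(z \<^bold>\<in> W) q"
    proof (rule mem_dense[OF le_Field(2)[OF z(1)]])
      fix r assume r: "q \<preceq> r"
      obtain s \<xi> where s: "r \<preceq> s" "(z \<^bold>= check_ord \<xi>) s"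
        using mem_w1_obtain[OF mem_mono[OF z(2) r] le_Field(2)[OF r]] .
      then show "\<exists>s. r \<preceq> s \<and> (z \<^bold>\<in> W) s"
        using mem_cong_left[OF s(2) mem_mono[OF sub R_trans[OF R_trans[OF z(1) r] s(1)]]] by blast
    qed
  qed
qed

end

section \<open>Sweetness and the countable chain condition\<close>

lemma uncountable_inj_w1:
  assumes "uncountable A"
  shows "\<exists>g :: w1 \<Rightarrow> 'b. inj g \<and> range g \<subseteq> A"
proof -
  have "natLeq <o |A|"
    using not_ordLeq_iff_ordLess[OF natLeq_Well_order card_of_Well_order, of A] assms
    by (simp add: countable_card_le_natLeq)
  then have "omega1 \<le>o |A|"
    unfolding cardSuc_ordLess_ordLeq[OF natLeq_Card_order card_of_Card_order] .
  then have "|Field omega1| \<le>o |A|"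
    by (rule ordIso_ordLeq_trans[OF Field_omega1_ordIso])
  then obtain g where g: "inj_on g (Field omega1)" "g ` Field omega1 \<subseteq> A"
    unfolding card_of_ordLeq[symmetric] by blast
  have "inj (\<lambda>x. g (Rep_w1 x))"
    by (rule injI) (use inj_onD[OF g(1) _ Rep_w1 Rep_w1] Rep_w1_inject in blast)
  moreover have "range (\<lambda>x. g (Rep_w1 x)) \<subseteq> A" using g(2) Rep_w1 by blast
  ultimately show ?thesis by blast
qed

context forcing_poset
begin

lemma forces_inf_gen_mono: "forces_inf_gen R p x \<Longrightarrow> p \<preceq> q \<Longrightarrow> forces_inf_gen R q x"
  unfolding forces_inf_gen_def using R_trans by blast

lemma forces_inf_gen_obtain:
  assumes "forces_inf_gen R p x" "p \<in> Field R"
  obtains q i where "p \<preceq> q" "m < i" "x i \<preceq> q"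
proof -
  obtain r i where r: "p \<preceq> r" "m < i" "forces_gen R r (x i)"
    using assms(1) R_refl[OF assms(2)] unfolding forces_inf_gen_def by blast
  obtain q where "r \<preceq> q" "x i \<preceq> q"
    using r(3) R_refl[OF le_Field(2)[OF r(1)]] unfolding forces_gen_def by blast
  with that r(1,2) R_trans show thesis by blast
qed

text \<open>Spread provides a sequence along which the functions given by sweetness grow, and some
  condition forces infinitely many, hence two, of its members to be generic.\<close>

lemma sweet_compatible:
  fixes J :: "w1 set"
  assumes "spread F" "sweet F R" "uncountable J" "\<And>x. x \<in> J \<Longrightarrow> p x \<in> Field R"
  obtains x y s where "x \<in> J" "y \<in> J" "x < y" "p x \<preceq> s" "p y \<preceq> s"
proof -
  have pJ: "\<forall>x\<in>J. p x \<in> Field R" using assms(4) by blast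
  obtain A K and N :: nat and f where A: "A \<subseteq> J" "uncountable A" and f: "\<forall>x\<in>A. \<forall>n<N. f x n \<in> F"
    "inj_on (\<lambda>(x, n). f x n) (A \<times> {..<N})"
    and gen: "growth_ensures f N K A (\<lambda>s k. \<exists>r\<in>Field R. forces_inf_gen R r (\<lambda>i. p (s i)))"
    using sweet_on_uncountable[OF assms(2,3) pJ] by (elim exE conjE) (rule that)
  obtain s k where s: "strict_mono s" "range s \<subseteq> A" "K < k" "grows_at f N s k"
    using spread_on_uncountable[OF assms(1) A(2) _ f(2), of K] f(1) by blast
  then obtain r where r: "r \<in> Field R" "forces_inf_gen R r (\<lambda>i. p (s i))" using gen by blast
  obtain q i where q: "r \<preceq> q" "0 < i" "p (s i) \<preceq> q" using forces_inf_gen_obtain[OF r(2,1)] .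
  obtain t j where t: "q \<preceq> t" "i < j" "p (s j) \<preceq> t"
    using forces_inf_gen_obtain[OF forces_inf_gen_mono[OF r(2) q(1)] le_Field(2)[OF q(1)]] .
  have "s i \<in> J" "s j \<in> J" using s(2) A(1) by blast+
  then show thesis using that[of "s i" "s j" t] strict_monoD[OF s(1) t(2)] R_trans[OF q(3) t(1)] t(3) by blast
qed

lemma ccc_poset_if_sweet:
  assumes "spread F" "sweet F R"
  shows "ccc_poset R"
proof
  fix A assume A: "A \<subseteq> Field R"
    and anti: "\<And>p q. p \<in> A \<Longrightarrow> q \<in> A \<Longrightarrow> p \<noteq> q \<Longrightarrow> \<not> (\<exists>r. p \<preceq> r \<and> q \<preceq> r)"
  show "countable A"
  proof (rule ccontr)
    assume "uncountable A"
    then obtain g :: "w1 \<Rightarrow> _" where g: "inj g" "range g \<subseteq> A" using uncountable_inj_w1 by blast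
    have gA: "g x \<in> A" for x using g(2) by blast
    obtain x y s where xy: "x < y" "g x \<preceq> s" "g y \<preceq> s"
      by (rule sweet_compatible[OF assms uncountable_UNIV_w1, of g]) (use gA A in blast)+
    have "g x \<noteq> g y" using injD[OF g(1), of x y] xy(1) by auto
    then show False using anti[OF gA gA] xy(2,3) by blast
  qed
qed

lemma f_impI:
  assumes "\<And>q. p \<preceq> q \<Longrightarrow> \<phi> q \<Longrightarrow> \<psi> q"
  shows "f_imp R \<phi> \<psi> p"
  unfolding f_imp_iff using assms R_refl le_Field(2) by blast

lemma f_exI:
  assumes "is_name R x" "stable (\<phi> x)" "\<phi> x p"
  shows "f_ex R \<phi> p"
  unfolding f_ex_iff using assms(1) stableD[OF assms(2,3)] R_refl le_Field(2) by blast

lemma f_ex_dense: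
  assumes "\<And>q. p \<preceq> q \<Longrightarrow> \<exists>r. q \<preceq> r \<and> f_ex R \<phi> r"
  shows "f_ex R \<phi> p"
  unfolding f_ex_iff
proof (intro allI impI)
  fix q assume "p \<preceq> q"
  then obtain r where r: "q \<preceq> r" "f_ex R \<phi> r" using assms by blast
  obtain s x where "r \<preceq> s" "is_name R x" "\<phi> x s" using ex_obtain[OF r(2) le_Field(2)[OF r(1)]] .
  then show "\<exists>r x. q \<preceq> r \<and> is_name R x \<and> \<phi> x r" using R_trans[OF r(1)] by blast
qed

lemma f_less_at_checkI:
  assumes "(u \<^bold>= check_fun f) p" "(v \<^bold>= check_fun g) p" "f k < g k" "p \<in> Field R"
  shows "f_less_at R u v (check_nat k) p"
  unfolding f_less_at_def
proof (rule f_exI[OF is_name_check_nat[of "f k"] stable_ex], rule f_exI[OF is_name_check_nat[of "g k"]])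
  show "(opair (check_nat k) (check_nat (f k)) \<^bold>\<in> u \<^bold>\<and> opair (check_nat k) (check_nat (g k)) \<^bold>\<in> v \<^bold>\<and>
      check_nat (f k) \<^bold>\<in> check_nat (g k)) p"
    using mem_cong_right[OF check_fun_memI[OF assms(4)] eq_sym[OF assms(1)]]
      mem_cong_right[OF check_fun_memI[OF assms(4)] eq_sym[OF assms(2)]] check_nat_memI[OF assms(3,4)]
    by (intro f_andI)
qed (intro stable_intros)

end

section \<open>The subsequence that meets the generic filter\<close>

text \<open>The condition \<open>p\<close> forces that \<open>r i\<close> is in the generic filter for infinitely many \<open>i\<close>.  In the extension
  these \<open>i\<close> can be enumerated in increasing order, and \<open>\<xi>\<close> composed with the enumeration is an increasing
  sequence of ordinals.\<close>

locale generic_subsequence = ccc_poset R for R :: "('a, 'b) cond rel" +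
  fixes \<xi> :: "nat \<Rightarrow> w1" and r :: "nat \<Rightarrow> ('a, 'b) cond" and p
  assumes strict_mono_\<xi>: "strict_mono \<xi>"
    and p_Field: "p \<in> Field R"
    and inf: "forces_inf_gen R p r"
begin

text \<open>A condition settles whether \<open>r k\<close> is generic if it is stronger than \<open>r k\<close> or incompatible with it.  So
  \<open>nth_met j i\<close> expresses that \<open>i\<close> is the index met after exactly \<open>j\<close> smaller ones.\<close>

definition decided :: "nat \<Rightarrow> ('a, 'b) cond \<Rightarrow> bool" where
  "decided m q \<longleftrightarrow> (\<forall>k<m. r k \<preceq> q \<or> \<not> (\<exists>t. q \<preceq> t \<and> r k \<preceq> t))"

definition met :: "nat \<Rightarrow> ('a, 'b) cond \<Rightarrow> nat set" where
  "met m q = {k. k < m \<and> r k \<preceq> q}"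

definition nth_met :: "nat \<Rightarrow> nat \<Rightarrow> ('a, 'b) fml" where
  "nth_met j i q \<longleftrightarrow> decided i q \<and> card (met i q) = j \<and> r i \<preceq> q"

definition generic_seq :: "('a, 'b) nm" where
  "generic_seq = comp_name UNIV (\<lambda>x. opair (check_nat (fst x)) (check_ord (\<xi> (snd x)))) (\<lambda>x. nth_met (fst x) (snd x))"

lemma met_mono: "decided m q \<Longrightarrow> q \<preceq> q' \<Longrightarrow> met m q' = met m q"
  unfolding met_def decided_def using R_trans by blast

lemma decided_mono: "decided m q \<Longrightarrow> q \<preceq> q' \<Longrightarrow> decided m q'"
  unfolding decided_def using R_trans by blast

lemma stable_nth_met: "stable (nth_met j i)"
  unfolding stable_def nth_met_def using met_mono decided_mono R_trans by metis

lemma finite_met: "finite (met m q)"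
  unfolding met_def by simp

lemma nth_met_less:
  assumes "nth_met j i q" "nth_met j' i' q" "j < j'"
  shows "i < i'"
proof (rule ccontr)
  assume "\<not> i < i'"
  then have "met i' q \<subseteq> met i q" unfolding met_def by auto
  then have "card (met i' q) \<le> card (met i q)" by (rule card_mono[OF finite_met])
  then show False using assms unfolding nth_met_def by simp
qed

lemma nth_met_unique:
  assumes "nth_met j i q" "nth_met j i' q"
  shows "i = i'"
proof -
  have "\<not> i < i'" if "nth_met j i q" "nth_met j i' q" for i i'
  proof
    assume "i < i'"
    then have "insert i (met i q) \<subseteq> met i' q" using that unfolding met_def nth_met_def by auto
    then have "card (insert i (met i q)) \<le> card (met i' q)" by (rule card_mono[OF finite_met])
    moreover have "i \<notin> met i q" unfolding met_def by simp
    ultimately show False using that finite_met unfolding nth_met_def by simp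
  qed
  with assms show ?thesis by (meson linorder_neqE_nat)
qed

lemma nth_met_le: "nth_met j i q \<Longrightarrow> j \<le> i"
proof -
  assume "nth_met j i q"
  moreover have "card (met i q) \<le> card {..<i}" by (rule card_mono) (auto simp: met_def)
  ultimately show ?thesis unfolding nth_met_def by simp
qed

text \<open>The next index after \<open>m\<close> at which the generic filter is met is the least one that is not ruled
  out.\<close>

lemma next_met:
  assumes "p \<preceq> q" "decided m q"
  obtains t i where "q \<preceq> t" "decided i t" "r i \<preceq> t" "met i t = met m q"
proof -
  let ?P = "\<lambda>i. m \<le> i \<and> (\<exists>t. q \<preceq> t \<and> r i \<preceq> t)"
  obtain t0 i0 where "q \<preceq> t0" "m < i0" "r i0 \<preceq> t0"
    using forces_inf_gen_obtain[OF forces_inf_gen_mono[OF inf assms(1)] le_Field(2)[OF assms(1)]] .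
  then have ex: "?P i0" by auto
  define i where "i = (LEAST i. ?P i)"
  have Pi: "?P i" unfolding i_def by (rule LeastI[of ?P, OF ex])
  have least: "\<not> ?P k" if "k < i" for k using not_less_Least[of k ?P] that unfolding i_def by blast
  obtain t where t: "q \<preceq> t" "r i \<preceq> t" using Pi by blast
  have out: "\<not> (\<exists>s. q \<preceq> s \<and> r k \<preceq> s)" if "m \<le> k" "k < i" for k using least[OF that(2)] that(1) by blast
  have "decided i t"
    unfolding decided_def
  proof (intro allI impI)
    fix k assume k: "k < i"
    show "r k \<preceq> t \<or> \<not> (\<exists>s. t \<preceq> s \<and> r k \<preceq> s)"
    proof (cases "k < m")
      case True
      then show ?thesis using decided_mono[OF assms(2) t(1)] unfolding decided_def by blast
    next
      case False
      then show ?thesis using out[OF _ k] R_trans[OF t(1)] by auto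
    qed
  qed
  moreover have "met i t = met m q"
  proof -
    have "met i t = met m t"
    proof (rule set_eqI)
      fix k
      have "k < i" if "k < m" using that Pi by simp
      moreover have "k < m" if "k < i" "r k \<preceq> t"
        using out[of k] that t(1) by (meson not_less)
      ultimately show "k \<in> met i t \<longleftrightarrow> k \<in> met m t" unfolding met_def by blast
    qed
    also have "\<dots> = met m q" using met_mono[OF assms(2) t(1)] .
    finally show ?thesis .
  qed
  ultimately show thesis using that t by blast
qed

lemma nth_met_exists:
  assumes "p \<preceq> q"
  shows "\<exists>t i. q \<preceq> t \<and> nth_met j i t"
  using assms
proof (induction j arbitrary: q)
  case 0
  have "decided 0 q" unfolding decided_def by simp
  from next_met[OF 0 this] obtain t i where "q \<preceq> t" "decided i t" "r i \<preceq> t" "met i t = met 0 q" .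
  moreover have "card (met 0 q) = 0" unfolding met_def by simp
  ultimately show ?case unfolding nth_met_def by metis
next
  case (Suc j)
  obtain q' i where q': "q \<preceq> q'" "nth_met j i q'" using Suc.IH[OF Suc.prems] by blast
  have "decided (Suc i) q'" using q'(2) unfolding nth_met_def decided_def by (auto simp: less_Suc_eq)
  from next_met[OF R_trans[OF Suc.prems q'(1)] this]
  obtain t i' where t: "q' \<preceq> t" "decided i' t" "r i' \<preceq> t" "met i' t = met (Suc i) q'" .
  have "met (Suc i) q' = insert i (met i q')"
    using q'(2) unfolding met_def nth_met_def by (auto simp: less_Suc_eq)
  moreover have "i \<notin> met i q'" unfolding met_def by simp
  ultimately have "card (met i' t) = Suc j" using t(4) q'(2) finite_met unfolding nth_met_def by simp
  then show ?case using t R_trans[OF q'(1)] unfolding nth_met_def by blast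
qed

lemma index_small: "|UNIV :: (nat \<times> nat) set| \<le>o |UNIV :: ('a, 'b) index set|"
  by (rule countable_ordLeq_index) simp

lemma is_name_generic_seq: "is_name R generic_seq"
  unfolding generic_seq_def by (rule is_name_comp[OF index_small]) (intro is_name_opair is_name_check_nat is_name_check_ord)

lemma mem_generic_seq_obtain:
  assumes "(opair x y \<^bold>\<in> generic_seq) q" "q \<in> Field R"
  obtains t j i where "q \<preceq> t" "(x \<^bold>= check_nat j) t" "(y \<^bold>= check_ord (\<xi> i)) t" "nth_met j i t"
proof -
  obtain t z where t: "q \<preceq> t" "(opair x y \<^bold>= opair (check_nat (fst z)) (check_ord (\<xi> (snd z)))) t"
      "nth_met (fst z) (snd z) t"
    using mem_comp_obtain[OF index_small stable_nth_met assms[unfolded generic_seq_def]] by blast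
  show thesis using that[OF t(1) opair_eqD[OF t(2) le_Field(2)[OF t(1)]] t(3)] .
qed

lemma f_fun_generic_seq:
  assumes "\<And>i q. p \<preceq> q \<Longrightarrow> r i \<preceq> q \<Longrightarrow> (check_ord (\<xi> i) \<^bold>\<in> A) q"
  shows "f_fun R generic_seq (\<lambda>x. x \<^bold>\<in> check_omega) A p"
  unfolding generic_seq_def
proof (rule f_fun_comp[OF index_small stable_nth_met is_name_check_nat is_name_check_ord])
  fix x q assume "p \<preceq> q" "nth_met (fst x) (snd x) q"
  then show "(check_nat (fst x) \<^bold>\<in> check_omega) q \<and> (check_ord (\<xi> (snd x)) \<^bold>\<in> A) q"
    using assms mem_omegaI[OF le_Field(2)] unfolding nth_met_def by blast
next
  fix z q assume z: "p \<preceq> q" "(z \<^bold>\<in> check_omega) q"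
  obtain t n where t: "q \<preceq> t" "(z \<^bold>= check_nat n) t" using mem_omega_obtain[OF z(2) le_Field(2)[OF z(1)]] .
  obtain s i where s: "t \<preceq> s" "nth_met n i s" using nth_met_exists[OF R_trans[OF z(1) t(1)]] by blast
  then show "\<exists>s x. q \<preceq> s \<and> x \<in> UNIV \<and> nth_met (fst x) (snd x) s \<and> (z \<^bold>= check_nat (fst x)) s"
    using R_trans[OF t(1)] eq_mono[OF t(2)] by (intro exI[of _ s] exI[of _ "(n, i)"]) simp
next
  fix x y q assume q: "p \<preceq> q" "nth_met (fst x) (snd x) q" "nth_met (fst y) (snd y) q"
    and eq: "(check_nat (fst x) \<^bold>= check_nat (fst y)) q"
  have "fst x = fst y" using check_nat_eqD[OF eq le_Field(2)[OF q(1)]] .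
  then have "snd x = snd y" using nth_met_unique q(2,3) by simp
  then show "(check_ord (\<xi> (snd x)) \<^bold>= check_ord (\<xi> (snd y))) q" by (simp add: eq_refl)
qed

lemma stable_f_suc: "stable (f_suc R i j)"
  unfolding f_suc_def f_iff_def by (intro stable_intros)

lemma generic_seq_successive_obtain:
  assumes "(opair x a \<^bold>\<in> generic_seq) q" "(opair y b \<^bold>\<in> generic_seq) q" "f_suc R x y q" "q \<in> Field R"
  obtains t i i' where "q \<preceq> t" "(a \<^bold>= check_ord (\<xi> i)) t" "(b \<^bold>= check_ord (\<xi> i')) t" "i < i'"
    "r i \<preceq> t" "r i' \<preceq> t"
proof -
  obtain s j i where s: "q \<preceq> s" "(x \<^bold>= check_nat j) s" "(a \<^bold>= check_ord (\<xi> i)) s" "nth_met j i s"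
    using mem_generic_seq_obtain[OF assms(1,4)] .
  obtain t j' i' where t: "s \<preceq> t" "(y \<^bold>= check_nat j') t" "(b \<^bold>= check_ord (\<xi> i')) t" "nth_met j' i' t"
    using mem_generic_seq_obtain[OF mem_mono[OF assms(2) s(1)] le_Field(2)[OF s(1)]] .
  have "j' = Suc j"
    using f_suc_checkD[OF stableD[OF stable_f_suc assms(3) R_trans[OF s(1) t(1)]] le_Field(2)[OF t(1)]
        eq_mono[OF s(2) t(1)] t(2)] .
  note m = stableD[OF stable_nth_met s(4) t(1)]
  have "i < i'" using nth_met_less[OF m t(4)] \<open>j' = Suc j\<close> by simp
  then show thesis
    using that[OF R_trans[OF s(1) t(1)] eq_mono[OF s(3) t(1)] t(3)] m t(4) unfolding nth_met_def by blast
qed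

lemma f_increasing_generic_seq: "f_increasing R generic_seq q"
  unfolding f_increasing_def
proof (intro f_allI f_impI)
  fix x y a b q1 q2 q3 q4
  assume q: "q \<preceq> q1" "q1 \<preceq> q2" "q2 \<preceq> q3" "q3 \<preceq> q4"
    and h: "f_suc R x y q2" "(opair x a \<^bold>\<in> generic_seq) q3" "(opair y b \<^bold>\<in> generic_seq) q4"
  show "(a \<^bold>\<in> b) q4"
  proof (rule mem_dense[OF le_Field(2)[OF q(4)]])
    fix s assume s: "q4 \<preceq> s"
    obtain t i i' where t: "s \<preceq> t" "(a \<^bold>= check_ord (\<xi> i)) t" "(b \<^bold>= check_ord (\<xi> i')) t" "i < i'"
      using generic_seq_successive_obtain[OF mem_mono[OF h(2) R_trans[OF q(4) s]] mem_mono[OF h(3) s]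
        stableD[OF stable_f_suc h(1) R_trans[OF R_trans[OF q(3,4)] s]] le_Field(2)[OF s]] .
    have "(check_ord (\<xi> i) \<^bold>\<in> check_ord (\<xi> i')) t"
      using check_ord_memI[OF strict_monoD[OF strict_mono_\<xi> t(4)] le_Field(2)[OF t(1)]] .
    then have "(a \<^bold>\<in> b) t" using mem_cong_left[OF t(2) mem_cong_right[OF _ eq_sym[OF t(3)]]] by blast
    with t(1) show "\<exists>t. s \<preceq> t \<and> (a \<^bold>\<in> b) t" by blast
  qed
qed

text \<open>The subsequence skips indices, but growth from each index to the next is transitive.\<close>

lemma f_grows_generic_seq:
  assumes f: "f_fun R f D (check_family F) p"
    and N: "(nstar \<^bold>= check_nat N) p"
    and val: "\<And>i n q. n < N \<Longrightarrow> p \<preceq> q \<Longrightarrow> r i \<preceq> q \<Longrightarrow>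
      has_value f (\<xi> i) n (g i n) q"
    and growth: "\<And>i n. n < N \<Longrightarrow> g i n k < g (Suc i) n k"
  shows "f_grows R generic_seq f (check_nat k) nstar p"
  unfolding f_grows_def
proof (intro f_allI f_impI)
  fix x y m a b u v q1 q2 q3 q4 q5 q6 q7
  assume names: "is_name R u" "is_name R v"
    and q: "p \<preceq> q1" "q1 \<preceq> q2" "q2 \<preceq> q3" "q3 \<preceq> q4" "q4 \<preceq> q5" "q5 \<preceq> q6" "q6 \<preceq> q7"
    and h: "f_suc R x y q2" "(m \<^bold>\<in> nstar) q3" "(opair x a \<^bold>\<in> generic_seq) q4" "(opair y b \<^bold>\<in> generic_seq) q5"
      "(opair (opair a m) u \<^bold>\<in> f) q6" "(opair (opair b m) v \<^bold>\<in> f) q7"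
  have le: "q5 \<preceq> q7" "q4 \<preceq> q7" "q3 \<preceq> q7" "q2 \<preceq> q7" "p \<preceq> q7"
    using q R_trans by blast+
  show "f_less_at R u v (check_nat k) q7"
    unfolding f_less_at_def
  proof (rule f_ex_dense)
    fix s assume s: "q7 \<preceq> s"
    obtain s1 n where s1: "s \<preceq> s1" "n < N" "(m \<^bold>= check_nat n) s1"
      using mem_ordinal_obtain[OF ordinal_names_check_nat mem_cong_right[OF
        mem_mono[OF h(2) R_trans[OF le(3) s]] eq_mono[OF N R_trans[OF le(5) s]]] le_Field(2)[OF s]] .
    have qs1: "q7 \<preceq> s1" using R_trans[OF s s1(1)] .
    obtain t i i' where t: "s1 \<preceq> t" "(a \<^bold>= check_ord (\<xi> i)) t" "(b \<^bold>= check_ord (\<xi> i')) t" "i < i'"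
      "r i \<preceq> t" "r i' \<preceq> t"
      using generic_seq_successive_obtain[OF mem_mono[OF h(3) R_trans[OF le(2) qs1]] mem_mono[OF h(4) R_trans[OF le(1) qs1]]
        stableD[OF stable_f_suc h(1) R_trans[OF le(4) qs1]] le_Field(2)[OF qs1]] .
    have qt: "q7 \<preceq> t" using R_trans[OF qs1 t(1)] .
    note Ft = le_Field(2)[OF qt] and pt = R_trans[OF le(5) qt] and mt = eq_mono[OF s1(3) t(1)]
    have u: "(opair (opair (check_ord (\<xi> i)) (check_nat n)) u \<^bold>\<in> f) t"
      using pair_mem_cong[OF mem_mono[OF h(5) R_trans[OF q(7) qt]] opair_cong[OF t(2) mt] eq_refl] .
    have v: "(opair (opair (check_ord (\<xi> i')) (check_nat n)) v \<^bold>\<in> f) t"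
      using pair_mem_cong[OF mem_mono[OF h(6) qt] opair_cong[OF t(3) mt] eq_refl] .
    note ft = stableD[OF stable_f_fun f pt] and nm = is_name_opair[OF is_name_check_ord is_name_check_nat]
    have "(u \<^bold>= check_fun (g i n)) t"
      using fun_unique[OF ft Ft nm names(1) is_name_check_fun u val[OF s1(2) pt t(5)]] .
    moreover have "(v \<^bold>= check_fun (g i' n)) t"
      using fun_unique[OF ft Ft nm names(2) is_name_check_fun v val[OF s1(2) pt t(6)]] .
    moreover have "g i n k < g i' n k"
      using lift_Suc_mono_less[of "\<lambda>i. g i n k", OF growth[OF s1(2)] t(4)] .
    ultimately have "f_less_at R u v (check_nat k) t" using f_less_at_checkI Ft by blast
    then show "\<exists>t. s \<preceq> t \<and> f_ex R (\<lambda>a. f_ex R (\<lambda>b. opair (check_nat k) a \<^bold>\<in> u \<^bold>\<and> opair (check_nat k) b \<^bold>\<in> v \<^bold>\<and> a \<^bold>\<in> b)) t"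
      unfolding f_less_at_def using R_trans[OF s1(1) t(1)] by blast
  qed
qed

end

section \<open>Sweet forcing notions preserve spread families\<close>

context ccc_poset
begin

text \<open>The combinatorial core.  If the conditions \<open>r x\<close> decide the values of an injective family of functions
  from \<open>F\<close>, then the chain condition makes the decided values pairwise distinct on an uncountable set,
  and the family obtained by adding the functions that witness sweetness for the sequence \<open>r\<close> controls
  both the growth of the values and the existence of a condition forcing infinitely many \<open>r x\<close>.  Through
  \<open>C\<close> the index set can be thinned out further at the same time.\<close>

lemma thin_and_grow:
  fixes E :: "w1 set" and g :: "w1 \<Rightarrow> nat \<Rightarrow> nat \<Rightarrow> nat"
  assumes sweet: "sweet F R" and E: "uncountable E"
    and r: "\<And>x. x \<in> E \<Longrightarrow> q \<preceq> r x"
    and f: "f_inj R f q"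
    and gF: "\<And>x n. x \<in> E \<Longrightarrow> n < N \<Longrightarrow> g x n \<in> F"
    and val: "\<And>x n. x \<in> E \<Longrightarrow> n < N \<Longrightarrow> has_value f x n (g x n) (r x)"
    and C: "\<And>x. x \<in> E \<Longrightarrow> countable {y\<in>E. C x y}" "\<And>x y. C x y \<Longrightarrow> C y x"
  shows "\<exists>A\<subseteq>E. uncountable A \<and> (\<forall>x\<in>A. \<forall>y\<in>A. x \<noteq> y \<longrightarrow> \<not> C x y) \<and>
    ensured_by_growth F A (\<lambda>s k. grows_at g N s k \<and> (\<exists>t\<in>Field R. forces_inf_gen R t (\<lambda>i. r (s i))))"
proof -
  have same: "x = y \<and> m = n" if h: "x \<in> E" "y \<in> E" "m < N" "n < N" "g x m = g y n" "r x \<preceq> t" "r y \<preceq> t" for x y m n t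
  proof -
    note Ft = le_Field(2)[OF h(6)]
    have "(opair (check_ord x) (check_nat m) \<^bold>= opair (check_ord y) (check_nat n)) t"
    proof (rule inj_unique[OF stableD[OF stable_f_inj f R_trans[OF r[OF h(1)] h(6)]] Ft])
      show "has_value f x m (g x m) t"
        using mem_mono[OF val[OF h(1,3)] h(6)] .
      show "has_value f y n (g x m) t"
        using mem_mono[OF val[OF h(2,4)] h(7)] h(5) by simp
    qed (intro is_name_opair is_name_check_ord is_name_check_nat is_name_check_fun)+
    from opair_eqD[OF this Ft] show ?thesis using check_ord_eqD check_nat_eqD Ft by blast
  qed
  define C' where "C' x y \<longleftrightarrow> C x y \<or> (\<exists>m<N. \<exists>n<N. g x m = g y n)" for x y
  have "\<exists>A\<subseteq>E. uncountable A \<and> (\<forall>x\<in>A. \<forall>y\<in>A. x \<noteq> y \<longrightarrow> \<not> C' x y)"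
  proof (rule uncountable_conflict_free[OF E])
    fix x assume x: "x \<in> E"
    have "countable {y\<in>E. g x m = g y n}" if n: "m < N" "n < N" for m n
    proof (rule ccontr)
      assume unc: "uncountable {y\<in>E. g x m = g y n}"
      obtain y z t where yz: "y \<in> {y\<in>E. g x m = g y n}" "z \<in> {y\<in>E. g x m = g y n}" "y \<noteq> z" "r y \<preceq> t" "r z \<preceq> t"
        using ccc_indexed[OF unc, of r] r le_Field(2) by blast
      then show False using same[of y z n n t] n(2) by simp
    qed
    then have "countable (\<Union>m<N. \<Union>n<N. {y\<in>E. g x m = g y n})" by (intro countable_UN) auto
    then have "countable ({y\<in>E. C x y} \<union> (\<Union>m<N. \<Union>n<N. {y\<in>E. g x m = g y n}))" using C(1)[OF x] by simp
    then show "countable {y\<in>E. C' x y}"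
      by (rule countable_subset[rotated]) (auto simp: C'_def)
  next
    fix x y assume "C' x y"
    then show "C' y x" using C(2) unfolding C'_def by metis
  qed
  then obtain A1 where A1: "A1 \<subseteq> E" "uncountable A1"
    and free: "\<forall>x\<in>A1. \<forall>y\<in>A1. x \<noteq> y \<longrightarrow> \<not> C' x y"
    by (elim exE conjE) (rule that)
  have g_inj: "inj_on (\<lambda>(x, n). g x n) (A1 \<times> {..<N})"
  proof (rule inj_onI, clarsimp)
    fix x m y n assume h: "x \<in> A1" "m < N" "y \<in> A1" "n < N" "g x m = g y n"
    have "x = y" using bspec[OF bspec[OF free h(1)] h(3)] h(2,4,5) unfolding C'_def by blast
    moreover have "r x \<preceq> r x" using R_refl le_Field(2) r A1(1) h(1) by blast
    ultimately show "x = y \<and> m = n" using same[of x y m n "r x"] h A1(1) by blast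
  qed
  have rF: "\<forall>x\<in>A1. r x \<in> Field R" using r A1(1) le_Field(2) by blast
  obtain A2 K and M :: nat and h where A2: "A2 \<subseteq> A1" "uncountable A2" and h: "\<forall>x\<in>A2. \<forall>n<M. h x n \<in> F"
    "inj_on (\<lambda>(x, n). h x n) (A2 \<times> {..<M})"
    and gen: "growth_ensures h M K A2 (\<lambda>s k. \<exists>t\<in>Field R. forces_inf_gen R t (\<lambda>i. r (s i)))"
    using sweet_on_uncountable[OF sweet A1(2) rF] by (elim exE conjE) (rule that)
  have "inj_on (\<lambda>(x, n). g x n) (A2 \<times> {..<N})" by (rule inj_on_subset[OF g_inj]) (use A2(1) in blast)
  moreover have "\<And>x n. x \<in> A2 \<Longrightarrow> n < N \<Longrightarrow> g x n \<in> F" using gF A1(1) A2(1) by blast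
  moreover have "\<And>x n. x \<in> A2 \<Longrightarrow> n < M \<Longrightarrow> h x n \<in> F" using h(1) by blast
  ultimately have "\<exists>A'\<subseteq>A2. uncountable A' \<and> (\<exists>(J :: nat) l. (\<forall>x\<in>A'. \<forall>n<J. l x n \<in> F) \<and>
      inj_on (\<lambda>(x, n). l x n) (A' \<times> {..<J}) \<and>
      (\<forall>n<N. \<exists>j<J. \<forall>x\<in>A'. g x n = l x j) \<and> (\<forall>n<M. \<exists>j<J. \<forall>x\<in>A'. h x n = l x j))"
    by (intro combine_families[OF A2(2) _ _ h(2)])
  then obtain A3 and J :: nat and l where A3: "A3 \<subseteq> A2" "uncountable A3"
    and l: "\<forall>x\<in>A3. \<forall>n<J. l x n \<in> F" "inj_on (\<lambda>(x, n). l x n) (A3 \<times> {..<J})"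
    and lg: "\<forall>n<N. \<exists>j<J. \<forall>x\<in>A3. g x n = l x j" and lh: "\<forall>n<M. \<exists>j<J. \<forall>x\<in>A3. h x n = l x j"
    by (elim exE conjE) (rule that)
  have works: "grows_at g N s k \<and> (\<exists>t\<in>Field R. forces_inf_gen R t (\<lambda>i. r (s i)))"
    if s: "strict_mono s" "range s \<subseteq> A3" "K < k" "grows_at l J s k" for s k
  proof -
    have sA: "s i \<in> A3" for i using s(2) by blast
    have gg: "g (s i) n k < g (s (Suc i)) n k" if n: "n < N" for i n
    proof -
      obtain j where "j < J" "\<forall>x\<in>A3. g x n = l x j" using lg n by metis
      then show ?thesis using s(4) sA by simp
    qed
    have hh: "h (s i) n k < h (s (Suc i)) n k" if n: "n < M" for i n
    proof -
      obtain j where "j < J" "\<forall>x\<in>A3. h x n = l x j" using lh n by metis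
      then show ?thesis using s(4) sA by simp
    qed
    have sA2: "range s \<subseteq> A2" using s(2) A3(1) by (rule subset_trans)
    have "\<exists>t\<in>Field R. forces_inf_gen R t (\<lambda>i. r (s i))"
      using gen[THEN spec, of s, THEN spec, of k] s(1) sA2 s(3) hh by simp
    with gg show ?thesis by simp
  qed
  have "A3 \<subseteq> E" using A1(1) A2(1) A3(1) by blast
  moreover have "\<not> C x y" if "x \<in> A3" "y \<in> A3" "x \<noteq> y" for x y
    using bspec[OF bspec[OF free, of x], of y] that A2(1) A3(1) unfolding C'_def by blast
  ultimately show ?thesis
    using A3(2) l works by (intro exI[of _ A3] conjI ballI exI[of _ K] exI[of _ J] exI[of _ l] allI impI) simp_all
qed

lemma f_timesI:
  assumes "is_name R x" "is_name R y" "(x \<^bold>\<in> A) p" "(y \<^bold>\<in> B) p"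
  shows "f_times R A B (opair x y) p"
  unfolding f_times_def
proof (rule f_exI[OF assms(1) stable_ex], rule f_exI[OF assms(2)])
  show "(x \<^bold>\<in> A \<^bold>\<and> y \<^bold>\<in> B \<^bold>\<and> opair x y \<^bold>= opair x y) p" using assms eq_refl by (intro f_andI)
qed (intro stable_intros)

lemma decide_values:
  assumes f: "f_fun R f (f_times R A nstar) (check_family F) q" and q: "q \<in> Field R"
    and x: "(check_ord x \<^bold>\<in> A) q" and N: "(nstar \<^bold>= check_nat N) q"
  shows "\<exists>r g. q \<preceq> r \<and> (\<forall>n<N. g n \<in> F \<and> has_value f x n (g n) r)"
proof -
  have "\<exists>r g. q \<preceq> r \<and> (\<forall>n<m. g n \<in> F \<and> has_value f x n (g n) r)"
    if "m \<le> N" for m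
    using that
  proof (induction m)
    case 0
    then show ?case using R_refl[OF q] by blast
  next
    case (Suc m)
    then obtain r g where r: "q \<preceq> r"
      "\<forall>n<m. g n \<in> F \<and> has_value f x n (g n) r" by auto
    note Fr = le_Field(2)[OF r(1)]
    let ?z = "opair (check_ord x) (check_nat m)"
    have nz: "is_name R ?z" by (intro is_name_opair is_name_check_ord is_name_check_nat)
    have "m < N" using Suc.prems by simp
    then have "(check_nat m \<^bold>\<in> nstar) r"
      using mem_cong_right[OF check_nat_memI[OF _ Fr] eq_sym[OF eq_mono[OF N r(1)]]] by blast
    then have z: "f_times R A nstar ?z r"
      using f_timesI[OF is_name_check_ord is_name_check_nat mem_mono[OF x r(1)]] by blast
    obtain s y where s: "r \<preceq> s" "is_name R y" "(opair ?z y \<^bold>\<in> f) s"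
      using fun_total[OF stableD[OF stable_f_fun f r(1)] Fr nz z] .
    note Fs = le_Field(2)[OF s(1)]
    have "(y \<^bold>\<in> check_family F) s"
      using fun_range[OF stableD[OF stable_f_fun f R_trans[OF r(1) s(1)]] Fs nz s(2,3)] .
    then obtain t h where t: "s \<preceq> t" "h \<in> F" "(y \<^bold>= check_fun h) t" using mem_family_obtain[OF _ Fs] by blast
    have "(opair ?z (check_fun h) \<^bold>\<in> f) t" using pair_mem_cong[OF mem_mono[OF s(3) t(1)] eq_refl t(3)] .
    moreover have "r \<preceq> t" using R_trans[OF s(1) t(1)] .
    ultimately have "\<forall>n<Suc m. (g(m := h)) n \<in> F \<and>
        (opair (opair (check_ord x) (check_nat n)) (check_fun ((g(m := h)) n)) \<^bold>\<in> f) t"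
      using r(2) t(2) mem_mono by (auto simp: less_Suc_eq)
    then show ?case using R_trans[OF r(1) \<open>r \<preceq> t\<close>] by blast
  qed
  then show ?thesis by blast
qed

lemma stable_f_increasing: "stable (f_increasing R s)"
  unfolding f_increasing_def by (intro stable_intros)

lemma stable_f_grows: "stable (f_grows R s f k n)"
  unfolding f_grows_def by (intro stable_intros)

end

context forcing_poset
begin

text \<open>The \<open>\<omega>\<^sub>1\<close> of the extension is \<^const>\<open>check_w1\<close>, so the members of a name for a family can be decided at each
  ordinal of the ground model, and the core lemma together with spread in the ground model applies.\<close>

theorem forced_spread_if_sweet:
  assumes F: "spread F" and sweet: "sweet F R"
  shows "forced R (f_spread R (check_family F))"
proof -
  interpret ccc_poset R using ccc_poset_if_sweet[OF assms] .
  have "f_spread R (check_family F) p" if p: "p \<in> Field R" for p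
    unfolding f_spread_def
  proof (intro f_andI f_allI f_impI)
    have "uncountable F" using F by (simp add: spread_def)
    then show "f_not R (f_countable R (check_family F)) p"
      by (rule not_countableI[where c = check_fun])
        (use is_name_check_fun check_fun_eqD mem_familyI[OF p] in blast)+
  next
    fix W kstar nstar f q1 q2 q3 q4 q5
    assume nW: "is_name R W"
      and le: "p \<preceq> q1" "q1 \<preceq> q2" "q2 \<preceq> q3" "q3 \<preceq> q4" "q4 \<preceq> q5"
      and h: "f_omega1 R W q1" "(kstar \<^bold>\<in> check_omega) q2" "(nstar \<^bold>\<in> check_omega) q3"
        "f_fun R f (f_times R W nstar) (check_family F) q4" "f_inj R f q5"
    show "f_ex R (\<lambda>s. f_ex R (\<lambda>k. f_fun R s (\<lambda>i. i \<^bold>\<in> check_omega) W \<^bold>\<and> f_increasing R s \<^bold>\<and>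
        k \<^bold>\<in> check_omega \<^bold>\<and> kstar \<^bold>\<in> k \<^bold>\<and> f_grows R s f k nstar)) q5"
    proof (rule f_ex_dense)
      fix q6 assume q6: "q5 \<preceq> q6"
      have le6: "q4 \<preceq> q6" "q3 \<preceq> q6" "q2 \<preceq> q6" "q1 \<preceq> q6" using le q6 R_trans by blast+
      obtain q7 K where q7: "q6 \<preceq> q7" "(kstar \<^bold>= check_nat K) q7"
        using mem_omega_obtain[OF mem_mono[OF h(2) le6(3)] le_Field(2)[OF q6]] .
      obtain q N where q: "q7 \<preceq> q" "(nstar \<^bold>= check_nat N) q"
        using mem_omega_obtain[OF mem_mono[OF h(3) R_trans[OF le6(2) q7(1)]] le_Field(2)[OF q7(1)]] .
      have q6q: "q6 \<preceq> q" using R_trans[OF q7(1) q(1)] .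
      note Fq = le_Field(2)[OF q6q]
      have K: "(kstar \<^bold>= check_nat K) q" using eq_mono[OF q7(2) q(1)] .
      have f: "f_fun R f (f_times R W nstar) (check_family F) q" "f_inj R f q"
        using stableD[OF stable_f_fun h(4) R_trans[OF le6(1) q6q]] stableD[OF stable_f_inj h(5) R_trans[OF q6 q6q]] .
      have W: "(W \<^bold>= check_w1) q" using f_omega1_unique[OF stableD[OF stable_f_omega1 h(1) R_trans[OF le6(4) q6q]] Fq nW] .
      have xW: "(check_ord x \<^bold>\<in> W) q" for x using mem_cong_right[OF mem_w1I[OF Fq] eq_sym[OF W]] .
      obtain r g where r: "\<And>x. q \<preceq> r x" and g: "\<And>x n. n < N \<Longrightarrow> g x n \<in> F"
        "\<And>x n. n < N \<Longrightarrow> has_value f x n (g x n) (r x)"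
        using decide_values[OF f(1) Fq xW q(2)] by metis
      have "\<exists>A\<subseteq>UNIV. uncountable A \<and> (\<forall>x\<in>A. \<forall>y\<in>A. x \<noteq> y \<longrightarrow> \<not> False) \<and>
        ensured_by_growth F A (\<lambda>s k. grows_at g N s k \<and> (\<exists>t\<in>Field R. forces_inf_gen R t (\<lambda>i. r (s i))))"
        using sweet uncountable_UNIV_w1 r f(2) g by (rule thin_and_grow) simp_all
      then obtain A K' l and J :: nat where A: "uncountable A" and l: "\<forall>x\<in>A. \<forall>j<J. l x j \<in> F"
        "inj_on (\<lambda>(x, j). l x j) (A \<times> {..<J})"
        and grow: "growth_ensures l J K' A (\<lambda>s k. grows_at g N s k \<and> (\<exists>t\<in>Field R. forces_inf_gen R t (\<lambda>i. r (s i))))"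
        by (elim exE conjE) (rule that)
      have "\<exists>s k. strict_mono s \<and> range s \<subseteq> A \<and> max K K' < k \<and> grows_at l J s k"
        by (rule spread_on_uncountable[OF F A _ l(2)]) (use l(1) in blast)
      then obtain s k where s: "strict_mono s" "range s \<subseteq> A" "max K K' < k"
        "grows_at l J s k"
        by (elim exE conjE) (rule that)
      have growing: "grows_at g N s k \<and> (\<exists>t\<in>Field R. forces_inf_gen R t (\<lambda>i. r (s i)))"
        using grow[THEN spec, of s, THEN spec, of k] s by simp
      then obtain t0 where t0: "t0 \<in> Field R" "forces_inf_gen R t0 (\<lambda>i. r (s i))" by blast
      obtain t i where t: "t0 \<preceq> t" "r (s i) \<preceq> t" using forces_inf_gen_obtain[OF t0(2,1)] by blast
      have qt: "q \<preceq> t" using R_trans[OF r t(2)] .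
      note Ft = le_Field(2)[OF qt]
      interpret generic_subsequence R s "\<lambda>i. r (s i)" t
        by unfold_locales (use s(1) Ft forces_inf_gen_mono[OF t0(2) t(1)] in auto)
      have 1: "f_fun R generic_seq (\<lambda>i. i \<^bold>\<in> check_omega) W t"
        by (rule f_fun_generic_seq) (use mem_mono[OF xW] R_trans[OF qt] in blast)
      have 2: "(kstar \<^bold>\<in> check_nat k) t"
        using mem_cong_left[OF eq_mono[OF K qt] check_nat_memI[OF _ Ft]] s(3) by simp
      have 3: "f_grows R generic_seq f (check_nat k) nstar t"
        by (rule f_grows_generic_seq[OF stableD[OF stable_f_fun f(1) qt] eq_mono[OF q(2) qt], of "\<lambda>i. g (s i)"])
          (use mem_mono[OF g(2)] growing in blast)+
      have "f_ex R (\<lambda>s. f_ex R (\<lambda>k. f_fun R s (\<lambda>i. i \<^bold>\<in> check_omega) W \<^bold>\<and> f_increasing R s \<^bold>\<and>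
        k \<^bold>\<in> check_omega \<^bold>\<and> kstar \<^bold>\<in> k \<^bold>\<and> f_grows R s f k nstar)) t"
      proof (rule f_exI[OF is_name_generic_seq stable_ex], rule f_exI[OF is_name_check_nat])
        show "(f_fun R generic_seq (\<lambda>i. i \<^bold>\<in> check_omega) W \<^bold>\<and> f_increasing R generic_seq \<^bold>\<and>
          check_nat k \<^bold>\<in> check_omega \<^bold>\<and> kstar \<^bold>\<in> check_nat k \<^bold>\<and> f_grows R generic_seq f (check_nat k) nstar) t"
          using 1 2 3 f_increasing_generic_seq mem_omegaI[OF Ft] by (intro f_andI)
      qed (intro stable_and stable_f_fun stable_f_increasing stable_f_grows stable_regular[OF regular_mem])
      then show "\<exists>t. q6 \<preceq> t \<and> f_ex R (\<lambda>s. f_ex R (\<lambda>k. f_fun R s (\<lambda>i. i \<^bold>\<in> check_omega) W \<^bold>\<and> f_increasing R s \<^bold>\<and>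
        k \<^bold>\<in> check_omega \<^bold>\<and> kstar \<^bold>\<in> k \<^bold>\<and> f_grows R s f k nstar)) t"
        using R_trans[OF q6q qt] by blast
    qed
  qed
  then show ?thesis unfolding forced_def by blast
qed

end

section \<open>Finite support iterations\<close>

context forcing_poset
begin

lemma imp_stepD:
  assumes "f_imp R \<phi> \<psi> p" "p \<in> Field R" "\<phi> p"
  obtains r where "p \<preceq> r" "\<psi> r"
  using impD[OF assms(1) R_refl[OF assms(2)] assms(3)] by blast

lemma forcing_notion_refl:
  assumes "f_forcing_notion R Q L p" "p \<in> Field R" "is_name R x" "(x \<^bold>\<in> Q) p"
  shows "(opair x x \<^bold>\<in> L) p"
proof -
  have "f_imp R (x \<^bold>\<in> Q) (opair x x \<^bold>\<in> L) p"
    using assms(1,3) unfolding f_forcing_notion_def f_and_iff f_all_iff by blast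
  from imp_regularD[OF this stable_regular[OF regular_mem] regular_mem assms(4,2)] show ?thesis .
qed

lemma stable_f_forcing_notion: "stable (f_forcing_notion R Q L)"
  unfolding f_forcing_notion_def by (intro stable_intros)

lemma forcing_notion_trans:
  assumes fn: "f_forcing_notion R Q L p" and p: "p \<in> Field R"
    and names: "is_name R x" "is_name R y" "is_name R z"
    and mem: "(x \<^bold>\<in> Q) p" "(y \<^bold>\<in> Q) p" "(z \<^bold>\<in> Q) p"
    and le: "(opair x y \<^bold>\<in> L) p" "(opair y z \<^bold>\<in> L) p"
  shows "(opair x z \<^bold>\<in> L) p"
proof (rule mem_dense[OF p])
  fix q assume q: "p \<preceq> q"
  note F = le_Field(2)
  have "f_imp R (x \<^bold>\<in> Q) (f_imp R (y \<^bold>\<in> Q) (f_imp R (z \<^bold>\<in> Q)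
      (f_imp R (opair x y \<^bold>\<in> L) (f_imp R (opair y z \<^bold>\<in> L) (opair x z \<^bold>\<in> L))))) q"
    using stableD[OF stable_f_forcing_notion fn q] names unfolding f_forcing_notion_def f_and_iff f_all_iff by blast
  then obtain q1 where q1: "q \<preceq> q1" "f_imp R (y \<^bold>\<in> Q) (f_imp R (z \<^bold>\<in> Q)
      (f_imp R (opair x y \<^bold>\<in> L) (f_imp R (opair y z \<^bold>\<in> L) (opair x z \<^bold>\<in> L)))) q1"
    using imp_stepD F[OF q] mem_mono[OF mem(1) q] by blast
  have le1: "p \<preceq> q1" using R_trans[OF q q1(1)] .
  obtain q2 where q2: "q1 \<preceq> q2" "f_imp R (z \<^bold>\<in> Q)
      (f_imp R (opair x y \<^bold>\<in> L) (f_imp R (opair y z \<^bold>\<in> L) (opair x z \<^bold>\<in> L))) q2"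
    using imp_stepD[OF q1(2) F[OF le1] mem_mono[OF mem(2) le1]] by blast
  have le2: "p \<preceq> q2" using R_trans[OF le1 q2(1)] .
  obtain q3 where q3: "q2 \<preceq> q3" "f_imp R (opair x y \<^bold>\<in> L) (f_imp R (opair y z \<^bold>\<in> L) (opair x z \<^bold>\<in> L)) q3"
    using imp_stepD[OF q2(2) F[OF le2] mem_mono[OF mem(3) le2]] by blast
  have le3: "p \<preceq> q3" using R_trans[OF le2 q3(1)] .
  obtain q4 where q4: "q3 \<preceq> q4" "f_imp R (opair y z \<^bold>\<in> L) (opair x z \<^bold>\<in> L) q4"
    using imp_stepD[OF q3(2) F[OF le3] mem_mono[OF le(1) le3]] by blast
  have le4: "p \<preceq> q4" using R_trans[OF le3 q4(1)] .
  obtain q5 where q5: "q4 \<preceq> q5" "(opair x z \<^bold>\<in> L) q5"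
    using imp_stepD[OF q4(2) F[OF le4] mem_mono[OF le(2) le4]] by blast
  show "\<exists>r. q \<preceq> r \<and> (opair x z \<^bold>\<in> L) r"
    using q5(2) R_trans[OF q1(1) R_trans[OF q2(1) R_trans[OF q3(1) R_trans[OF q4(1) q5(1)]]]] by blast
qed

lemma forces_gen_le: "x \<preceq> p \<Longrightarrow> forces_gen R p x"
  unfolding forces_gen_def using R_trans R_refl le_Field(2) by blast

lemma forcing_notion_R: "forcing_notion R"
  unfolding forcing_notion_def preorder_on_def
proof (intro conjI)
  show "R \<subseteq> Field R \<times> Field R" using le_Field by auto
  show "refl_on (Field R) R" using R_refl by (simp add: refl_on_def)
  show "trans R" using R_trans by (auto intro: transI)
  show "R \<noteq> {}" using R_refl[OF empty_in_Field] by blast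
qed

end

lemma restrict_lessThan_twice:
  assumes "(\<epsilon> :: 'a::wellorder) \<le> \<beta>"
  shows "(p |` {..<\<beta>}) |` {..<\<epsilon>} = p |` {..<\<epsilon>}"
proof -
  have "{..<\<beta>} \<inter> {..<\<epsilon>} = {..<\<epsilon>}" using assms by auto
  then show ?thesis by simp
qed

lemma iter_condsI:
  assumes "finite (dom p)" "dom p \<subseteq> {..<\<alpha>}"
    and "\<And>\<beta>. \<beta> \<in> dom p \<Longrightarrow> p |` {..<\<beta>} \<in> Field (P \<beta>)"
    and "\<And>\<beta>. \<beta> \<in> dom p \<Longrightarrow> the (p \<beta>) \<in> fst ` elts (Q \<beta>)"
    and "\<And>\<beta>. \<beta> \<in> dom p \<Longrightarrow> f_mem (P \<beta>) (the (p \<beta>)) (Q \<beta>) (p |` {..<\<beta>})"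
  shows "p \<in> iter_conds P Q \<alpha>"
  unfolding iter_conds_def using assms by blast

lemma iter_condsD:
  assumes "p \<in> iter_conds P Q \<alpha>" "\<beta> \<in> dom p"
  shows "\<beta> < \<alpha>" "p |` {..<\<beta>} \<in> Field (P \<beta>)" "the (p \<beta>) \<in> fst ` elts (Q \<beta>)"
    "f_mem (P \<beta>) (the (p \<beta>)) (Q \<beta>) (p |` {..<\<beta>})"
  using assms unfolding iter_conds_def by auto

lemma iter_conds_dom: "p \<in> iter_conds P Q \<alpha> \<Longrightarrow> finite (dom p) \<and> dom p \<subseteq> {..<\<alpha>}"
  unfolding iter_conds_def by simp

lemma iter_conds_restrict:
  fixes \<beta> :: "'a::wellorder"
  assumes p: "p \<in> iter_conds P Q \<alpha>"
  shows "p |` {..<\<beta>} \<in> iter_conds P Q \<beta>"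
proof (rule iter_condsI)
  show "finite (dom (p |` {..<\<beta>}))" "dom (p |` {..<\<beta>}) \<subseteq> {..<\<beta>}"
    using iter_conds_dom[OF p] by auto
  fix \<epsilon> assume "\<epsilon> \<in> dom (p |` {..<\<beta>})"
  then have \<epsilon>: "\<epsilon> \<in> dom p" "\<epsilon> < \<beta>" by (auto simp only: dom_restrict Int_iff lessThan_iff)
  have r: "(p |` {..<\<beta>}) |` {..<\<epsilon>} = p |` {..<\<epsilon>}" "(p |` {..<\<beta>}) \<epsilon> = p \<epsilon>"
    using restrict_lessThan_twice[of \<epsilon> \<beta> p] \<epsilon>(2) by simp_all
  show "(p |` {..<\<beta>}) |` {..<\<epsilon>} \<in> Field (P \<epsilon>)" "the ((p |` {..<\<beta>}) \<epsilon>) \<in> fst ` elts (Q \<epsilon>)"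
    "f_mem (P \<epsilon>) (the ((p |` {..<\<beta>}) \<epsilon>)) (Q \<epsilon>) ((p |` {..<\<beta>}) |` {..<\<epsilon>})"
    unfolding r using iter_condsD[OF p \<epsilon>(1)] by blast+
qed

lemma iter_conds_restrict_self:
  assumes "p \<in> iter_conds P Q \<alpha>"
  shows "p |` {..<\<alpha>} = p"
proof
  fix \<epsilon>
  show "(p |` {..<\<alpha>}) \<epsilon> = p \<epsilon>"
  proof (cases "\<epsilon> < \<alpha>")
    case False
    then have "\<epsilon> \<notin> dom p" using iter_conds_dom[OF assms] by auto
    with False show ?thesis by (simp add: domIff)
  qed simp
qed

locale fs_iter =
  fixes \<gamma> :: "'a::wellorder" and P :: "'a \<Rightarrow> ('a, 'i) cond rel" and Q L :: "'a \<Rightarrow> ('a, 'i) nm"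
  assumes iteration: "fs_iteration \<gamma> P Q L"
begin

lemma is_name_Q: "\<alpha> < \<gamma> \<Longrightarrow> is_name (P \<alpha>) (Q \<alpha>)"
  using iteration unfolding fs_iteration_def by blast

lemma forced_forcing_notion: "\<alpha> < \<gamma> \<Longrightarrow> p \<in> Field (P \<alpha>) \<Longrightarrow> f_forcing_notion (P \<alpha>) (Q \<alpha>) (L \<alpha>) p"
  using iteration unfolding fs_iteration_def forced_def by blast

lemma P_iff:
  assumes "\<alpha> \<le> \<gamma>"
  shows "(p, q) \<in> P \<alpha> \<longleftrightarrow> p \<in> iter_conds P Q \<alpha> \<and> q \<in> iter_conds P Q \<alpha> \<and> dom p \<subseteq> dom q \<and>
    (\<forall>\<beta>\<in>dom p. f_mem (P \<beta>) (opair (the (p \<beta>)) (the (q \<beta>))) (L \<beta>) (q |` {..<\<beta>}))"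
proof -
  note eq = iteration[unfolded fs_iteration_def, THEN conjunct1, THEN spec, of \<alpha>, THEN mp, OF assms]
  show ?thesis by (subst eq) (simp only: mem_Collect_eq case_prod_conv)
qed

lemma P_restrict:
  assumes "(p, q) \<in> P \<alpha>" "\<beta> \<le> \<alpha>" "\<alpha> \<le> \<gamma>"
  shows "(p |` {..<\<beta>}, q |` {..<\<beta>}) \<in> P \<beta>"
  unfolding P_iff[OF order_trans[OF assms(2,3)]]
proof (intro conjI ballI)
  have h: "p \<in> iter_conds P Q \<alpha>" "q \<in> iter_conds P Q \<alpha>" "dom p \<subseteq> dom q"
    and le: "\<And>\<beta>. \<beta> \<in> dom p \<Longrightarrow> f_mem (P \<beta>) (opair (the (p \<beta>)) (the (q \<beta>))) (L \<beta>) (q |` {..<\<beta>})"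
    using assms(1) unfolding P_iff[OF assms(3)] by blast+
  show "p |` {..<\<beta>} \<in> iter_conds P Q \<beta>" "q |` {..<\<beta>} \<in> iter_conds P Q \<beta>"
    using iter_conds_restrict h by blast+
  show "dom (p |` {..<\<beta>}) \<subseteq> dom (q |` {..<\<beta>})" using h(3) by (auto simp only: dom_restrict)
  fix \<epsilon> assume "\<epsilon> \<in> dom (p |` {..<\<beta>})"
  then have \<epsilon>: "\<epsilon> \<in> dom p" "\<epsilon> < \<beta>" by (auto simp only: dom_restrict Int_iff lessThan_iff)
  have r: "(q |` {..<\<beta>}) |` {..<\<epsilon>} = q |` {..<\<epsilon>}" "(q |` {..<\<beta>}) \<epsilon> = q \<epsilon>" "(p |` {..<\<beta>}) \<epsilon> = p \<epsilon>"
    using restrict_lessThan_twice[of \<epsilon> \<beta> q] \<epsilon>(2) by simp_all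
  show "f_mem (P \<epsilon>) (opair (the ((p |` {..<\<beta>}) \<epsilon>)) (the ((q |` {..<\<beta>}) \<epsilon>))) (L \<epsilon>) ((q |` {..<\<beta>}) |` {..<\<epsilon>})"
    unfolding r using le[OF \<epsilon>(1)] .
qed

lemma coordinate_name:
  assumes "p \<in> iter_conds P Q \<alpha>" "\<alpha> \<le> \<gamma>" "\<beta> \<in> dom p"
    and fp: "forcing_poset (P \<beta>)"
  shows "is_name (P \<beta>) (the (p \<beta>))"
proof -
  obtain c where "(the (p \<beta>), c) \<in> elts (Q \<beta>)" using iter_condsD(3)[OF assms(1,3)] by force
  moreover have "\<beta> < \<gamma>" using iter_condsD(1)[OF assms(1,3)] assms(2) by simp
  ultimately show ?thesis using forcing_poset.is_name_eltsD[OF fp is_name_Q] by blast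
qed

text \<open>Reflexivity and transitivity at a coordinate \<open>\<beta>\<close> come from what \<open>P \<beta>\<close> forces about the order of \<open>Q \<beta>\<close>,
  which can be exploited once \<open>P \<beta>\<close> is known to be a forcing notion; whence the induction.\<close>

lemma P_forcing_poset: "\<alpha> \<le> \<gamma> \<Longrightarrow> forcing_poset (P \<alpha>) \<and> Field (P \<alpha>) = iter_conds P Q \<alpha>"
proof (induction \<alpha> rule: less_induct)
  case (less \<alpha>)
  note le\<gamma> = less.prems
  have fp: "forcing_poset (P \<beta>)" if "\<beta> < \<alpha>" for \<beta>
    using less.IH[OF that] that le\<gamma> by simp
  have refl: "(p, p) \<in> P \<alpha>" if p: "p \<in> iter_conds P Q \<alpha>" for p
    unfolding P_iff[OF le\<gamma>]
  proof (intro conjI ballI p subset_refl)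
    fix \<beta> assume \<beta>: "\<beta> \<in> dom p"
    note D = iter_condsD[OF p \<beta>]
    interpret B: forcing_poset "P \<beta>" using fp[OF D(1)] .
    have "\<beta> < \<gamma>" using D(1) le\<gamma> by simp
    from B.forcing_notion_refl[OF forced_forcing_notion[OF this D(2)] D(2) coordinate_name[OF p le\<gamma> \<beta> fp[OF D(1)]] D(4)]
    show "f_mem (P \<beta>) (opair (the (p \<beta>)) (the (p \<beta>))) (L \<beta>) (p |` {..<\<beta>})" .
  qed
  have Field: "Field (P \<alpha>) = iter_conds P Q \<alpha>"
  proof
    show "Field (P \<alpha>) \<subseteq> iter_conds P Q \<alpha>" unfolding Field_def using P_iff[OF le\<gamma>] by blast
    show "iter_conds P Q \<alpha> \<subseteq> Field (P \<alpha>)" using refl unfolding Field_def by blast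
  qed
  have empty: "Map.empty \<in> iter_conds P Q \<alpha>" by (rule iter_condsI) simp_all
  have trans: "(p, r) \<in> P \<alpha>" if pq: "(p, q) \<in> P \<alpha>" and qr: "(q, r) \<in> P \<alpha>" for p q r
    unfolding P_iff[OF le\<gamma>]
  proof (intro conjI ballI)
    have pc: "p \<in> iter_conds P Q \<alpha>" and qc: "q \<in> iter_conds P Q \<alpha>" and rc: "r \<in> iter_conds P Q \<alpha>"
      and dom: "dom p \<subseteq> dom q" "dom q \<subseteq> dom r"
      using pq qr unfolding P_iff[OF le\<gamma>] by blast+
    show "p \<in> iter_conds P Q \<alpha>" "r \<in> iter_conds P Q \<alpha>" "dom p \<subseteq> dom r" using pc rc dom by blast+
    fix \<beta> assume \<beta>: "\<beta> \<in> dom p"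
    then have \<beta>q: "\<beta> \<in> dom q" and \<beta>r: "\<beta> \<in> dom r" using dom by blast+
    have lt: "\<beta> < \<alpha>" "\<beta> < \<gamma>" using iter_condsD(1)[OF pc \<beta>] le\<gamma> by simp_all
    interpret B: forcing_poset "P \<beta>" using fp[OF lt(1)] .
    have pq': "(p |` {..<\<beta>}, q |` {..<\<beta>}) \<in> P \<beta>" and qr': "(q |` {..<\<beta>}, r |` {..<\<beta>}) \<in> P \<beta>"
      using P_restrict[OF _ _ le\<gamma>] pq qr lt(1) by (auto simp: less_imp_le)
    have pr': "(p |` {..<\<beta>}, r |` {..<\<beta>}) \<in> P \<beta>" using B.R_trans[OF pq' qr'] .
    note Fr = B.le_Field(2)[OF pr']
    have "f_mem (P \<beta>) (opair (the (p \<beta>)) (the (q \<beta>))) (L \<beta>) (q |` {..<\<beta>})"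
      using pq \<beta> unfolding P_iff[OF le\<gamma>] by blast
    note le1 = B.mem_mono[OF this qr']
    have le2: "f_mem (P \<beta>) (opair (the (q \<beta>)) (the (r \<beta>))) (L \<beta>) (r |` {..<\<beta>})"
      using qr \<beta>q unfolding P_iff[OF le\<gamma>] by blast
    note nm = coordinate_name[OF _ le\<gamma> _ fp[OF lt(1)]]
    show "f_mem (P \<beta>) (opair (the (p \<beta>)) (the (r \<beta>))) (L \<beta>) (r |` {..<\<beta>})"
      using B.forcing_notion_trans[OF forced_forcing_notion[OF lt(2) Fr] Fr nm[OF pc \<beta>] nm[OF qc \<beta>q] nm[OF rc \<beta>r]
        B.mem_mono[OF iter_condsD(4)[OF pc \<beta>] pr'] B.mem_mono[OF iter_condsD(4)[OF qc \<beta>q] qr']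
        iter_condsD(4)[OF rc \<beta>r] le1 le2] .
  qed
  have "forcing_poset (P \<alpha>)"
  proof
    show "p \<in> Field (P \<alpha>) \<Longrightarrow> (p, p) \<in> P \<alpha>" for p using refl Field by blast
    show "(p, q) \<in> P \<alpha> \<Longrightarrow> (q, r) \<in> P \<alpha> \<Longrightarrow> (p, r) \<in> P \<alpha>" for p q r by (rule trans)
    show "Map.empty \<in> Field (P \<alpha>)" using empty Field by blast
    show "(Map.empty, p) \<in> P \<alpha>" if "p \<in> Field (P \<alpha>)" for p
      using that empty unfolding P_iff[OF le\<gamma>] Field by simp
  qed
  with Field show ?case by blast
qed

lemmas P_poset = P_forcing_poset[THEN conjunct1]
lemmas Field_P = P_forcing_poset[THEN conjunct2]

text \<open>At a coordinate in only one of the domains the union inherits the value, which is above itself.  At a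
  common coordinate it takes the value of \<open>y\<close>, which has to be above that of \<open>x\<close>.\<close>

lemma union_conditions:
  assumes "\<alpha> \<le> \<gamma>" "x \<in> Field (P \<alpha>)" "y \<in> Field (P \<alpha>)"
    and "\<And>\<epsilon>. \<epsilon> \<in> dom x \<inter> dom y \<Longrightarrow>
      f_mem (P \<epsilon>) (opair (the (x \<epsilon>)) (the (y \<epsilon>))) (L \<epsilon>) ((x ++ y) |` {..<\<epsilon>})"
  shows "(x, x ++ y) \<in> P \<alpha> \<and> (y, x ++ y) \<in> P \<alpha>"
  using assms
proof (induction \<alpha> arbitrary: x y rule: less_induct)
  case (less \<alpha>)
  note le\<gamma> = less.prems(1)
  let ?z = "x ++ y"
  have xc: "x \<in> iter_conds P Q \<alpha>" and yc: "y \<in> iter_conds P Q \<alpha>"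
    using less.prems(2,3) unfolding Field_P[OF le\<gamma>] .
  have below: "(x |` {..<\<epsilon>}, ?z |` {..<\<epsilon>}) \<in> P \<epsilon> \<and> (y |` {..<\<epsilon>}, ?z |` {..<\<epsilon>}) \<in> P \<epsilon>" if \<epsilon>: "\<epsilon> < \<alpha>" for \<epsilon>
  proof -
    have le\<epsilon>: "\<epsilon> \<le> \<gamma>" using \<epsilon> le\<gamma> by simp
    have z: "x |` {..<\<epsilon>} ++ y |` {..<\<epsilon>} = ?z |` {..<\<epsilon>}"
      by (rule ext) (simp add: map_add_def restrict_map_def)
    have "(x |` {..<\<epsilon>}, x |` {..<\<epsilon>} ++ y |` {..<\<epsilon>}) \<in> P \<epsilon> \<and> (y |` {..<\<epsilon>}, x |` {..<\<epsilon>} ++ y |` {..<\<epsilon>}) \<in> P \<epsilon>"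
    proof (rule less.IH[OF \<epsilon> le\<epsilon>])
      show "x |` {..<\<epsilon>} \<in> Field (P \<epsilon>)" "y |` {..<\<epsilon>} \<in> Field (P \<epsilon>)"
        unfolding Field_P[OF le\<epsilon>] using iter_conds_restrict xc yc by blast+
      fix \<delta> assume "\<delta> \<in> dom (x |` {..<\<epsilon>}) \<inter> dom (y |` {..<\<epsilon>})"
      then have \<delta>: "\<delta> \<in> dom x \<inter> dom y" "\<delta> < \<epsilon>" by (auto simp only: dom_restrict Int_iff lessThan_iff)
      have r: "(?z |` {..<\<epsilon>}) |` {..<\<delta>} = ?z |` {..<\<delta>}" "(x |` {..<\<epsilon>}) \<delta> = x \<delta>" "(y |` {..<\<epsilon>}) \<delta> = y \<delta>"
        using restrict_lessThan_twice[of \<delta> \<epsilon> ?z] \<delta>(2) by simp_all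
      show "f_mem (P \<delta>) (opair (the ((x |` {..<\<epsilon>}) \<delta>)) (the ((y |` {..<\<epsilon>}) \<delta>))) (L \<delta>)
          ((x |` {..<\<epsilon>} ++ y |` {..<\<epsilon>}) |` {..<\<delta>})"
        unfolding z r using less.prems(4)[OF \<delta>(1)] .
    qed
    then show ?thesis unfolding z .
  qed
  have fp: "forcing_poset (P \<epsilon>)" if "\<epsilon> < \<alpha>" for \<epsilon> using P_poset[of \<epsilon>] that le\<gamma> by simp
  have memx: "f_mem (P \<epsilon>) (the (x \<epsilon>)) (Q \<epsilon>) (?z |` {..<\<epsilon>})" if "\<epsilon> \<in> dom x" for \<epsilon>
    using forcing_poset.mem_mono[OF fp iter_condsD(4)[OF xc that]] below iter_condsD(1)[OF xc that] by blast
  have memy: "f_mem (P \<epsilon>) (the (y \<epsilon>)) (Q \<epsilon>) (?z |` {..<\<epsilon>})" if "\<epsilon> \<in> dom y" for \<epsilon>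
    using forcing_poset.mem_mono[OF fp iter_condsD(4)[OF yc that]] below iter_condsD(1)[OF yc that] by blast
  have zF: "?z |` {..<\<epsilon>} \<in> Field (P \<epsilon>)" if "\<epsilon> < \<alpha>" for \<epsilon> using below[OF that] unfolding Field_def by blast
  have zx: "?z \<epsilon> = x \<epsilon>" if "\<epsilon> \<notin> dom y" for \<epsilon> using that by (simp add: map_add_def domIff)
  have zy: "?z \<epsilon> = y \<epsilon>" if "\<epsilon> \<in> dom y" for \<epsilon> using that by (auto simp: map_add_def)
  have zc: "?z \<in> iter_conds P Q \<alpha>"
  proof (rule iter_condsI)
    show "finite (dom ?z)" "dom ?z \<subseteq> {..<\<alpha>}"
      using iter_conds_dom[OF xc] iter_conds_dom[OF yc] by simp_all
    fix \<epsilon> assume \<epsilon>: "\<epsilon> \<in> dom ?z"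
    then have "\<epsilon> < \<alpha>" using iter_conds_dom[OF xc] iter_conds_dom[OF yc] by auto
    then show "?z |` {..<\<epsilon>} \<in> Field (P \<epsilon>)" by (rule zF)
    have "the (?z \<epsilon>) \<in> fst ` elts (Q \<epsilon>) \<and> f_mem (P \<epsilon>) (the (?z \<epsilon>)) (Q \<epsilon>) (?z |` {..<\<epsilon>})"
    proof (cases "\<epsilon> \<in> dom y")
      case True
      show ?thesis unfolding zy[OF True] using iter_condsD(3)[OF yc True] memy[OF True] by blast
    next
      case False
      then have "\<epsilon> \<in> dom x" using \<epsilon> by simp
      then show ?thesis unfolding zx[OF False] using iter_condsD(3)[OF xc] memx by blast
    qed
    then show "the (?z \<epsilon>) \<in> fst ` elts (Q \<epsilon>)" "f_mem (P \<epsilon>) (the (?z \<epsilon>)) (Q \<epsilon>) (?z |` {..<\<epsilon>})" by blast+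
  qed
  have refl: "f_mem (P \<epsilon>) (opair v v) (L \<epsilon>) (?z |` {..<\<epsilon>})"
    if "\<epsilon> < \<alpha>" "is_name (P \<epsilon>) v" "f_mem (P \<epsilon>) v (Q \<epsilon>) (?z |` {..<\<epsilon>})" for \<epsilon> v
    using forcing_poset.forcing_notion_refl[OF fp[OF that(1)] forced_forcing_notion[OF _ zF[OF that(1)]] zF[OF that(1)] that(2,3)]
      that(1) le\<gamma> by simp
  have "(x, ?z) \<in> P \<alpha>"
    unfolding P_iff[OF le\<gamma>]
  proof (intro conjI ballI xc zc)
    show "dom x \<subseteq> dom ?z" by simp
    fix \<epsilon> assume \<epsilon>: "\<epsilon> \<in> dom x"
    show "f_mem (P \<epsilon>) (opair (the (x \<epsilon>)) (the (?z \<epsilon>))) (L \<epsilon>) (?z |` {..<\<epsilon>})"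
    proof (cases "\<epsilon> \<in> dom y")
      case True
      then show ?thesis using less.prems(4) \<epsilon> zy[OF True] by simp
    next
      case False
      show ?thesis unfolding zx[OF False]
        using refl[OF iter_condsD(1)[OF xc \<epsilon>] coordinate_name[OF xc le\<gamma> \<epsilon> fp[OF iter_condsD(1)[OF xc \<epsilon>]]] memx[OF \<epsilon>]] .
    qed
  qed
  moreover have "(y, ?z) \<in> P \<alpha>"
    unfolding P_iff[OF le\<gamma>]
  proof (intro conjI ballI yc zc)
    show "dom y \<subseteq> dom ?z" by simp
    fix \<epsilon> assume \<epsilon>: "\<epsilon> \<in> dom y"
    show "f_mem (P \<epsilon>) (opair (the (y \<epsilon>)) (the (?z \<epsilon>))) (L \<epsilon>) (?z |` {..<\<epsilon>})"
      unfolding zy[OF \<epsilon>]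
      using refl[OF iter_condsD(1)[OF yc \<epsilon>] coordinate_name[OF yc le\<gamma> \<epsilon> fp[OF iter_condsD(1)[OF yc \<epsilon>]]] memy[OF \<epsilon>]] .
  qed
  ultimately show ?case by blast
qed

lemma extend_condition:
  assumes "\<beta> < \<alpha>" "\<alpha> \<le> \<gamma>" "t \<in> Field (P \<beta>)" "v \<in> fst ` elts (Q \<beta>)" "f_mem (P \<beta>) v (Q \<beta>) t"
  shows "t(\<beta> \<mapsto> v) \<in> Field (P \<alpha>)" "(t(\<beta> \<mapsto> v)) |` {..<\<beta>} = t"
proof -
  have tc: "t \<in> iter_conds P Q \<beta>" using assms(1-3) Field_P[of \<beta>] by simp
  have r: "(t(\<beta> \<mapsto> v)) |` {..<\<epsilon>} = t |` {..<\<epsilon>}" if "\<epsilon> \<le> \<beta>" for \<epsilon>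
    using that by (intro ext) (auto simp: restrict_map_def)
  show rt: "(t(\<beta> \<mapsto> v)) |` {..<\<beta>} = t"
    unfolding r[OF order_refl] using iter_conds_restrict_self[OF tc] .
  show "t(\<beta> \<mapsto> v) \<in> Field (P \<alpha>)"
    unfolding Field_P[OF assms(2)]
  proof (rule iter_condsI)
    show "finite (dom (t(\<beta> \<mapsto> v)))" "dom (t(\<beta> \<mapsto> v)) \<subseteq> {..<\<alpha>}"
      using iter_conds_dom[OF tc] assms(1) by auto
    fix \<epsilon> assume \<epsilon>: "\<epsilon> \<in> dom (t(\<beta> \<mapsto> v))"
    have "(t(\<beta> \<mapsto> v)) |` {..<\<epsilon>} \<in> Field (P \<epsilon>) \<and> the ((t(\<beta> \<mapsto> v)) \<epsilon>) \<in> fst ` elts (Q \<epsilon>) \<and>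
      f_mem (P \<epsilon>) (the ((t(\<beta> \<mapsto> v)) \<epsilon>)) (Q \<epsilon>) ((t(\<beta> \<mapsto> v)) |` {..<\<epsilon>})"
    proof (cases "\<epsilon> = \<beta>")
      case True
      show ?thesis unfolding True rt using assms(3-5) by simp
    next
      case False
      then have \<epsilon>t: "\<epsilon> \<in> dom t" using \<epsilon> by simp
      have "\<epsilon> \<le> \<beta>" using iter_condsD(1)[OF tc \<epsilon>t] by simp
      then show ?thesis unfolding r[OF \<open>\<epsilon> \<le> \<beta>\<close>] using iter_condsD[OF tc \<epsilon>t] False by simp
    qed
    then show "(t(\<beta> \<mapsto> v)) |` {..<\<epsilon>} \<in> Field (P \<epsilon>)" "the ((t(\<beta> \<mapsto> v)) \<epsilon>) \<in> fst ` elts (Q \<epsilon>)"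
      "f_mem (P \<epsilon>) (the ((t(\<beta> \<mapsto> v)) \<epsilon>)) (Q \<epsilon>) ((t(\<beta> \<mapsto> v)) |` {..<\<epsilon>})" by blast+
  qed
qed

end

section \<open>Two-step iterations\<close>

context forcing_poset
begin

text \<open>This says that in the two-step iteration the condition \<open>(t, v)\<close> forces infinitely many of the
  \<open>(c i, w i)\<close> to be generic: an arbitrary extension \<open>(u, y)\<close> has a further extension \<open>(u', z)\<close> above one
  of them.  The name \<open>z\<close> is taken from the domain of \<open>Q\<close> since only such names occur in conditions of an
  iteration.\<close>

abbreviation pair_forces_inf_gen ::
    "('a, 'i) nm \<Rightarrow> ('a, 'i) nm \<Rightarrow> ('a, 'i) cond \<Rightarrow> ('a, 'i) nm \<Rightarrow> (nat \<Rightarrow> ('a, 'i) cond) \<Rightarrow>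
      (nat \<Rightarrow> ('a, 'i) nm) \<Rightarrow> bool" where
  "pair_forces_inf_gen Q L t v c w \<equiv> \<forall>m u y. t \<preceq> u \<longrightarrow> is_name R y \<longrightarrow> (y \<^bold>\<in> Q) u \<longrightarrow> (opair v y \<^bold>\<in> L) u \<longrightarrow>
    (\<exists>u' i z. u \<preceq> u' \<and> m < i \<and> c i \<preceq> u' \<and> z \<in> fst ` elts Q \<and> (z \<^bold>\<in> Q) u' \<and>
      (opair y z \<^bold>\<in> L) u' \<and> (opair (w i) z \<^bold>\<in> L) u')"

end

context ccc_poset
begin

text \<open>If no condition forced uncountably many of the \<open>c x\<close> into the generic filter, then the conditions
  excluding a final segment would be dense.  Countably many of them, hence a single final segment, would
  suffice, and no \<open>c x\<close> with \<open>x\<close> in that segment could be compatible with any of these.\<close>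

lemma unboundedly_many_generic:
  fixes B :: "w1 set"
  assumes B: "uncountable B" and c: "\<And>x. x \<in> B \<Longrightarrow> c x \<in> Field R"
  shows "\<exists>p\<in>Field R. \<forall>q x. p \<preceq> q \<longrightarrow> (\<exists>e\<in>B. x \<le> e \<and> (\<exists>r. q \<preceq> r \<and> c e \<preceq> r))"
proof -
  define bad where "bad q x \<longleftrightarrow> (\<forall>e\<in>B. x \<le> e \<longrightarrow> \<not> (\<exists>r. q \<preceq> r \<and> c e \<preceq> r))" for q x
  have "\<exists>p\<in>Field R. \<forall>q x. p \<preceq> q \<longrightarrow> \<not> bad q x"
  proof (rule ccontr)
    assume no: "\<not> ?thesis"
    define M where "M = countable_predense_set (\<lambda>q. \<exists>x. bad q x)"
    have M: "M \<subseteq> {q \<in> Field R. \<exists>x. bad q x}" "countable M"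
      and max: "\<And>q x. q \<in> Field R \<Longrightarrow> bad q x \<Longrightarrow> \<exists>a\<in>M. \<exists>r. a \<preceq> r \<and> q \<preceq> r"
      using countable_predense[of "\<lambda>q. \<exists>x. bad q x"] unfolding M_def by blast+
    have "\<forall>a\<in>M. \<exists>x. bad a x" using M(1) by blast
    then obtain b where b: "\<forall>a\<in>M. bad a (b a)" unfolding bchoice_iff by (elim exE)
    obtain z where z: "\<forall>y\<in>b ` M. y < z" using countable_bounded_w1[OF countable_image[OF M(2)]] by blast
    obtain e where e: "e \<in> B" "z < e" using uncountable_Int_greaterThan[OF B] by blast
    obtain q x where q: "c e \<preceq> q" "bad q x" using no c[OF e(1)] by blast
    obtain a r where a: "a \<in> M" "a \<preceq> r" "q \<preceq> r" using max[OF le_Field(2)[OF q(1)] q(2)] by blast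
    have "b a < z" using z a(1) by blast
    then have "b a \<le> e" using e(2) by simp
    moreover have "bad a (b a)" using b a(1) by blast
    ultimately show False using a(2) R_trans[OF q(1) a(3)] e(1) unfolding bad_def by blast
  qed
  then show ?thesis unfolding bad_def by simp
qed

lemma f_sweet_obtain:
  assumes sweet: "f_sweet R F Q L p" and p: "p \<in> Field R" and names: "is_name R W" "is_name R x"
    and W: "f_omega1 R W p" and x: "f_fun R x (\<lambda>\<alpha>. \<alpha> \<^bold>\<in> W) Q p"
  obtains q A kstar nstar f where "p \<preceq> q" "f_subset R A W q" "f_equipotent R A W q"
    "(kstar \<^bold>\<in> check_omega) q" "(nstar \<^bold>\<in> check_omega) q"
    "f_fun R f (f_times R A nstar) F q" "f_inj R f q"
    "f_all R (\<lambda>s. f_imp R (f_fun R s (\<lambda>i. i \<^bold>\<in> check_omega) A) (f_imp R (f_increasing R s)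
      (f_imp R (f_ex R (\<lambda>k. k \<^bold>\<in> check_omega \<^bold>\<and> kstar \<^bold>\<in> k \<^bold>\<and> f_grows R s f k nstar))
        (f_ex R (\<lambda>r. r \<^bold>\<in> Q \<^bold>\<and> f_forces_inf_gen R Q L r x s))))) q"
proof -
  note F = le_Field(2)
  define works where "works A kstar nstar f =
     f_all R (\<lambda>s. f_imp R (f_fun R s (\<lambda>i. i \<^bold>\<in> check_omega) A) (f_imp R (f_increasing R s)
      (f_imp R (f_ex R (\<lambda>k. k \<^bold>\<in> check_omega \<^bold>\<and> kstar \<^bold>\<in> k \<^bold>\<and> f_grows R s f k nstar))
        (f_ex R (\<lambda>r. r \<^bold>\<in> Q \<^bold>\<and> f_forces_inf_gen R Q L r x s)))))" for A kstar nstar f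
  define body where "body A kstar nstar f = (f_subset R A W \<^bold>\<and> f_equipotent R A W \<^bold>\<and>
     kstar \<^bold>\<in> check_omega \<^bold>\<and> nstar \<^bold>\<in> check_omega \<^bold>\<and> f_fun R f (f_times R A nstar) F \<^bold>\<and> f_inj R f \<^bold>\<and>
     works A kstar nstar f)" for A kstar nstar f
  have 0: "f_imp R (f_omega1 R W) (f_imp R (f_fun R x (\<lambda>\<alpha>. \<alpha> \<^bold>\<in> W) Q)
      (f_ex R (\<lambda>A. f_ex R (\<lambda>kstar. f_ex R (\<lambda>nstar. f_ex R (\<lambda>f. body A kstar nstar f)))))) p"
    using allD[OF allD[OF sweet[unfolded f_sweet_def f_and_iff[of "f_forcing_notion R Q L"], THEN conjunct2] names(1)] names(2)]
    unfolding body_def works_def .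
  obtain p1 where p1: "p \<preceq> p1" "f_imp R (f_fun R x (\<lambda>\<alpha>. \<alpha> \<^bold>\<in> W) Q)
      (f_ex R (\<lambda>A. f_ex R (\<lambda>kstar. f_ex R (\<lambda>nstar. f_ex R (\<lambda>f. body A kstar nstar f))))) p1"
    using imp_stepD[OF 0 p W] .
  obtain p2 where p2: "p1 \<preceq> p2"
      "f_ex R (\<lambda>A. f_ex R (\<lambda>kstar. f_ex R (\<lambda>nstar. f_ex R (\<lambda>f. body A kstar nstar f)))) p2"
    using imp_stepD[OF p1(2) F[OF p1(1)] stableD[OF stable_f_fun x p1(1)]] .
  obtain p3 A where p3: "p2 \<preceq> p3" "f_ex R (\<lambda>kstar. f_ex R (\<lambda>nstar. f_ex R (\<lambda>f. body A kstar nstar f))) p3"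
    using ex_obtain[OF p2(2) F[OF p2(1)]] .
  obtain p4 kstar where p4: "p3 \<preceq> p4" "f_ex R (\<lambda>nstar. f_ex R (\<lambda>f. body A kstar nstar f)) p4"
    using ex_obtain[OF p3(2) F[OF p3(1)]] .
  obtain p5 nstar where p5: "p4 \<preceq> p5" "f_ex R (\<lambda>f. body A kstar nstar f) p5"
    using ex_obtain[OF p4(2) F[OF p4(1)]] .
  obtain p6 f where p6: "p5 \<preceq> p6" "body A kstar nstar f p6"
    using ex_obtain[OF p5(2) F[OF p5(1)]] .
  have "p \<preceq> p6"
    using R_trans[OF p1(1) R_trans[OF p2(1) R_trans[OF p3(1) R_trans[OF p4(1) R_trans[OF p5(1) p6(1)]]]]] .
  moreover have "f_subset R A W p6 \<and> f_equipotent R A W p6 \<and> (kstar \<^bold>\<in> check_omega) p6 \<and>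
      (nstar \<^bold>\<in> check_omega) p6 \<and> f_fun R f (f_times R A nstar) F p6 \<and> f_inj R f p6 \<and> works A kstar nstar f p6"
    using p6(2) unfolding body_def f_and_iff .
  ultimately show thesis using that[of p6 A kstar nstar f] unfolding works_def by blast
qed

lemma stable_f_forces_inf_gen: "stable (f_forces_inf_gen R Q L v x s)"
  unfolding f_forces_inf_gen_def by (intro stable_intros)

lemma f_forces_inf_gen_obtain:
  assumes v: "f_forces_inf_gen R Q L v xs s u" and u: "u \<in> Field R"
    and y: "is_name R y" "(y \<^bold>\<in> Q) u" "(opair v y \<^bold>\<in> L) u"
  obtains u' \<tau> i \<alpha> x where "u \<preceq> u'" "is_name R \<tau>" "is_name R x"
    "(\<tau> \<^bold>\<in> Q) u' \<and> (opair y \<tau> \<^bold>\<in> L) u' \<and> (i \<^bold>\<in> check_omega) u' \<and> (check_nat m \<^bold>\<in> i) u' \<and>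
      (opair i \<alpha> \<^bold>\<in> s) u' \<and> (opair \<alpha> x \<^bold>\<in> xs) u' \<and> f_forces_gen R Q L \<tau> x u'"
proof -
  note F = le_Field(2)
  define body where "body \<tau> i \<alpha> x = (\<tau> \<^bold>\<in> Q \<^bold>\<and> opair y \<tau> \<^bold>\<in> L \<^bold>\<and> i \<^bold>\<in> check_omega \<^bold>\<and> check_nat m \<^bold>\<in> i \<^bold>\<and>
    opair i \<alpha> \<^bold>\<in> s \<^bold>\<and> opair \<alpha> x \<^bold>\<in> xs \<^bold>\<and> f_forces_gen R Q L \<tau> x)" for \<tau> i \<alpha> x
  let ?ex = "f_ex R (\<lambda>\<tau>. f_ex R (\<lambda>i. f_ex R (\<lambda>\<alpha>. f_ex R (\<lambda>x. body \<tau> i \<alpha> x))))"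
  have "f_imp R (check_nat m \<^bold>\<in> check_omega) (f_imp R (y \<^bold>\<in> Q) (f_imp R (opair v y \<^bold>\<in> L) ?ex)) u"
    using allD[OF allD[OF v[unfolded f_forces_inf_gen_def] is_name_check_nat] y(1)] unfolding body_def .
  from imp_stepD[OF this u mem_omegaI[OF u]]
  obtain u1 where u1: "u \<preceq> u1" "f_imp R (y \<^bold>\<in> Q) (f_imp R (opair v y \<^bold>\<in> L) ?ex) u1" .
  obtain u2 where u2: "u1 \<preceq> u2" "f_imp R (opair v y \<^bold>\<in> L) ?ex u2"
    using imp_stepD[OF u1(2) F[OF u1(1)] mem_mono[OF y(2) u1(1)]] .
  obtain u3 where u3: "u2 \<preceq> u3" "?ex u3"
    using imp_stepD[OF u2(2) F[OF u2(1)] mem_mono[OF y(3) R_trans[OF u1(1) u2(1)]]] .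
  obtain u4 \<tau> where u4: "u3 \<preceq> u4" "is_name R \<tau>" "f_ex R (\<lambda>i. f_ex R (\<lambda>\<alpha>. f_ex R (\<lambda>x. body \<tau> i \<alpha> x))) u4"
    using ex_obtain[OF u3(2) F[OF u3(1)]] .
  obtain u5 i where u5: "u4 \<preceq> u5" "f_ex R (\<lambda>\<alpha>. f_ex R (\<lambda>x. body \<tau> i \<alpha> x)) u5"
    using ex_obtain[OF u4(3) F[OF u4(1)]] .
  obtain u6 \<alpha> where u6: "u5 \<preceq> u6" "f_ex R (\<lambda>x. body \<tau> i \<alpha> x) u6"
    using ex_obtain[OF u5(2) F[OF u5(1)]] .
  obtain u7 x where u7: "u6 \<preceq> u7" "is_name R x" "body \<tau> i \<alpha> x u7"
    using ex_obtain[OF u6(2) F[OF u6(1)]] .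
  have "u \<preceq> u7"
    using R_trans[OF u1(1) R_trans[OF u2(1) R_trans[OF u3(1) R_trans[OF u4(1) R_trans[OF u5(1)
      R_trans[OF u6(1) u7(1)]]]]]] .
  from that[OF this u4(2) u7(2) u7(3)[unfolded body_def f_and_iff]] show thesis .
qed

text \<open>Otherwise conditions that decide the preimages under the bijection from \<open>A\<close> to \<open>\<omega>\<^sub>1\<close> would use
  the same preimage for uncountably many ordinals, and two of these conditions are compatible.\<close>

lemma uncountable_decided:
  assumes equip: "f_equipotent R A check_w1 q" and sub: "f_subset R A check_w1 q" and q: "q \<in> Field R"
  shows "uncountable {x. \<exists>r. q \<preceq> r \<and> (check_ord x \<^bold>\<in> A) r}" proof
  define E where "E = {x. \<exists>r. q \<preceq> r \<and> (check_ord x \<^bold>\<in> A) r}"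
  assume "countable {x. \<exists>r. q \<preceq> r \<and> (check_ord x \<^bold>\<in> A) r}"
  then have cE: "countable E" unfolding E_def .
  obtain q' h where q'0: "q \<preceq> q'" "(f_fun R h (\<lambda>x. x \<^bold>\<in> A) check_w1 \<^bold>\<and> f_inj R h \<^bold>\<and>
    f_all R (\<lambda>y. f_imp R (y \<^bold>\<in> check_w1) (f_ex R (\<lambda>x. opair x y \<^bold>\<in> h)))) q'"
    using ex_obtain[OF equip[unfolded f_equipotent_def] q] .
  then have q': "q \<preceq> q'" "f_fun R h (\<lambda>x. x \<^bold>\<in> A) check_w1 q'"
    "f_all R (\<lambda>y. f_imp R (y \<^bold>\<in> check_w1) (f_ex R (\<lambda>x. opair x y \<^bold>\<in> h))) q'"
    unfolding f_and_iff by blast+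
  note Fq' = le_Field(2)[OF q'(1)]
  have stable_sub: "stable (f_subset R A check_w1)" unfolding f_subset_def by (intro stable_intros)
  have "\<exists>r x. q' \<preceq> r \<and> x \<in> E \<and> (opair (check_ord x) (check_ord y) \<^bold>\<in> h) r" for y
  proof -
    obtain r1 where r1: "q' \<preceq> r1" "f_ex R (\<lambda>x. opair x (check_ord y) \<^bold>\<in> h) r1"
      using imp_stepD[OF allD[OF q'(3) is_name_check_ord] Fq' mem_w1I[OF Fq']] .
    obtain r2 x where r2: "r1 \<preceq> r2" "is_name R x" "(opair x (check_ord y) \<^bold>\<in> h) r2"
      using ex_obtain[OF r1(2) le_Field(2)[OF r1(1)]] .
    have le2: "q' \<preceq> r2" using R_trans[OF r1(1) r2(1)] .
    note F2 = le_Field(2)[OF le2]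
    have xA: "(x \<^bold>\<in> A) r2" using fun_dom[OF stableD[OF stable_f_fun q'(2) le2] F2 r2(2) is_name_check_ord r2(3)] .
    have "(x \<^bold>\<in> check_w1) r2" using f_subsetD[OF stableD[OF stable_sub sub R_trans[OF q'(1) le2]] F2 r2(2) xA] .
    then obtain r3 \<xi> where r3: "r2 \<preceq> r3" "(x \<^bold>= check_ord \<xi>) r3" using mem_w1_obtain[OF _ F2] by blast
    have "(opair (check_ord \<xi>) (check_ord y) \<^bold>\<in> h) r3"
      using pair_mem_cong[OF mem_mono[OF r2(3) r3(1)] r3(2) eq_refl] .
    moreover have "(check_ord \<xi> \<^bold>\<in> A) r3" using mem_cong_left[OF eq_sym[OF r3(2)] mem_mono[OF xA r3(1)]] .
    then have "\<xi> \<in> E" unfolding E_def using R_trans[OF q'(1) R_trans[OF le2 r3(1)]] by blast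
    moreover have "q' \<preceq> r3" using R_trans[OF le2 r3(1)] .
    ultimately show ?thesis by (intro exI[of _ r3] exI[of _ \<xi>] conjI)
  qed
  then have "\<forall>y. \<exists>r x. q' \<preceq> r \<and> x \<in> E \<and> (opair (check_ord x) (check_ord y) \<^bold>\<in> h) r" ..
  then obtain r x where "\<forall>y. q' \<preceq> r y \<and> x y \<in> E \<and> (opair (check_ord (x y)) (check_ord y) \<^bold>\<in> h) (r y)"
    unfolding choice_iff by (elim exE)
  then have r: "q' \<preceq> r y" "x y \<in> E" "(opair (check_ord (x y)) (check_ord y) \<^bold>\<in> h) (r y)" for y
    by blast+
  have "\<exists>z\<in>range x. uncountable {y. x y = z}"
  proof (rule ccontr)
    assume "\<not> ?thesis"
    moreover have "countable (range x)" using countable_subset[OF _ cE] r(2) by blast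
    ultimately have "countable (\<Union>z\<in>range x. {y. x y = z})" by (intro countable_UN) blast+
    moreover have "(\<Union>z\<in>range x. {y. x y = z}) = UNIV" by auto
    ultimately show False using uncountable_UNIV_w1 by simp
  qed
  then obtain z where unc: "uncountable {y. x y = z}" by blast
  obtain y y' t where y: "y \<in> {y. x y = z}" "y' \<in> {y. x y = z}" "y \<noteq> y'" "r y \<preceq> t" "r y' \<preceq> t"
    using ccc_indexed[OF unc, of r] r(1) le_Field(2) by blast
  have t: "q' \<preceq> t" using R_trans[OF r(1) y(4)] .
  have "(opair (check_ord z) (check_ord y) \<^bold>\<in> h) t" "(opair (check_ord z) (check_ord y') \<^bold>\<in> h) t"
    using mem_mono[OF r(3) y(4)] mem_mono[OF r(3) y(5)] y(1,2) by simp_all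
  then have "(check_ord y \<^bold>= check_ord y') t"
    using fun_unique[OF stableD[OF stable_f_fun q'(2) t] le_Field(2)[OF t] is_name_check_ord is_name_check_ord is_name_check_ord]
    by blast
  then show False using check_ord_eqD[OF _ le_Field(2)[OF t]] y(3) by blast
qed

end

context ccc_poset
begin

text \<open>Suppose that \<open>c x\<close> forces \<open>w x\<close> to be in the sweet forcing notion \<open>(Q, L)\<close>.  In the extension
  consider the sequence that assigns to \<open>\<xi>\<close> the value \<open>w e\<close> for the least \<open>e \<ge> \<xi>\<close> with \<open>c e\<close> generic;
  sweetness gives an uncountable set \<open>A\<close> and functions in \<open>F\<close>.  Conditions \<open>r \<xi>\<close> forcing \<open>\<xi> \<in> A\<close> and deciding
  \<open>e\<close> and the functions are then treated by sweetness of the ground model poset, as in the core lemma.  The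
  uncountable set of the conclusion consists of the decided \<open>e\<close>.\<close>

lemma two_step:
  fixes B :: "w1 set"
  assumes sweet: "sweet F R"
    and Q_sweet: "\<And>p. p \<in> Field R \<Longrightarrow> f_sweet R (check_family F) Q L p"
    and nQ: "is_name R Q"
    and B: "uncountable B" and c: "\<And>x. x \<in> B \<Longrightarrow> c x \<in> Field R"
    and w: "\<And>x. x \<in> B \<Longrightarrow> is_name R (w x)" "\<And>x. x \<in> B \<Longrightarrow> (w x \<^bold>\<in> Q) (c x)"
  shows "\<exists>A\<subseteq>B. uncountable A \<and> ensured_by_growth F A (\<lambda>s k. \<exists>t v. t \<in> Field R \<and> v \<in> fst ` elts Q \<and> (v \<^bold>\<in> Q) t \<and>
      pair_forces_inf_gen Q L t v (\<lambda>i. c (s i)) (\<lambda>i. w (s i)))"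
proof -
  note F = le_Field(2)
  have Q_fn: "f_forcing_notion R Q L p" if "p \<in> Field R" for p
    using Q_sweet[OF that] unfolding f_sweet_def f_and_iff[of "f_forcing_notion R Q L"] by (rule conjunct1)
  have "\<exists>p\<in>Field R. \<forall>q x. p \<preceq> q \<longrightarrow> (\<exists>e\<in>B. x \<le> e \<and> (\<exists>r. q \<preceq> r \<and> c e \<preceq> r))"
    using B c by (rule unboundedly_many_generic)
  then obtain p where p: "p \<in> Field R"
    and many: "\<forall>q x. p \<preceq> q \<longrightarrow> (\<exists>e\<in>B. x \<le> e \<and> (\<exists>r. q \<preceq> r \<and> c e \<preceq> r))"
    by (elim bexE)

  \<comment> \<open>A condition satisfies \<open>\<phi> (\<xi>, e)\<close> if it forces \<open>e\<close> to be the least element of \<open>B\<close> from \<open>\<xi>\<close> on with \<open>c e\<close> generic.\<close>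
  define \<phi> where "\<phi> x r \<longleftrightarrow> c (snd x) \<preceq> r \<and> fst x \<le> snd x \<and>
      (\<forall>e\<in>B. fst x \<le> e \<longrightarrow> e < snd x \<longrightarrow> \<not> (\<exists>t. r \<preceq> t \<and> c e \<preceq> t))" for x :: "w1 \<times> w1" and r
  define ps where "ps = comp_name (UNIV \<times> B) (\<lambda>x. opair (check_ord (fst x)) (w (snd x))) \<phi>"
  have I: "|(UNIV :: w1 set) \<times> B| \<le>o |UNIV :: ('a, 'b) index set|"
    by (rule Times_ordLeq_index[OF w1_ordLeq_index w1_ordLeq_index])
  have stable: "stable (\<phi> x)" for x
    unfolding stable_def \<phi>_def using R_trans by blast
  have \<phi>_unique: "snd x = snd y"
    if "x \<in> UNIV \<times> B" "y \<in> UNIV \<times> B" "\<phi> x r" "\<phi> y r" "fst x = fst y" "r \<in> Field R" for x y r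
  proof -
    have "\<not> snd x < snd y" if "x \<in> UNIV \<times> B" "\<phi> x r" "\<phi> y r" "fst x = fst y" for x y
      using that R_refl[OF \<open>r \<in> Field R\<close>] unfolding \<phi>_def by auto
    from this[of x y] this[of y x] that show ?thesis by (metis antisym_conv3)
  qed
  have \<phi>_exists: "\<exists>r e. q \<preceq> r \<and> e \<in> B \<and> \<phi> (\<xi>, e) r" if q: "p \<preceq> q" for q \<xi>
  proof -
    let ?S = "\<lambda>e. e \<in> B \<and> \<xi> \<le> e \<and> (\<exists>r. q \<preceq> r \<and> c e \<preceq> r)"
    have ex: "\<exists>e. ?S e" using many[rule_format, OF q, of \<xi>] by blast
    define e where "e = (LEAST e. ?S e)"
    have e: "?S e" unfolding e_def using LeastI_ex[OF ex] .
    have least: "\<not> ?S e'" if "e' < e" for e' using not_less_Least[of e' ?S] that unfolding e_def by blast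
    obtain r where r: "q \<preceq> r" "c e \<preceq> r" using e by blast
    have "\<phi> (\<xi>, e) r" unfolding \<phi>_def using r e least R_trans[OF r(1)] by auto
    with r(1) e show ?thesis by blast
  qed
  have ps_fun: "f_fun R ps (\<lambda>x. x \<^bold>\<in> check_w1) Q p"
    unfolding ps_def
  proof (rule f_fun_comp[OF I stable is_name_check_ord])
    show "is_name R (w (snd x))" if "x \<in> UNIV \<times> B" for x using w(1) that by auto
    fix x q assume "x \<in> UNIV \<times> B" "p \<preceq> q" "\<phi> x q"
    then show "(check_ord (fst x) \<^bold>\<in> check_w1) q \<and> (w (snd x) \<^bold>\<in> Q) q"
      using mem_w1I[OF F] mem_mono[OF w(2)] unfolding \<phi>_def by auto
  next
    fix z q assume z: "p \<preceq> q" "(z \<^bold>\<in> check_w1) q"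
    obtain r \<xi> where r: "q \<preceq> r" "(z \<^bold>= check_ord \<xi>) r" using mem_w1_obtain[OF z(2) F[OF z(1)]] .
    obtain s e where s: "r \<preceq> s" "e \<in> B" "\<phi> (\<xi>, e) s" using \<phi>_exists[OF R_trans[OF z(1) r(1)]] by blast
    show "\<exists>s x. q \<preceq> s \<and> x \<in> UNIV \<times> B \<and> \<phi> x s \<and> (z \<^bold>= check_ord (fst x)) s"
      using R_trans[OF r(1) s(1)] s(2,3) eq_mono[OF r(2) s(1)] by (intro exI[of _ s] exI[of _ "(\<xi>, e)"]) simp
  next
    fix x y q assume h: "x \<in> UNIV \<times> B" "y \<in> UNIV \<times> B" "p \<preceq> q" "\<phi> x q" "\<phi> y q"
      "(check_ord (fst x) \<^bold>= check_ord (fst y)) q"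
    have "snd x = snd y" using \<phi>_unique[OF h(1,2,4,5) check_ord_eqD[OF h(6)]] F[OF h(3)] by blast
    then show "(w (snd x) \<^bold>= w (snd y)) q" by (simp add: eq_refl)
  qed
  have ps_name: "is_name R ps"
    unfolding ps_def by (rule is_name_comp[OF I]) (use w(1) is_name_opair is_name_check_ord in auto)

  obtain q0 A kstar nstar f where q0: "p \<preceq> q0" and A_sub: "f_subset R A check_w1 q0"
    and A_equip: "f_equipotent R A check_w1 q0"
    and kN: "(kstar \<^bold>\<in> check_omega) q0" "(nstar \<^bold>\<in> check_omega) q0"
    and f0: "f_fun R f (f_times R A nstar) (check_family F) q0" "f_inj R f q0"
    and works: "f_all R (\<lambda>s. f_imp R (f_fun R s (\<lambda>i. i \<^bold>\<in> check_omega) A) (f_imp R (f_increasing R s)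
      (f_imp R (f_ex R (\<lambda>k. k \<^bold>\<in> check_omega \<^bold>\<and> kstar \<^bold>\<in> k \<^bold>\<and> f_grows R s f k nstar))
        (f_ex R (\<lambda>r. r \<^bold>\<in> Q \<^bold>\<and> f_forces_inf_gen R Q L r ps s))))) q0"
    by (rule f_sweet_obtain[OF Q_sweet[OF p] p is_name_check_w1 ps_name f_omega1_check_w1[OF p] ps_fun])
  obtain q0' K where q0': "q0 \<preceq> q0'" "(kstar \<^bold>= check_nat K) q0'"
    using mem_omega_obtain[OF kN(1) F[OF q0]] .
  obtain q N where q1: "q0' \<preceq> q" "(nstar \<^bold>= check_nat N) q"
    using mem_omega_obtain[OF mem_mono[OF kN(2) q0'(1)] F[OF q0'(1)]] .
  have q0q: "q0 \<preceq> q" using R_trans[OF q0'(1) q1(1)] .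
  have pq: "p \<preceq> q" using R_trans[OF q0 q0q] .
  note Fq = F[OF q0q]
  have kq: "(kstar \<^bold>= check_nat K) q" using eq_mono[OF q0'(2) q1(1)] .
  have f: "f_fun R f (f_times R A nstar) (check_family F) q" "f_inj R f q"
    using stableD[OF stable_f_fun f0(1) q0q] stableD[OF stable_f_inj f0(2) q0q] .
  have stable_sub: "stable (f_subset R A check_w1)" "stable (f_equipotent R A check_w1)"
    unfolding f_subset_def f_equipotent_def by (intro stable_intros)+

  \<comment> \<open>The set \<open>A\<close> lives in the extension; \<open>E\<close> collects its possible elements in the ground model.\<close>
  define E where "E = {x. \<exists>r. q \<preceq> r \<and> (check_ord x \<^bold>\<in> A) r}"
  have E: "uncountable E"
    unfolding E_def using uncountable_decided[OF stableD[OF stable_sub(2) A_equip q0q] stableD[OF stable_sub(1) A_sub q0q] Fq] .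
  have "\<exists>r e g. q \<preceq> r \<and> (check_ord x \<^bold>\<in> A) r \<and> e \<in> B \<and> \<phi> (x, e) r \<and>
      (\<forall>n<N. g n \<in> F \<and> has_value f x n (g n) r)"
    if "x \<in> E" for x
  proof -
    obtain r0 where r0: "q \<preceq> r0" "(check_ord x \<^bold>\<in> A) r0" using \<open>x \<in> E\<close> unfolding E_def by blast
    obtain r1 e where r1: "r0 \<preceq> r1" "e \<in> B" "\<phi> (x, e) r1" using \<phi>_exists[OF R_trans[OF pq r0(1)]] by blast
    have qr1: "q \<preceq> r1" using R_trans[OF r0(1) r1(1)] .
    obtain r g where r: "r1 \<preceq> r"
      "\<forall>n<N. g n \<in> F \<and> has_value f x n (g n) r"
      using decide_values[OF stableD[OF stable_f_fun f(1) qr1] F[OF qr1] mem_mono[OF r0(2) r1(1)] eq_mono[OF q1(2) qr1]] by blast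
    have "q \<preceq> r" using R_trans[OF qr1 r(1)] .
    moreover have "(check_ord x \<^bold>\<in> A) r" using mem_mono[OF r0(2) R_trans[OF r1(1) r(1)]] .
    moreover have "\<phi> (x, e) r" using stableD[OF stable r1(3) r(1)] .
    ultimately show ?thesis using r1(2) r(2) by blast
  qed
  then have "\<forall>x\<in>E. \<exists>r e g. q \<preceq> r \<and> (check_ord x \<^bold>\<in> A) r \<and> e \<in> B \<and> \<phi> (x, e) r \<and>
      (\<forall>n<N. g n \<in> F \<and> has_value f x n (g n) r)" by blast
  then obtain r where "\<forall>x\<in>E. \<exists>e g. q \<preceq> r x \<and> (check_ord x \<^bold>\<in> A) (r x) \<and> e \<in> B \<and> \<phi> (x, e) (r x) \<and>
      (\<forall>n<N. g n \<in> F \<and> has_value f x n (g n) (r x))"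
    unfolding bchoice_iff by blast
  then obtain e where "\<forall>x\<in>E. \<exists>g. q \<preceq> r x \<and> (check_ord x \<^bold>\<in> A) (r x) \<and> e x \<in> B \<and> \<phi> (x, e x) (r x) \<and>
      (\<forall>n<N. g n \<in> F \<and> has_value f x n (g n) (r x))"
    unfolding bchoice_iff by blast
  then obtain g where data: "\<forall>x\<in>E. q \<preceq> r x \<and> (check_ord x \<^bold>\<in> A) (r x) \<and> e x \<in> B \<and> \<phi> (x, e x) (r x) \<and>
      (\<forall>n<N. g x n \<in> F \<and> has_value f x n (g x n) (r x))"
    unfolding bchoice_iff by blast
  have r: "q \<preceq> r x" and rA: "(check_ord x \<^bold>\<in> A) (r x)" and eB: "e x \<in> B" and r\<phi>: "\<phi> (x, e x) (r x)"
    if "x \<in> E" for x using data that by blast+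
  have gF: "g x n \<in> F" and gval: "has_value f x n (g x n) (r x)"
    if "x \<in> E" "n < N" for x n using data that by blast+
  have xe: "x \<le> e x" if "x \<in> E" for x using r\<phi>[OF that] unfolding \<phi>_def by simp

  \<comment> \<open>Indices without conflict have disjoint intervals \<open>{x..e x}\<close>, so that \<open>e\<close> is increasing and increasing
    sequences of values \<open>e x\<close> come from increasing sequences of indices.\<close>
  define C where "C x y \<longleftrightarrow> x < y \<and> y \<le> e x \<or> y < x \<and> x \<le> e y" for x y
  have C1: "countable {y\<in>E. C x y}" for x
    by (rule countable_subset[of _ "{..e x} \<union> {..<x}"])
      (auto simp: C_def countable_atMost_w1 countable_lessThan_w1)
  have C2: "C x y \<Longrightarrow> C y x" for x y unfolding C_def by blast
  have "\<exists>A\<subseteq>E. uncountable A \<and> (\<forall>x\<in>A. \<forall>y\<in>A. x \<noteq> y \<longrightarrow> \<not> C x y) \<and>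
    ensured_by_growth F A (\<lambda>s k. grows_at g N s k \<and> (\<exists>t\<in>Field R. forces_inf_gen R t (\<lambda>i. r (s i))))"
    using sweet E r f(2) gF gval C1 C2 by (rule thin_and_grow)
  then obtain A4 K' l and J :: nat where A4: "A4 \<subseteq> E" "uncountable A4"
    and sep: "\<forall>x\<in>A4. \<forall>y\<in>A4. x \<noteq> y \<longrightarrow> \<not> C x y"
    and l: "\<forall>x\<in>A4. \<forall>j<J. l x j \<in> F" "inj_on (\<lambda>(x, j). l x j) (A4 \<times> {..<J})"
    and grow: "growth_ensures l J K' A4 (\<lambda>s k. grows_at g N s k \<and> (\<exists>t\<in>Field R. forces_inf_gen R t (\<lambda>i. r (s i))))"
    by (elim exE conjE) (rule that)
  have e_less: "e x < e y" if "x \<in> A4" "y \<in> A4" "x < y" for x y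
  proof -
    have "\<not> C x y" using bspec[OF bspec[OF sep that(1)] that(2)] that(3) by blast
    then have "e x < y" using that(3) unfolding C_def by (meson not_le)
    also have "y \<le> e y" using xe A4(1) that(2) by blast
    finally show ?thesis .
  qed
  have e_inj: "inj_on e A4"
  proof (rule inj_onI)
    fix x y assume "x \<in> A4" "y \<in> A4" "e x = e y"
    then show "x = y" using e_less[of x y] e_less[of y x] by (cases x y rule: linorder_cases) simp_all
  qed
  define d where "d = inv_into A4 e"
  have d: "d z \<in> A4" "e (d z) = z" if "z \<in> e ` A4" for z
    using inv_into_into[OF that] f_inv_into_f[OF that] unfolding d_def .
  have good: "\<exists>t v. t \<in> Field R \<and> v \<in> fst ` elts Q \<and> (v \<^bold>\<in> Q) t \<and>
      pair_forces_inf_gen Q L t v (\<lambda>i. c (s i)) (\<lambda>i. w (s i))"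
    if s: "strict_mono s" "range s \<subseteq> e ` A4" "max K K' < k"
      "\<forall>i. \<forall>j<J. l (d (s i)) j k < l (d (s (Suc i))) j k" for s k
  proof -
    define \<xi> where "\<xi> i = d (s i)" for i :: nat
    have sA: "s i \<in> e ` A4" for i using s(2) by blast
    have \<xi>A: "\<xi> i \<in> A4" and e\<xi>: "e (\<xi> i) = s i" for i
      using d[OF sA] unfolding \<xi>_def by simp_all
    have \<xi>E: "\<xi> i \<in> E" for i using \<xi>A A4(1) by blast
    have sm: "strict_mono \<xi>"
    proof (rule strict_monoI)
      fix i j :: nat assume "i < j"
      then have "e (\<xi> i) < e (\<xi> j)" unfolding e\<xi> using strict_monoD[OF s(1)] by blast
      then show "\<xi> i < \<xi> j"
        using e_less[OF \<xi>A \<xi>A, of j i] by (cases "\<xi> i" "\<xi> j" rule: linorder_cases) simp_all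
    qed
    have growing: "grows_at g N \<xi> k \<and> (\<exists>t\<in>Field R. forces_inf_gen R t (\<lambda>i. r (\<xi> i)))"
    proof (rule grow[THEN spec, of \<xi>, THEN spec, of k, THEN mp, THEN mp, THEN mp, THEN mp])
      show "range \<xi> \<subseteq> A4" using \<xi>A by blast
      show "K' < k" using s(3) by simp
      show "grows_at l J \<xi> k" using s(4) unfolding \<xi>_def .
    qed (rule sm)
    obtain t0 where t0: "t0 \<in> Field R" "forces_inf_gen R t0 (\<lambda>i. r (\<xi> i))" using growing by blast
    obtain t1 i0 where t1: "t0 \<preceq> t1" "r (\<xi> i0) \<preceq> t1" using forces_inf_gen_obtain[OF t0(2,1)] by blast
    have qt1: "q \<preceq> t1" using R_trans[OF r[OF \<xi>E] t1(2)] .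
    note Ft1 = F[OF qt1]
    interpret generic_subsequence R \<xi> "\<lambda>i. r (\<xi> i)" t1
      by unfold_locales (use sm Ft1 forces_inf_gen_mono[OF t0(2) t1(1)] in auto)
    have sub_fun: "f_fun R generic_seq (\<lambda>i. i \<^bold>\<in> check_omega) A t1"
      by (rule f_fun_generic_seq) (use mem_mono[OF rA[OF \<xi>E]] in blast)
    have sub_grows: "f_grows R generic_seq f (check_nat k) nstar t1"
      by (rule f_grows_generic_seq[OF stableD[OF stable_f_fun f(1) qt1] eq_mono[OF q1(2) qt1], of "\<lambda>i. g (\<xi> i)"])
        (use mem_mono[OF gval[OF \<xi>E]] growing in blast)+
    have "(kstar \<^bold>\<in> check_nat k) t1"
      using mem_cong_left[OF eq_mono[OF kq qt1] check_nat_memI[OF _ Ft1]] s(3) by simp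
    then have "(check_nat k \<^bold>\<in> check_omega \<^bold>\<and> kstar \<^bold>\<in> check_nat k \<^bold>\<and> f_grows R generic_seq f (check_nat k) nstar) t1"
      using mem_omegaI[OF Ft1] sub_grows by (intro f_andI)
    then have ex_k: "f_ex R (\<lambda>k. k \<^bold>\<in> check_omega \<^bold>\<and> kstar \<^bold>\<in> k \<^bold>\<and> f_grows R generic_seq f k nstar) t1"
      by (rule f_exI[OF is_name_check_nat, rotated]) (intro stable_intros stable_f_grows)

    have "f_imp R (f_fun R generic_seq (\<lambda>i. i \<^bold>\<in> check_omega) A) (f_imp R (f_increasing R generic_seq)
      (f_imp R (f_ex R (\<lambda>k. k \<^bold>\<in> check_omega \<^bold>\<and> kstar \<^bold>\<in> k \<^bold>\<and> f_grows R generic_seq f k nstar))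
        (f_ex R (\<lambda>r. r \<^bold>\<in> Q \<^bold>\<and> f_forces_inf_gen R Q L r ps generic_seq)))) t1"
      using stableD[OF stable_imp allD[OF works is_name_generic_seq] R_trans[OF q0q qt1]] .
    from imp_stepD[OF this Ft1 sub_fun] obtain t2 where t2: "t1 \<preceq> t2" "f_imp R (f_increasing R generic_seq)
      (f_imp R (f_ex R (\<lambda>k. k \<^bold>\<in> check_omega \<^bold>\<and> kstar \<^bold>\<in> k \<^bold>\<and> f_grows R generic_seq f k nstar))
        (f_ex R (\<lambda>r. r \<^bold>\<in> Q \<^bold>\<and> f_forces_inf_gen R Q L r ps generic_seq))) t2" .
    obtain t3 where t3: "t2 \<preceq> t3" "f_imp R (f_ex R (\<lambda>k. k \<^bold>\<in> check_omega \<^bold>\<and> kstar \<^bold>\<in> k \<^bold>\<and> f_grows R generic_seq f k nstar))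
        (f_ex R (\<lambda>r. r \<^bold>\<in> Q \<^bold>\<and> f_forces_inf_gen R Q L r ps generic_seq)) t3"
      using imp_stepD[OF t2(2) F[OF t2(1)] f_increasing_generic_seq] .
    obtain t4 where t4: "t3 \<preceq> t4" "f_ex R (\<lambda>r. r \<^bold>\<in> Q \<^bold>\<and> f_forces_inf_gen R Q L r ps generic_seq) t4"
      using imp_stepD[OF t3(2) F[OF t3(1)] stableD[OF stable_ex ex_k R_trans[OF t2(1) t3(1)]]] .
    obtain t5 v0 where t5: "t4 \<preceq> t5" "is_name R v0" "(v0 \<^bold>\<in> Q \<^bold>\<and> f_forces_inf_gen R Q L v0 ps generic_seq) t5"
      using ex_obtain[OF t4(2) F[OF t4(1)]] .
    have v0: "(v0 \<^bold>\<in> Q) t5" "f_forces_inf_gen R Q L v0 ps generic_seq t5" using t5(3) unfolding f_and_iff by blast+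
    obtain t v where t: "t5 \<preceq> t" "v \<in> fst ` elts Q" "(v \<^bold>\<in> Q) t" "(v0 \<^bold>= v) t"
      by (rule mem_obtain[OF v0(1) F[OF t5(1)]]) (metis fst_conv imageI mem_eltsI)
    have t1t: "t1 \<preceq> t"
      using R_trans[OF t2(1) R_trans[OF t3(1) R_trans[OF t4(1) R_trans[OF t5(1) t(1)]]]] .
    have "\<exists>u' i z. u \<preceq> u' \<and> m < i \<and> c (s i) \<preceq> u' \<and> z \<in> fst ` elts Q \<and> (z \<^bold>\<in> Q) u' \<and>
            (opair y z \<^bold>\<in> L) u' \<and> (opair (w (s i)) z \<^bold>\<in> L) u'"
      if u: "t \<preceq> u" and y: "is_name R y" "(y \<^bold>\<in> Q) u" "(opair v y \<^bold>\<in> L) u" for m u y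
    proof -
      have v0y: "(opair v0 y \<^bold>\<in> L) u" using pair_mem_cong[OF y(3) eq_sym[OF eq_mono[OF t(4) u]] eq_refl] .
      obtain u7 \<tau> i \<alpha> x where uu7: "u \<preceq> u7" and \<tau>: "is_name R \<tau>" and x: "is_name R x"
        and h: "(\<tau> \<^bold>\<in> Q) u7 \<and> (opair y \<tau> \<^bold>\<in> L) u7 \<and> (i \<^bold>\<in> check_omega) u7 \<and> (check_nat m \<^bold>\<in> i) u7 \<and>
          (opair i \<alpha> \<^bold>\<in> generic_seq) u7 \<and> (opair \<alpha> x \<^bold>\<in> ps) u7 \<and> f_forces_gen R Q L \<tau> x u7"
        using f_forces_inf_gen_obtain[OF stableD[OF stable_f_forces_inf_gen v0(2) R_trans[OF t(1) u]] F[OF u] y(1,2) v0y] .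
      \<comment> \<open>Deciding the entry of the subsequence at \<open>i\<close> gives an \<open>a\<close>, not below \<open>i\<close> and hence above \<open>m\<close>, for which
        \<open>r (\<xi> a)\<close> and thereby \<open>c (s a)\<close> is generic.\<close>
      obtain u8 j a where u8: "u7 \<preceq> u8" "(i \<^bold>= check_nat j) u8" "(\<alpha> \<^bold>= check_ord (\<xi> a)) u8" "nth_met j a u8"
        using mem_generic_seq_obtain[of i \<alpha> u7] h F[OF uu7] by blast
      have "(check_nat m \<^bold>\<in> check_nat j) u8" using mem_cong_right[OF mem_mono[OF _ u8(1)] u8(2)] h by blast
      then have "m < j" using check_nat_memD[OF _ F[OF u8(1)]] by blast
      then have ma: "m < a" using nth_met_le[OF u8(4)] by simp
      have ru8: "r (\<xi> a) \<preceq> u8" using u8(4) unfolding nth_met_def by blast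
      have "(opair \<alpha> x \<^bold>\<in> ps) u8" using mem_mono[OF _ u8(1)] h by blast
      then have "(opair \<alpha> x \<^bold>\<in> comp_name (UNIV \<times> B) (\<lambda>x. opair (check_ord (fst x)) (w (snd x))) \<phi>) u8"
        unfolding ps_def .
      then obtain u9 z0 where u9: "u8 \<preceq> u9" "z0 \<in> UNIV \<times> B"
          "(opair \<alpha> x \<^bold>= opair (check_ord (fst z0)) (w (snd z0))) u9" "\<phi> z0 u9"
        by (rule mem_comp_obtain[OF I stable _ F[OF u8(1)]])
      note F9 = F[OF u9(1)] and eqs = opair_eqD[OF u9(3) F[OF u9(1)]]
      have fst0: "fst z0 = fst (\<xi> a, e (\<xi> a))"
        using check_ord_eqD[OF eq_trans[OF eq_sym[OF eq_mono[OF u8(3) u9(1)]] eqs(1)] F9] by (simp only: fst_conv)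
      have \<phi>9: "\<phi> (\<xi> a, e (\<xi> a)) u9" using stableD[OF stable r\<phi>[OF \<xi>E] R_trans[OF ru8 u9(1)]] .
      have in9: "(\<xi> a, e (\<xi> a)) \<in> UNIV \<times> B" using eB[OF \<xi>E] by simp
      have "snd z0 = snd (\<xi> a, e (\<xi> a))"
        by (rule \<phi>_unique[OF u9(2) in9 u9(4) \<phi>9 fst0 F9])
      then have z0: "snd z0 = s a" by (simp only: snd_conv e\<xi>)
      have c9: "c (s a) \<preceq> u9" using u9(4) z0 unfolding \<phi>_def by simp
      have xw: "(x \<^bold>= w (s a)) u9" using eqs(2) unfolding z0 .
      \<comment> \<open>As \<open>\<tau>\<close> forces \<open>x\<close>, that is \<open>w (s a)\<close>, to be generic, it has a common upper bound with it: in
        \<open>f_forces_gen\<close> the extension of \<open>\<tau>\<close> can be taken to be \<open>\<tau>\<close>.\<close>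
      have u79: "u7 \<preceq> u9" using R_trans[OF u8(1) u9(1)] .
      have \<tau>9: "(\<tau> \<^bold>\<in> Q) u9" "(opair y \<tau> \<^bold>\<in> L) u9" using mem_mono[OF _ u79] h by blast+
      have "f_imp R (\<tau> \<^bold>\<in> Q) (f_imp R (opair \<tau> \<tau> \<^bold>\<in> L)
          (f_ex R (\<lambda>v. v \<^bold>\<in> Q \<^bold>\<and> opair \<tau> v \<^bold>\<in> L \<^bold>\<and> opair x v \<^bold>\<in> L))) u7"
        using h \<tau> unfolding f_forces_gen_def f_all_iff by blast
      note imp9 = stableD[OF stable_imp this u79]
      obtain u10 where u10: "u9 \<preceq> u10" "f_imp R (opair \<tau> \<tau> \<^bold>\<in> L)
          (f_ex R (\<lambda>v. v \<^bold>\<in> Q \<^bold>\<and> opair \<tau> v \<^bold>\<in> L \<^bold>\<and> opair x v \<^bold>\<in> L)) u10"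
        using imp_stepD[OF imp9 F9 \<tau>9(1)] .
      note F10 = F[OF u10(1)]
      obtain u11 where u11: "u10 \<preceq> u11" "f_ex R (\<lambda>v. v \<^bold>\<in> Q \<^bold>\<and> opair \<tau> v \<^bold>\<in> L \<^bold>\<and> opair x v \<^bold>\<in> L) u11"
        using imp_stepD[OF u10(2) F10 forcing_notion_refl[OF Q_fn[OF F10] F10 \<tau> mem_mono[OF \<tau>9(1) u10(1)]]] .
      obtain u12 z1 where u12: "u11 \<preceq> u12" "is_name R z1"
          "(z1 \<^bold>\<in> Q \<^bold>\<and> opair \<tau> z1 \<^bold>\<in> L \<^bold>\<and> opair x z1 \<^bold>\<in> L) u12"
        using ex_obtain[OF u11(2) F[OF u11(1)]] .
      note F12 = F[OF u12(1)]
      have z1: "(z1 \<^bold>\<in> Q) u12" "(opair \<tau> z1 \<^bold>\<in> L) u12" "(opair x z1 \<^bold>\<in> L) u12"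
        using u12(3) unfolding f_and_iff by blast+
      have u912: "u9 \<preceq> u12" using R_trans[OF u10(1) R_trans[OF u11(1) u12(1)]] .
      have uu12: "u \<preceq> u12" using R_trans[OF uu7 R_trans[OF u79 u912]] .
      have yz1: "(opair y z1 \<^bold>\<in> L) u12"
        using forcing_notion_trans[OF Q_fn[OF F12] F12 y(1) \<tau> u12(2) mem_mono[OF y(2) uu12]
            mem_mono[OF \<tau>9(1) u912] z1(1) mem_mono[OF \<tau>9(2) u912] z1(2)] .
      obtain u13 z where u13: "u12 \<preceq> u13" "z \<in> fst ` elts Q" "(z \<^bold>\<in> Q) u13" "(z1 \<^bold>= z) u13"
        by (rule mem_obtain[OF z1(1) F12]) (metis fst_conv imageI mem_eltsI)
      have "(opair y z \<^bold>\<in> L) u13" using pair_mem_cong[OF mem_mono[OF yz1 u13(1)] eq_refl u13(4)] .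
      moreover have "(opair (w (s a)) z \<^bold>\<in> L) u13"
        using pair_mem_cong[OF mem_mono[OF z1(3) u13(1)] eq_mono[OF xw R_trans[OF u912 u13(1)]] u13(4)] .
      moreover have "c (s a) \<preceq> u13" using R_trans[OF c9 R_trans[OF u912 u13(1)]] .
      ultimately show ?thesis
        using R_trans[OF uu12 u13(1)] ma u13(2,3) by (intro exI[of _ u13] exI[of _ a] exI[of _ z] conjI)
    qed
    then show ?thesis using F[OF t1t] t(2,3) by blast
  qed
  have "e ` A4 \<subseteq> B" using eB A4(1) by blast
  moreover have "uncountable (e ` A4)" using A4(2) countable_image_inj_on[OF _ e_inj] by blast
  moreover have "\<forall>z\<in>e ` A4. \<forall>j<J. l (d z) j \<in> F" using l(1) d(1) by blast
  moreover have "inj_on (\<lambda>(z, j). l (d z) j) (e ` A4 \<times> {..<J})"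
  proof (rule inj_onI)
    fix x y assume h: "x \<in> e ` A4 \<times> {..<J}" "y \<in> e ` A4 \<times> {..<J}"
      "(\<lambda>(z, j). l (d z) j) x = (\<lambda>(z, j). l (d z) j) y"
    obtain z i z' j where xy: "x = (e z, i)" "y = (e z', j)" "z \<in> A4" "z' \<in> A4" "i < J" "j < J"
      using h(1,2) by blast
    have "d (e z) = z" "d (e z') = z'" using xy(3,4) e_inj unfolding d_def by simp_all
    then have "z = z' \<and> i = j" using inj_onD[OF l(2), of "(z, i)" "(z', j)"] h(3) xy by simp
    then show "x = y" using xy(1,2) by simp
  qed
  ultimately show ?thesis
    using good by (intro exI[of _ "e ` A4"] conjI exI[of _ "max K K'"] exI[of _ J] exI[of _ "\<lambda>z. l (d z)"] allI impI)
qed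

end

section \<open>Sweetness of the iteration\<close>

text \<open>The parts of the sets \<open>S i\<close> outside \<open>D\<close> are pairwise disjoint, and a finite set meets only finitely many of them.\<close>

lemma eventually_disjoint:
  fixes S :: "nat \<Rightarrow> 'b set"
  assumes X: "finite X" and S: "\<And>i j. i \<noteq> j \<Longrightarrow> S i \<inter> S j \<subseteq> D"
  obtains M where "\<And>i. M < i \<Longrightarrow> S i \<inter> X \<subseteq> D"
proof -
  let ?I = "{i. \<not> S i \<inter> X \<subseteq> D}"
  define a where "a i = (SOME x. x \<in> S i \<inter> X \<and> x \<notin> D)" for i
  have a: "a i \<in> S i \<inter> X \<and> a i \<notin> D" if "i \<in> ?I" for i
    unfolding a_def by (rule someI_ex) (use that in blast)
  have "inj_on a ?I"
  proof (rule inj_onI, rule ccontr)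
    fix i j assume h: "i \<in> ?I" "j \<in> ?I" "a i = a j" "i \<noteq> j"
    then show False using a[OF h(1)] a[OF h(2)] S[OF h(4)] by auto
  qed
  moreover have "finite (a ` ?I)" by (rule finite_subset[OF _ X]) (use a in blast)
  ultimately have "finite ?I" using finite_imageD by blast
  then obtain M where M: "\<forall>i\<in>?I. i < M" unfolding finite_nat_set_iff_bounded by blast
  show thesis
  proof (rule that[of M])
    fix i assume "M < i"
    then have "i \<notin> ?I" using M by auto
    then show "S i \<inter> X \<subseteq> D" by blast
  qed
qed

context fs_iter
begin

text \<open>Below \<open>\<beta>\<close> the condition \<open>y\<close> is already stronger than \<open>x\<close>, and above \<open>\<beta>\<close> the domains are
  disjoint.\<close>

lemma merge_above:
  assumes \<alpha>: "\<alpha> \<le> \<gamma>" and x: "x \<in> Field (P \<alpha>)" and y: "y \<in> Field (P \<alpha>)" and \<beta>: "\<beta> < \<alpha>"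
    and below: "(x |` {..<\<beta>}, y |` {..<\<beta>}) \<in> P \<beta>"
    and at: "\<beta> \<in> dom x \<inter> dom y \<Longrightarrow> f_mem (P \<beta>) (opair (the (x \<beta>)) (the (y \<beta>))) (L \<beta>) (y |` {..<\<beta>})"
    and above: "\<And>\<epsilon>. \<epsilon> \<in> dom x \<inter> dom y \<Longrightarrow> \<epsilon> \<le> \<beta>"
  shows "(x, x ++ y) \<in> P \<alpha>" "(y, x ++ y) \<in> P \<alpha>" "(x ++ y) |` {..<\<beta>} = y |` {..<\<beta>}"
proof -
  have \<beta>\<gamma>: "\<beta> \<le> \<gamma>" using \<alpha> \<beta> by simp
  have sub: "dom (x |` {..<\<beta>}) \<subseteq> dom (y |` {..<\<beta>})"
    and le: "\<And>\<epsilon>. \<epsilon> \<in> dom (x |` {..<\<beta>}) \<Longrightarrow> f_mem (P \<epsilon>) (opair (the ((x |` {..<\<beta>}) \<epsilon>)) (the ((y |` {..<\<beta>}) \<epsilon>)))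
      (L \<epsilon>) ((y |` {..<\<beta>}) |` {..<\<epsilon>})"
    using below unfolding P_iff[OF \<beta>\<gamma>] by blast+
  have dxy: "\<delta> \<in> dom y" if "\<delta> \<in> dom x" "\<delta> < \<beta>" for \<delta>
  proof -
    have "\<delta> \<in> dom (x |` {..<\<beta>})" using that by (simp only: dom_restrict Int_iff lessThan_iff)
    then show ?thesis using sub by (auto simp only: dom_restrict)
  qed
  have r: "(x ++ y) |` {..<\<epsilon>} = y |` {..<\<epsilon>}" if "\<epsilon> \<le> \<beta>" for \<epsilon>
  proof
    fix \<delta>
    show "((x ++ y) |` {..<\<epsilon>}) \<delta> = (y |` {..<\<epsilon>}) \<delta>"
    proof (cases "\<delta> < \<epsilon>")
      case True
      then have "\<delta> \<in> dom x \<Longrightarrow> \<delta> \<in> dom y" using dxy that by simp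
      then have "(x ++ y) \<delta> = y \<delta>" by (cases "y \<delta>") (auto simp: map_add_def)
      then show ?thesis by (simp add: restrict_map_def)
    qed (simp add: restrict_map_def)
  qed
  have "(x, x ++ y) \<in> P \<alpha> \<and> (y, x ++ y) \<in> P \<alpha>"
  proof (rule union_conditions[OF \<alpha> x y])
    fix \<epsilon> assume \<epsilon>: "\<epsilon> \<in> dom x \<inter> dom y"
    have le\<beta>: "\<epsilon> \<le> \<beta>" using above[OF \<epsilon>] .
    show "f_mem (P \<epsilon>) (opair (the (x \<epsilon>)) (the (y \<epsilon>))) (L \<epsilon>) ((x ++ y) |` {..<\<epsilon>})"
    proof (cases "\<epsilon> = \<beta>")
      case True
      show ?thesis using at \<epsilon> unfolding True r[OF order_refl] by blast
    next
      case False
      then have lt: "\<epsilon> < \<beta>" using le\<beta> by simp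
      then have "\<epsilon> \<in> dom (x |` {..<\<beta>})" using \<epsilon> by (simp only: dom_restrict Int_iff lessThan_iff)
      moreover have "(x |` {..<\<beta>}) \<epsilon> = x \<epsilon>" "(y |` {..<\<beta>}) \<epsilon> = y \<epsilon>" using lt by simp_all
      ultimately show ?thesis using le[of \<epsilon>] unfolding r[OF le\<beta>] restrict_lessThan_twice[OF le\<beta>] by simp
    qed
  qed
  then show "(x, x ++ y) \<in> P \<alpha>" "(y, x ++ y) \<in> P \<alpha>" by blast+
  show "(x ++ y) |` {..<\<beta>} = y |` {..<\<beta>}" using r[OF order_refl] .
qed

text \<open>With the domains forming a \<open>\<Delta>\<close>-system, a condition \<open>q\<close> interferes with almost all members of a sequence only on the root.
  So once the restrictions to the maximum \<open>\<beta>\<close> of the root and the values at \<open>\<beta>\<close> are amalgamated, which is a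
  matter of \<open>P \<beta>\<close> and \<open>Q \<beta>\<close>, the union with the remaining parts is a condition.\<close>

lemma sweet_iteration:
  assumes F: "spread F"
    and Q_sweet: "\<And>\<beta>. \<beta> < \<gamma> \<Longrightarrow> forced (P \<beta>) (f_sweet (P \<beta>) (check_family F) (Q \<beta>) (L \<beta>))"
  shows "\<alpha> \<le> \<gamma> \<Longrightarrow> sweet F (P \<alpha>)"
proof (induction \<alpha> rule: less_induct)
  case (less \<alpha>)
  note \<alpha> = less.prems
  interpret A: forcing_poset "P \<alpha>" using P_poset[OF \<alpha>] .
  show ?case
  proof (rule sweetI[OF A.forcing_notion_R])
    fix p :: "w1 \<Rightarrow> ('a, 'i) cond" assume pF: "\<And>x. p x \<in> Field (P \<alpha>)"
    have pc: "p x \<in> iter_conds P Q \<alpha>" for x using pF Field_P[OF \<alpha>] by simp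
    have fin: "finite (dom (p x))" for x using iter_conds_dom[OF pc] by blast
    have "\<exists>B\<subseteq>UNIV. uncountable B \<and> (\<exists>D. \<forall>x\<in>B. \<forall>y\<in>B. x \<noteq> y \<longrightarrow> dom (p x) \<inter> dom (p y) = D)"
      by (rule uncountable_Delta_system[OF uncountable_UNIV_w1 fin])
    then obtain B D where B: "uncountable B" and D: "\<forall>x\<in>B. \<forall>y\<in>B. x \<noteq> y \<longrightarrow> dom (p x) \<inter> dom (p y) = D"
      by (elim exE conjE) (rule that)
    have almost: "\<exists>M. \<forall>i>M. dom (p (s i)) \<inter> X \<subseteq> D" if s: "strict_mono s" "range s \<subseteq> B" and X: "finite X"
      for s :: "nat \<Rightarrow> w1" and X
    proof -
      have "dom (p (s i)) \<inter> dom (p (s j)) \<subseteq> D" if "i \<noteq> j" for i j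
      proof -
        have "s i \<in> B" "s j \<in> B" using s(2) by blast+
        moreover have "s i \<noteq> s j" using that strict_mono_eq[OF s(1)] by simp
        ultimately show ?thesis using bspec[OF bspec[OF D, of "s i"], of "s j"] by blast
      qed
      from eventually_disjoint[OF X, of "\<lambda>i. dom (p (s i))" D, OF this] show ?thesis by blast
    qed
    show "\<exists>A. uncountable A \<and> ensured_by_growth F A (\<lambda>s k. \<exists>r\<in>Field (P \<alpha>). forces_inf_gen (P \<alpha>) r (\<lambda>i. p (s i)))"
    proof (cases "D = {}")
      case True
      have "\<exists>r\<in>Field (P \<alpha>). forces_inf_gen (P \<alpha>) r (\<lambda>i. p (s i))" if s: "strict_mono s" "range s \<subseteq> B" for s
      proof (rule bexI[OF _ A.empty_in_Field])
        show "forces_inf_gen (P \<alpha>) Map.empty (\<lambda>i. p (s i))"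
          unfolding forces_inf_gen_def
        proof (intro allI impI)
          fix m q assume "(Map.empty, q) \<in> P \<alpha>"
          then have q: "q \<in> Field (P \<alpha>)" by (rule A.le_Field)
          then have "finite (dom q)" using iter_conds_dom Field_P[OF \<alpha>] by blast
          then obtain M where M: "\<forall>i>M. dom (p (s i)) \<inter> dom q \<subseteq> D" using almost[OF s] by blast
          define i where "i = Suc (max m M)"
          have "dom (p (s i)) \<inter> dom q = {}" using M True by (simp add: i_def)
          then have "(p (s i), p (s i) ++ q) \<in> P \<alpha> \<and> (q, p (s i) ++ q) \<in> P \<alpha>"
            by (intro union_conditions[OF \<alpha> pF q]) blast
          moreover have "m < i" by (simp add: i_def)
          ultimately show "\<exists>r i. (q, r) \<in> P \<alpha> \<and> m < i \<and> forces_gen (P \<alpha>) r (p (s i))"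
            using A.forces_gen_le by blast
        qed
      qed
      \<comment> \<open>Every increasing sequence has the required property, so an empty list of functions will do.\<close>
      then show ?thesis
        using B by (intro exI[of _ B] conjI exI[of _ 0] exI[of _ "0 :: nat"] exI[of _ "\<lambda>x n. undefined"] allI impI) simp_all
    next
      case False
      have Ddom: "D \<subseteq> dom (p x)" if xB: "x \<in> B" for x
      proof -
        have "\<not> B \<subseteq> {x}"
        proof
          assume "B \<subseteq> {x}"
          then have "countable B" by (rule countable_subset) simp
          with B show False by simp
        qed
        then obtain y where y: "y \<in> B" "x \<noteq> y" unfolding subset_iff singleton_iff by metis
        have "dom (p x) \<inter> dom (p y) = D" using mp[OF bspec[OF bspec[OF D xB] y(1)] y(2)] .
        from this[symmetric] show ?thesis by (rule ssubst) (rule Int_lower1)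
      qed
      have "B \<noteq> {}" using B by auto
      then obtain x0 where x0: "x0 \<in> B" by blast
      have finD: "finite D" using finite_subset[OF Ddom[OF x0] fin] .
      define \<beta> where "\<beta> = Max D"
      have \<beta>D: "\<beta> \<in> D" and le\<beta>: "\<And>\<epsilon>. \<epsilon> \<in> D \<Longrightarrow> \<epsilon> \<le> \<beta>"
        unfolding \<beta>_def using finD False by (simp_all add: Max_ge)
      have \<beta>dom: "\<beta> \<in> dom (p x)" if "x \<in> B" for x using Ddom[OF that] \<beta>D by blast
      have \<beta>\<alpha>: "\<beta> < \<alpha>" using iter_condsD(1)[OF pc \<beta>dom[OF x0]] .
      then have \<beta>\<gamma>: "\<beta> < \<gamma>" using \<alpha> by simp
      have IH: "sweet F (P \<beta>)" using less.IH[OF \<beta>\<alpha>] \<beta>\<gamma> by simp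
      interpret B: ccc_poset "P \<beta>"
        using forcing_poset.ccc_poset_if_sweet[OF P_poset F IH] \<beta>\<gamma> by simp
      define c where "c x = p x |` {..<\<beta>}" for x
      define w where "w x = the (p x \<beta>)" for x
      have Qs: "f_sweet (P \<beta>) (check_family F) (Q \<beta>) (L \<beta>) q" if "q \<in> Field (P \<beta>)" for q
        using Q_sweet[OF \<beta>\<gamma>] that unfolding forced_def by blast
      have cF: "c x \<in> Field (P \<beta>)" if "x \<in> B" for x
        unfolding c_def using iter_condsD(2)[OF pc \<beta>dom[OF that]] .
      have wn: "is_name (P \<beta>) (w x)" if "x \<in> B" for x
        unfolding w_def using coordinate_name[OF pc \<alpha> \<beta>dom[OF that] B.forcing_poset_axioms] .
      have wQ: "f_mem (P \<beta>) (w x) (Q \<beta>) (c x)" if "x \<in> B" for x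
        unfolding w_def c_def using iter_condsD(4)[OF pc \<beta>dom[OF that]] .
      have "\<exists>A\<subseteq>B. uncountable A \<and> ensured_by_growth F A (\<lambda>s k. \<exists>t v. t \<in> Field (P \<beta>) \<and> v \<in> fst ` elts (Q \<beta>) \<and>
          f_mem (P \<beta>) v (Q \<beta>) t \<and> B.pair_forces_inf_gen (Q \<beta>) (L \<beta>) t v (\<lambda>i. c (s i)) (\<lambda>i. w (s i)))"
        using IH Qs is_name_Q[OF \<beta>\<gamma>] B cF wn wQ by (rule B.two_step)
      then obtain A K J l where A: "A \<subseteq> B" "uncountable A" and l: "\<forall>x\<in>A. \<forall>j<J. l x j \<in> F"
        "inj_on (\<lambda>(x, j). l x j) (A \<times> {..<J :: nat})"
        and good: "growth_ensures l J K A (\<lambda>s k. \<exists>t v. t \<in> Field (P \<beta>) \<and> v \<in> fst ` elts (Q \<beta>) \<and>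
          f_mem (P \<beta>) v (Q \<beta>) t \<and> B.pair_forces_inf_gen (Q \<beta>) (L \<beta>) t v (\<lambda>i. c (s i)) (\<lambda>i. w (s i)))"
        by (elim exE conjE) (rule that)
      have "\<exists>r\<in>Field (P \<alpha>). forces_inf_gen (P \<alpha>) r (\<lambda>i. p (s i))"
        if s: "strict_mono s" "range s \<subseteq> A" "K < k" "grows_at l J s k" for s k
      proof -
        have sB: "range s \<subseteq> B" using s(2) A(1) by (rule subset_trans)
        have siB: "s i \<in> B" for i using sB by blast
        obtain t v where t: "t \<in> Field (P \<beta>)" "v \<in> fst ` elts (Q \<beta>)" "f_mem (P \<beta>) v (Q \<beta>) t"
          and step: "B.pair_forces_inf_gen (Q \<beta>) (L \<beta>) t v (\<lambda>i. c (s i)) (\<lambda>i. w (s i))"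
          using good[THEN spec, of s, THEN spec, of k, THEN mp, OF s(1), THEN mp, OF s(2), THEN mp, OF s(3), THEN mp, OF s(4)]
          by (elim exE conjE) (rule that)
        \<comment> \<open>The condition \<open>(t, v)\<close> of the two-step iteration, read as a condition of \<open>P \<alpha>\<close>.\<close>
        define r where "r = t(\<beta> \<mapsto> v)"
        have rF: "r \<in> Field (P \<alpha>)" and rt: "r |` {..<\<beta>} = t"
          unfolding r_def using extend_condition[OF \<beta>\<alpha> \<alpha> t] .
        have "forces_inf_gen (P \<alpha>) r (\<lambda>i. p (s i))"
          unfolding forces_inf_gen_def
        proof (intro allI impI)
          fix m q assume rq: "(r, q) \<in> P \<alpha>"
          have q: "q \<in> Field (P \<alpha>)" using A.le_Field(2)[OF rq] .
          have qc: "q \<in> iter_conds P Q \<alpha>" using q Field_P[OF \<alpha>] by simp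
          have \<beta>r: "\<beta> \<in> dom r" "the (r \<beta>) = v" unfolding r_def by simp_all
          then have \<beta>q: "\<beta> \<in> dom q" using rq unfolding P_iff[OF \<alpha>] by blast
          define u where "u = q |` {..<\<beta>}"
          define y where "y = the (q \<beta>)"
          have tu: "(t, u) \<in> P \<beta>" using P_restrict[OF rq less_imp_le[OF \<beta>\<alpha>] \<alpha>] unfolding rt u_def .
          have yn: "is_name (P \<beta>) y" unfolding y_def using coordinate_name[OF qc \<alpha> \<beta>q B.forcing_poset_axioms] .
          have yQ: "f_mem (P \<beta>) y (Q \<beta>) u" unfolding y_def u_def using iter_condsD(4)[OF qc \<beta>q] .
          have vy: "f_mem (P \<beta>) (opair v y) (L \<beta>) u"
            using rq \<beta>r unfolding P_iff[OF \<alpha>] y_def u_def by blast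
          have "finite (dom q)" using iter_conds_dom[OF qc] by blast
          then obtain M where M: "\<forall>i>M. dom (p (s i)) \<inter> dom q \<subseteq> D" using almost[OF s(1) sB] by blast
          obtain u' i z where u': "(u, u') \<in> P \<beta>" and mi: "max m M < i" and ci: "(c (s i), u') \<in> P \<beta>"
            and z: "z \<in> fst ` elts (Q \<beta>)" "f_mem (P \<beta>) z (Q \<beta>) u'" and yz: "f_mem (P \<beta>) (opair y z) (L \<beta>) u'"
            and wz: "f_mem (P \<beta>) (opair (w (s i)) z) (L \<beta>) u'"
            using step[THEN spec, of "max m M", THEN spec, of u, THEN spec, of y, THEN mp, OF tu, THEN mp, OF yn,
              THEN mp, OF yQ, THEN mp, OF vy] by (elim exE conjE) (rule that)
          \<comment> \<open>Since \<open>r1\<close> extends \<open>q\<close> up to \<open>\<beta>\<close> and has no coordinates above, it is compatible with \<open>q\<close>.  The union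
            \<open>r2\<close> has the values of \<open>r1\<close> up to \<open>\<beta>\<close>, where it is stronger than \<open>p (s i)\<close>; and beyond \<open>\<beta>\<close> the domain of
            \<open>p (s i)\<close> misses that of \<open>q\<close> because \<open>i\<close> is larger than \<open>M\<close>.\<close>
          define r1 where "r1 = u'(\<beta> \<mapsto> z)"
          have r1F: "r1 \<in> Field (P \<alpha>)" and r1u: "r1 |` {..<\<beta>} = u'"
            unfolding r1_def using extend_condition[OF \<beta>\<alpha> \<alpha> B.le_Field(2)[OF u'] z] .
          have u'dom: "dom u' \<subseteq> {..<\<beta>}"
            using iter_conds_dom B.le_Field(2)[OF u'] Field_P[OF less_imp_le[OF \<beta>\<gamma>]] by blast
          have r1dom: "\<epsilon> \<le> \<beta>" if "\<epsilon> \<in> dom r1" for \<epsilon> using that u'dom unfolding r1_def by (auto split: if_splits)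
          have r1\<beta>: "r1 \<beta> = Some z" unfolding r1_def by simp
          define r2 where "r2 = q ++ r1"
          have r2: "(q, r2) \<in> P \<alpha>" "r2 |` {..<\<beta>} = u'"
          proof -
            have 1: "(q |` {..<\<beta>}, r1 |` {..<\<beta>}) \<in> P \<beta>" using u' unfolding u_def r1u .
            have 2: "f_mem (P \<beta>) (opair (the (q \<beta>)) (the (r1 \<beta>))) (L \<beta>) (r1 |` {..<\<beta>})"
              using yz unfolding y_def r1u r1\<beta> by simp
            note m = merge_above[OF \<alpha> q r1F \<beta>\<alpha> 1 2]
            show "(q, r2) \<in> P \<alpha>" unfolding r2_def by (rule m(1)) (use r1dom in blast)
            show "r2 |` {..<\<beta>} = u'" unfolding r2_def r1u[symmetric] by (rule m(3)) (use r1dom in blast)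
          qed
          have r2F: "r2 \<in> Field (P \<alpha>)" using A.le_Field(2)[OF r2(1)] .
          have r2\<beta>: "r2 \<beta> = Some z" unfolding r2_def using r1\<beta> by simp
          define r3 where "r3 = p (s i) ++ r2"
          have r3: "(p (s i), r3) \<in> P \<alpha> \<and> (r2, r3) \<in> P \<alpha>"
          proof -
            have 1: "(p (s i) |` {..<\<beta>}, r2 |` {..<\<beta>}) \<in> P \<beta>" using ci unfolding c_def r2(2) .
            have 2: "f_mem (P \<beta>) (opair (the (p (s i) \<beta>)) (the (r2 \<beta>))) (L \<beta>) (r2 |` {..<\<beta>})"
              using wz unfolding w_def r2(2) r2\<beta> by simp
            have 3: "\<epsilon> \<le> \<beta>" if "\<epsilon> \<in> dom (p (s i)) \<inter> dom r2" for \<epsilon>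
            proof (cases "\<epsilon> \<in> dom r1")
              case False
              then have "\<epsilon> \<in> dom (p (s i)) \<inter> dom q" using that unfolding r2_def by auto
              then have "\<epsilon> \<in> D" using M mi by auto
              then show ?thesis by (rule le\<beta>)
            qed (rule r1dom)
            note m = merge_above[OF \<alpha> pF r2F \<beta>\<alpha> 1 2]
            have "(p (s i), r3) \<in> P \<alpha>" unfolding r3_def by (rule m(1)) (rule 3)
            moreover have "(r2, r3) \<in> P \<alpha>" unfolding r3_def by (rule m(2)) (rule 3)
            ultimately show ?thesis by blast
          qed
          have "(q, r3) \<in> P \<alpha>" using A.R_trans[OF r2(1)] r3 by blast
          moreover have "m < i" using mi by simp
          moreover have "forces_gen (P \<alpha>) r3 (p (s i))" using A.forces_gen_le r3 by blast
          ultimately show "\<exists>r i. (q, r) \<in> P \<alpha> \<and> m < i \<and> forces_gen (P \<alpha>) r (p (s i))" by blast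
        qed
        with rF show ?thesis by blast
      qed
      then show ?thesis
        using A(2) l by (intro exI[of _ A] conjI exI[of _ K] exI[of _ J] exI[of _ l] allI impI)
    qed
  qed
qed

end

theorem theorem2p5:
  fixes F :: "(nat \<Rightarrow> nat) set"
    and \<gamma> :: "'a::wellorder"
    and P :: "'a \<Rightarrow> ('a, 'i) cond rel"
    and Q L :: "'a \<Rightarrow> ('a, 'i) nm"
  assumes "spread F"
    and "fs_iteration \<gamma> P Q L"
    and "\<And>\<alpha>. \<alpha> < \<gamma> \<Longrightarrow> forced (P \<alpha>) (f_spread (P \<alpha>) (check_family F))"
    and "\<And>\<alpha>. \<alpha> < \<gamma> \<Longrightarrow> forced (P \<alpha>) (f_sweet (P \<alpha>) (check_family F) (Q \<alpha>) (L \<alpha>))"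
  shows "sweet F (P \<gamma>) \<and> forced (P \<gamma>) (f_spread (P \<gamma>) (check_family F))"
proof -
  interpret fs_iter \<gamma> P Q L using assms(2) by (rule fs_iter.intro)
  interpret forcing_poset "P \<gamma>" using P_poset[OF order_refl] .
  have "sweet F (P \<gamma>)" using sweet_iteration[OF assms(1) _ order_refl] assms(4) by blast
  with forced_spread_if_sweet[OF assms(1)] show ?thesis by blast
qed

end
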